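(* Let $(\mathcal{X},\rho,\mu)$ be a space of homogeneous type satisfying the weak reverse doubling (WRD) condition and let $\Omega\subseteq\mathcal{X}$ be an open set satisfying the weak measure density (WMD) condition. Let $0<q<p<\infty$ and let $\phi\in\mathcal{G}^{\rm dec}_p$ satisfy both the nearness condition and that there exists $C_{(\phi)}\in(0,\infty)$ such that, for any $x\in\mathcal{X}$ and $r\in(0,\infty)$, $\int_r^\infty\frac{\phi(x,t)}{t}\,dt\le C_{(\phi)}\phi(x,r)$. Assume either that there exists $\widetilde{C}_{(\phi)}\in[1,\infty)$ such that, for any ball $B\subset\mathcal{X}$, $\frac1{\widetilde C_{(\phi)}}\le\phi(B)[\mu(B)]^{\frac1p}\le\widetilde C_{(\phi)}$, or that both $\lim_{r\to0^+}\inf_{x\in B}\phi(x,r)=\infty$ for any ball $B\subset\mathcal{X}$ and $\lim_{r\to\infty}\phi(x,r)[\mu(B(x,r))]^{\frac1p}=\infty$ for any $x\in\mathcal{X}$. Then there exist $C,\widetilde C\in(0,\infty)$ such that, for any $f\in[L_{p,\phi}(\Omega)/\mathbb{R}]\cap\bigcup_{s\in(0,1)}\dot W^{s,q}_{L_{p,\phi}}(\Omega)$, $$C\|f\|_{L_{p,\phi}(\Omega)/\mathbb{R}}\le\liminf_{s\to0^+}s^{\frac1q}\left\|\left\{\int_\Omega\frac{|f(\cdot)-f(y)|^q}{U(\cdot,y)[\rho(\cdot,y)]^{sq}}\,d\mu(y)\right\}^{\frac1q}\right\|_{L_{p,\phi}(\Omega)}\le\limsup_{s\to0^+}s^{\frac1q}\left\|\left\{\int_\Omega\frac{|f(\cdot)-f(y)|^q}{U(\cdot,y)[\rho(\cdot,y)]^{sq}}\,d\mu(y)\right\}^{\frac1q}\right\|_{L_{p,\phi}(\Omega)}\le\widetilde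 C\|f\|_{L_{p,\phi}(\Omega)/\mathbb{R}}.$$
   Context: A quasi-metric on a nonempty set $\mathcal{X}$ is $\rho:\mathcal{X}\times\mathcal{X}\to[0,\infty)$ with $\rho(x,y)=0$ iff $x=y$, $\rho(x,y)=\rho(y,x)$, and $\rho(x,z)\le K_0[\rho(x,y)+\rho(y,z)]$ for some constant $K_0\in[1,\infty)$. Balls: $B(x,r):=\{y:\rho(x,y)<r\}$. $(\mathcal{X},\rho,\mu)$ is a space of homogeneous type if $\rho$ is a quasi-metric, $\mu$ is a nonnegative measure on a $\sigma$-algebra containing all balls, and there is $L_{(\mu)}\in[1,\infty)$ with $0<\mu(B(x,2r))\le L_{(\mu)}\mu(B(x,r))<\infty$ for all $x,r$. WRD condition: there exist $x_0\in\mathcal{X}$ and $\lambda,C_{(\mu)}\in(1,\infty)$ with $\liminf_{r\to\infty}\frac{\mu(B(x_0,\lambda r))}{\mu(B(x_0,r))}\ge C_{(\mu)}$. WMD condition for $\Omega$: there exist $x_0\in\mathcal{X}$ and $C_0\in(0,1]$ with $\liminf_{r\to\infty}\frac{\mu(B(x_0,r)\cap\Omega)}{\mu(B(x_0,r))}\ge C_0$. $U(x,y):=\min\{\mu(B(x,\rho(x,y))),\mu(B(y,\rho(x,y)))\}$. The integrand $|f(x)-f(y)|^q/(U(x,y)[\rho(x,y)]^{sq})$ is read as $0$ at $y=x$. For $\phi:\mathcal{X}\times(0,\infty)\to(0,\infty)$ and a ball $B=B(x,r)$, write $\phi(B):=\phi(x,r)$. $\phi$ satisfies the nearness condition if there is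 $C>0$ with $\frac1C\le\frac{\phi(x,r)}{\phi(y,r)}\le C$ whenever $\rho(x,y)\le r$. A function $\psi:\mathcal{X}\times(0,\infty)\to(0,\infty)$ is almost increasing (resp. almost decreasing) in $r$ if there is $C>0$ with $\psi(x,r)\le C\psi(x,s)$ (resp. $C\psi(x,r)\ge\psi(x,s)$) for all $x\in\mathcal{X}$ and $0<r<s<\infty$. $\mathcal{G}^{\rm dec}_p$ is the set of $\phi:\mathcal{X}\times(0,\infty)\to(0,\infty)$ such that $r\mapsto[\mu(B(x,r))]^{1/p}\phi(x,r)$ is almost increasing and $r\mapsto\phi(x,r)$ is almost decreasing. $L_{p,\phi}(\mathcal{X})$ (generalized Morrey space): all $f\in L^p_{\mathrm{loc}}(\mathcal{X})$ (measurable $f$ such that each $x\in\mathcal{X}$ has some $r_x>0$ with $f\mathbf{1}_{B(x,r_x)}\in L^p(\mathcal{X})$) with $\|f\|_{L_{p,\phi}(\mathcal{X})}:=\sup_B\frac1{\phi(B)}[\frac1{\mu(B)}\int_B|f|^p\,d\mu]^{1/p}<\infty$, supremum over all balls. For $Y=L_{p,\phi}$: $Y(\Omega)$ is the set of measurable $f$ on $\Omega$ that are restrictions of some $g\in Y(\mathcal{X})$, with $\|f\|_{Y(\Omega)}:=\inf\{\|g\|_{Y(\mathcal{X})}:g\in Y(\mathcal{X}),g|_\Omega=f\}$ (and $\infty$ if no such $g$); $\dot W^{s,q}_Y(\Omega)$ is the set of measurable $f$ on $\Omega$ with $\big\|\{\int_\Omega\frac{|f(\cdot)-f(y)|^q}{U(\cdot,y)[\rho(\cdot,y)]^{sq}}d\mu(y)\}^{1/q}\big\|_{Y(\Omega)}<\infty$;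 $Y(\Omega)/\mathbb{R}$ is the set of measurable $f$ on $\Omega$ (modulo additive real constants) with $\|f\|_{Y(\Omega)/\mathbb{R}}:=\inf_{a\in\mathbb{R}}\|f+a\|_{Y(\Omega)}<\infty$. $s\to0^+$ means $s\in(0,1)$, $s\to0$. *)

theory Defs
  imports "HOL-Analysis.Analysis"
begin

section \<open>Spaces of homogeneous type\<close>

text \<open>The underlying set is the carrier \<open>space M\<close>; the functions \<open>\<rho>\<close>, \<open>\<phi>\<close>, \<open>f\<close> are total
  in HOL, but their values outside the carrier are irrelevant everywhere below.\<close>

definition quasi_metric_on :: "'a set \<Rightarrow> ('a \<Rightarrow> 'a \<Rightarrow> real) \<Rightarrow> bool" where
  "quasi_metric_on X \<rho> \<longleftrightarrow>
     (\<forall>x\<in>X. \<forall>y\<in>X. 0 \<le> \<rho> x y \<and> (\<rho> x y = 0 \<longleftrightarrow> x = y) \<and> \<rho> x y = \<rho> y x) \<and>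
     (\<exists>K\<ge>1. \<forall>x\<in>X. \<forall>y\<in>X. \<forall>z\<in>X. \<rho> x z \<le> K * (\<rho> x y + \<rho> y z))"

definition qball :: "'a measure \<Rightarrow> ('a \<Rightarrow> 'a \<Rightarrow> real) \<Rightarrow> 'a \<Rightarrow> real \<Rightarrow> 'a set" where
  "qball M \<rho> x r = {y \<in> space M. \<rho> x y < r}"

definition homogeneous_type :: "'a measure \<Rightarrow> ('a \<Rightarrow> 'a \<Rightarrow> real) \<Rightarrow> bool" where
  "homogeneous_type M \<rho> \<longleftrightarrow>
     space M \<noteq> {} \<and> quasi_metric_on (space M) \<rho> \<and>
     (\<forall>x\<in>space M. \<forall>r>0. qball M \<rho> x r \<in> sets M) \<and>
     (\<exists>L::real. 1 \<le> L \<and> (\<forall>x\<in>space M. \<forall>r>0.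
        0 < emeasure M (qball M \<rho> x (2 * r)) \<and>
        emeasure M (qball M \<rho> x (2 * r)) \<le> ennreal L * emeasure M (qball M \<rho> x r) \<and>
        ennreal L * emeasure M (qball M \<rho> x r) < \<infinity>))"

definition quasi_open :: "'a measure \<Rightarrow> ('a \<Rightarrow> 'a \<Rightarrow> real) \<Rightarrow> 'a set \<Rightarrow> bool" where
  "quasi_open M \<rho> \<Omega> \<longleftrightarrow> \<Omega> \<subseteq> space M \<and> (\<forall>x\<in>\<Omega>. \<exists>r>0. qball M \<rho> x r \<subseteq> \<Omega>)"

text \<open>Weak reverse doubling and weak measure density.\<close>

definition WRD :: "'a measure \<Rightarrow> ('a \<Rightarrow> 'a \<Rightarrow> real) \<Rightarrow> bool" where
  "WRD M \<rho> \<longleftrightarrow> (\<exists>x0\<in>space M. \<exists>l>1. \<exists>C>1.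
     ennreal C \<le> Liminf at_top
       (\<lambda>r. emeasure M (qball M \<rho> x0 (l * r)) / emeasure M (qball M \<rho> x0 r)))"

definition WMD :: "'a measure \<Rightarrow> ('a \<Rightarrow> 'a \<Rightarrow> real) \<Rightarrow> 'a set \<Rightarrow> bool" where
  "WMD M \<rho> \<Omega> \<longleftrightarrow> (\<exists>x0\<in>space M. \<exists>C. 0 < C \<and> C \<le> 1 \<and>
     ennreal C \<le> Liminf at_top
       (\<lambda>r. emeasure M (qball M \<rho> x0 r \<inter> \<Omega>) / emeasure M (qball M \<rho> x0 r)))"

definition U_fun :: "'a measure \<Rightarrow> ('a \<Rightarrow> 'a \<Rightarrow> real) \<Rightarrow> 'a \<Rightarrow> 'a \<Rightarrow> real" where
  "U_fun M \<rho> x y =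
     min (measure M (qball M \<rho> x (\<rho> x y))) (measure M (qball M \<rho> y (\<rho> x y)))"

section \<open>Growth functions\<close>

definition nearness :: "'a measure \<Rightarrow> ('a \<Rightarrow> 'a \<Rightarrow> real) \<Rightarrow> ('a \<Rightarrow> real \<Rightarrow> real) \<Rightarrow> bool" where
  "nearness M \<rho> \<phi> \<longleftrightarrow> (\<exists>C>0. \<forall>x\<in>space M. \<forall>y\<in>space M. \<forall>r>0.
     \<rho> x y \<le> r \<longrightarrow> 1 / C \<le> \<phi> x r / \<phi> y r \<and> \<phi> x r / \<phi> y r \<le> C)"

definition almost_increasing :: "'a set \<Rightarrow> ('a \<Rightarrow> real \<Rightarrow> real) \<Rightarrow> bool" where
  "almost_increasing X \<psi> \<longleftrightarrow>
     (\<exists>C>0. \<forall>x\<in>X. \<forall>r s. 0 < r \<and> r < s \<longrightarrow> \<psi> x r \<le> C * \<psi> x s)"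

definition almost_decreasing :: "'a set \<Rightarrow> ('a \<Rightarrow> real \<Rightarrow> real) \<Rightarrow> bool" where
  "almost_decreasing X \<psi> \<longleftrightarrow>
     (\<exists>C>0. \<forall>x\<in>X. \<forall>r s. 0 < r \<and> r < s \<longrightarrow> C * \<psi> x r \<ge> \<psi> x s)"

definition G_dec ::
    "'a measure \<Rightarrow> ('a \<Rightarrow> 'a \<Rightarrow> real) \<Rightarrow> real \<Rightarrow> ('a \<Rightarrow> real \<Rightarrow> real) set" where
  "G_dec M \<rho> p = {\<phi>.
     (\<forall>x\<in>space M. \<forall>r>0. 0 < \<phi> x r) \<and>
     almost_increasing (space M) (\<lambda>x r. measure M (qball M \<rho> x r) powr (1 / p) * \<phi> x r) \<and>
     almost_decreasing (space M) \<phi>}"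

section \<open>Generalized Morrey spaces\<close>

text \<open>Powers of extended nonnegative reals, for positive exponents.\<close>

definition enn_powr :: "ennreal \<Rightarrow> real \<Rightarrow> ennreal" where
  "enn_powr u a = (if u = \<infinity> then \<infinity> else ennreal (enn2real u powr a))"

definition morrey_norm ::
    "'a measure \<Rightarrow> ('a \<Rightarrow> 'a \<Rightarrow> real) \<Rightarrow> real \<Rightarrow> ('a \<Rightarrow> real \<Rightarrow> real) \<Rightarrow> ('a \<Rightarrow> real) \<Rightarrow> ennreal"
where
  "morrey_norm M \<rho> p \<phi> f = (SUP (x, r) \<in> space M \<times> {0<..}.
     ennreal (1 / \<phi> x r) *
     enn_powr ((\<integral>\<^sup>+y\<in>qball M \<rho> x r. ennreal (\<bar>f y\<bar> powr p) \<partial>M)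
                 / emeasure M (qball M \<rho> x r)) (1 / p))"

definition Lp_loc :: "'a measure \<Rightarrow> ('a \<Rightarrow> 'a \<Rightarrow> real) \<Rightarrow> real \<Rightarrow> ('a \<Rightarrow> real) set" where
  "Lp_loc M \<rho> p = {f \<in> borel_measurable M. \<forall>x\<in>space M. \<exists>r>0.
     (\<integral>\<^sup>+y\<in>qball M \<rho> x r. ennreal (\<bar>f y\<bar> powr p) \<partial>M) < \<infinity>}"

definition morrey_space ::
    "'a measure \<Rightarrow> ('a \<Rightarrow> 'a \<Rightarrow> real) \<Rightarrow> real \<Rightarrow> ('a \<Rightarrow> real \<Rightarrow> real) \<Rightarrow> ('a \<Rightarrow> real) set" where
  "morrey_space M \<rho> p \<phi> = {f \<in> Lp_loc M \<rho> p. morrey_norm M \<rho> p \<phi> f < \<infinity>}"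

text \<open>The norm of the restricted space on \<open>\<Omega>\<close>; it is \<open>\<infinity>\<close> (the infimum of the empty set) if
  there is no extension. Functions on \<open>\<Omega>\<close> are extended-real-valued here because the
  inner functional of the Sobolev norm may be infinite at some points. As usual for these
  spaces, functions agreeing almost everywhere are identified, so that \<open>g = F\<close> on \<open>\<Omega>\<close> means
  almost everywhere; for real-valued measurable \<open>F\<close> this does not affect the norm.\<close>

definition morrey_norm_on ::
    "'a measure \<Rightarrow> ('a \<Rightarrow> 'a \<Rightarrow> real) \<Rightarrow> real \<Rightarrow> ('a \<Rightarrow> real \<Rightarrow> real) \<Rightarrow> 'a set \<Rightarrow> ('a \<Rightarrow> ereal)
      \<Rightarrow> ennreal" where
  "morrey_norm_on M \<rho> p \<phi> \<Omega> F =
     Inf {morrey_norm M \<rho> p \<phi> g | g.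
       g \<in> morrey_space M \<rho> p \<phi> \<and> (AE x in M. x \<in> \<Omega> \<longrightarrow> ereal (g x) = F x)}"

definition morrey_norm_mod_const ::
    "'a measure \<Rightarrow> ('a \<Rightarrow> 'a \<Rightarrow> real) \<Rightarrow> real \<Rightarrow> ('a \<Rightarrow> real \<Rightarrow> real) \<Rightarrow> 'a set \<Rightarrow> ('a \<Rightarrow> real)
      \<Rightarrow> ennreal" where
  "morrey_norm_mod_const M \<rho> p \<phi> \<Omega> f =
     (INF a::real. morrey_norm_on M \<rho> p \<phi> \<Omega> (\<lambda>x. ereal (f x + a)))"

definition morrey_space_mod_const ::
    "'a measure \<Rightarrow> ('a \<Rightarrow> 'a \<Rightarrow> real) \<Rightarrow> real \<Rightarrow> ('a \<Rightarrow> real \<Rightarrow> real) \<Rightarrow> 'a set \<Rightarrow> ('a \<Rightarrow> real) set"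
where
  "morrey_space_mod_const M \<rho> p \<phi> \<Omega> =
     {f \<in> borel_measurable (restrict_space M \<Omega>). morrey_norm_mod_const M \<rho> p \<phi> \<Omega> f < \<infinity>}"

section \<open>The fractional Sobolev seminorm\<close>

definition gagliardo ::
    "'a measure \<Rightarrow> ('a \<Rightarrow> 'a \<Rightarrow> real) \<Rightarrow> 'a set \<Rightarrow> real \<Rightarrow> real \<Rightarrow> ('a \<Rightarrow> real) \<Rightarrow> 'a \<Rightarrow> ennreal" where
  "gagliardo M \<rho> \<Omega> s q f x = enn_powr
     (\<integral>\<^sup>+y\<in>\<Omega>. (if y = x then 0
                 else ennreal (\<bar>f x - f y\<bar> powr q / (U_fun M \<rho> x y * \<rho> x y powr (s * q)))) \<partial>M)
     (1 / q)"

text \<open>The Morrey norm on \<open>\<Omega>\<close> of a nonnegative function \<open>F\<close>. For measurable \<open>F\<close> it is the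
  norm above. The axioms of a space of homogeneous type do not force \<open>\<rho>\<close> to be jointly
  measurable, so \<open>F = gagliardo M \<rho> \<Omega> s q f\<close> can fail to be measurable, and its Morrey norm is
  then undefined. In that case we take the infimum of the norms of measurable majorants; for
  measurable \<open>F\<close> this would give the same value, as the Morrey norm is monotone in \<open>\<bar>f\<bar>\<close>.\<close>

definition morrey_outer_norm_on ::
    "'a measure \<Rightarrow> ('a \<Rightarrow> 'a \<Rightarrow> real) \<Rightarrow> real \<Rightarrow> ('a \<Rightarrow> real \<Rightarrow> real) \<Rightarrow> 'a set \<Rightarrow> ('a \<Rightarrow> ennreal)
      \<Rightarrow> ennreal" where
  "morrey_outer_norm_on M \<rho> p \<phi> \<Omega> F =
     (if F \<in> borel_measurable (restrict_space M \<Omega>)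
      then morrey_norm_on M \<rho> p \<phi> \<Omega> (\<lambda>x. enn2ereal (F x))
      else Inf {morrey_norm_on M \<rho> p \<phi> \<Omega> (\<lambda>x. enn2ereal (H x)) | H.
             H \<in> borel_measurable (restrict_space M \<Omega>) \<and> (\<forall>x\<in>\<Omega>. F x \<le> H x)})"

definition sobolev_seminorm ::
    "'a measure \<Rightarrow> ('a \<Rightarrow> 'a \<Rightarrow> real) \<Rightarrow> real \<Rightarrow> ('a \<Rightarrow> real \<Rightarrow> real) \<Rightarrow> 'a set \<Rightarrow> real \<Rightarrow> real
      \<Rightarrow> ('a \<Rightarrow> real) \<Rightarrow> ennreal" where
  "sobolev_seminorm M \<rho> p \<phi> \<Omega> s q f =
     morrey_outer_norm_on M \<rho> p \<phi> \<Omega> (gagliardo M \<rho> \<Omega> s q f)"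

definition sobolev_space ::
    "'a measure \<Rightarrow> ('a \<Rightarrow> 'a \<Rightarrow> real) \<Rightarrow> real \<Rightarrow> ('a \<Rightarrow> real \<Rightarrow> real) \<Rightarrow> 'a set \<Rightarrow> real \<Rightarrow> real
      \<Rightarrow> ('a \<Rightarrow> real) set" where
  "sobolev_space M \<rho> p \<phi> \<Omega> s q =
     {f \<in> borel_measurable (restrict_space M \<Omega>). sobolev_seminorm M \<rho> p \<phi> \<Omega> s q f < \<infinity>}"

end

theory Submission
  imports Defs
begin

text \<open>Why the theorem holds. Write \<open>F s\<close> for the inner functional, that is
  \<open>F s x = (\<integral>y\<in>\<Omega>. \<bar>f x - f y\<bar>\<^sup>q / (U x y \<rho>\<^sup>s\<^sup>q))\<^sup>1\<^sup>/\<^sup>q\<close>, and let \<open>g\<close> be a Morrey function that equals \<open>f + a\<close>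
  on \<open>\<Omega>\<close>. As \<open>s\<close> tends to 0, only the part of the integral at large distances survives multiplication by
  \<open>s\<close>. By doubling, the mass of the kernel \<open>1 / (U \<rho>\<^sup>s\<^sup>q)\<close> at distances at least 1 is a geometric series
  over dyadic shells, hence at most of order \<open>1 / s\<close>. Weak reverse doubling and weak measure density
  say that every large shell contains a fixed proportion of \<open>\<Omega>\<close>, so the mass on \<open>\<Omega>\<close> beyond any
  fixed radius is also at least of order \<open>1 / s\<close> (\<open>far_kernel_lower_eventually\<close>). Since \<open>g y\<close> is small
  on average for distant \<open>y\<close>, this suggests \<open>s\<^sup>1\<^sup>/\<^sup>q F s x \<approx> \<bar>g x\<bar>\<close>, and this is what is proved, in two
  one-sided forms.

  Lower bound. The integral condition forces \<open>\<phi> x r\<close> to tend to 0 as \<open>r\<close> tends to infinity, so beyond a large radius,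
  depending on \<open>x\<close>, the contribution of \<open>g y\<close> is negligible against \<open>\<bar>g x\<bar>\<close>. This gives
  \<open>c \<bar>g x\<bar> \<le> s\<^sup>1\<^sup>/\<^sup>q F s x\<close> for all small \<open>s\<close>, pointwise (\<open>U_energy_lower_eventually\<close>), and Fatou's lemma
  transports it to the Morrey norm (\<open>sobolev_liminf_ge\<close>).

  Upper bound. The part at distances below 1 is at most the functional at a fixed exponent \<open>s0\<close>, which is
  a Morrey function by assumption, and so it vanishes in the limit. In the far part \<open>\<bar>g x\<bar>\<close> contributes
  \<open>\<bar>g x\<bar>\<^sup>q / s\<close>, up to a constant, and \<open>\<bar>g y\<bar>\<close> contributes \<open>\<Sum>k. 2\<^sup>-\<^sup>k\<^sup>s\<^sup>q\<close> times the averages of \<open>\<bar>g\<bar>\<^sup>q\<close> over balls of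
  radius \<open>2\<^sup>k\<^sup>+\<^sup>1\<close>. Because \<open>q < p\<close>, these can be replaced by averages of \<open>\<bar>g\<bar>\<^sup>p\<close> by a Hoelder type
  argument, and averaging operators are bounded on the Morrey space uniformly in the scale
  (\<open>morrey_bd_avg_op\<close>).

  Measurability needs care throughout: \<open>\<rho>\<close> is measurable in each variable, but not
  necessarily jointly. For this reason \<open>U\<close> is replaced by the comparable one-sided kernel \<open>kern\<close>, and the averages over
  balls are replaced by majorants built from countable nets (\<open>avg_op\<close>), which also turn Tonelli's
  theorem into an exchange of a sum and an integral.\<close>

section \<open>Powers, extended reals and geometric sums\<close>

text \<open>Both the Morrey norm and the Gagliardo functional are roots of integrals. Everywhere below they
  are compared with real numbers, and this equivalence removes the root.\<close>

lemma enn_powr_le_iff: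
  assumes a: "0 < a" and c: "0 \<le> c"
  shows "enn_powr u (1 / a) \<le> ennreal c \<longleftrightarrow> u \<le> ennreal (c powr a)"
proof (cases u)
  case (real r)
  have "r powr (1 / a) \<le> c \<longleftrightarrow> r \<le> c powr a"
  proof
    assume "r powr (1 / a) \<le> c"
    then have "(r powr (1 / a)) powr a \<le> c powr a"
      using a by (intro powr_mono2) auto
    then show "r \<le> c powr a" using a real by (simp add: powr_powr)
  next
    assume "r \<le> c powr a"
    then have "r powr (1 / a) \<le> (c powr a) powr (1 / a)"
      using a real by (intro powr_mono2) auto
    then show "r powr (1 / a) \<le> c" using a c by (simp add: powr_powr)
  qed
  then show ?thesis using real c by (simp add: enn_powr_def)
next
  case top
  then show ?thesis by (simp add: enn_powr_def top_unique)
qed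

lemma powr_add_le:
  fixes a b q :: real
  assumes "0 \<le> a" "0 \<le> b" "0 < q"
  shows "(a + b) powr q \<le> 2 powr q * (a powr q + b powr q)"
proof -
  have "(a + b) powr q \<le> (2 * max a b) powr q"
    using assms by (intro powr_mono2) auto
  also have "\<dots> = 2 powr q * max a b powr q" using assms by (simp add: powr_mult)
  also have "\<dots> \<le> 2 powr q * (a powr q + b powr q)"
    by (intro mult_left_mono) (auto simp: max_def)
  finally show ?thesis .
qed

lemma powr_interpolate:
  fixes t l p q :: real
  assumes "0 \<le> t" "0 < l" "0 < q" "q < p"
  shows "t powr q \<le> l powr q + l powr (q - p) * t powr p"
proof (cases "t \<le> l")
  case True
  then have "t powr q \<le> l powr q" using assms by (intro powr_mono2) auto
  then show ?thesis by (smt (verit) mult_nonneg_nonneg powr_ge_zero)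
next
  case False
  then have "t powr (q - p) \<le> l powr (q - p)"
    using assms by (intro powr_mono2') auto
  then have "t powr (q - p) * t powr p \<le> l powr (q - p) * t powr p"
    by (intro mult_right_mono) auto
  then show ?thesis using False assms
    by (smt (verit, ccfv_SIG) diff_add_cancel powr_add powr_ge_zero)
qed

text \<open>This replaces Hoelder's inequality for a measure of mass at most \<open>N\<close>. Integrating the pointwise
  bound \<open>t\<^sup>q \<le> l\<^sup>q + l\<^sup>q\<^sup>-\<^sup>p t\<^sup>p\<close> costs only the factor 2 as soon as the level \<open>l\<close> is an upper bound
  for the mean of order \<open>p\<close>, and leaves \<open>l\<close> free to be chosen in each application.\<close>

lemma nn_integral_interpolate:
  fixes w :: "'a \<Rightarrow> ennreal" and g :: "'a \<Rightarrow> real"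
  assumes [measurable]: "w \<in> borel_measurable M" "g \<in> borel_measurable M"
    and l: "0 < l" and q: "0 < q" "q < p" and N: "0 \<le> N"
    and mass: "(\<integral>\<^sup>+y. w y \<partial>M) \<le> ennreal N"
    and p_int: "(\<integral>\<^sup>+y. ennreal (\<bar>g y\<bar> powr p) * w y \<partial>M) \<le> ennreal (l powr p * N)"
  shows "(\<integral>\<^sup>+y. ennreal (\<bar>g y\<bar> powr q) * w y \<partial>M) \<le> ennreal (2 * l powr q * N)"
proof -
  have "(\<integral>\<^sup>+y. ennreal (\<bar>g y\<bar> powr q) * w y \<partial>M)
      \<le> (\<integral>\<^sup>+y. ennreal (l powr q) * w y
             + ennreal (l powr (q - p)) * (ennreal (\<bar>g y\<bar> powr p) * w y) \<partial>M)"
  proof (rule nn_integral_mono)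
    fix y
    have "ennreal (\<bar>g y\<bar> powr q) \<le> ennreal (l powr q + l powr (q - p) * \<bar>g y\<bar> powr p)"
      using powr_interpolate[of "\<bar>g y\<bar>" l q p] l q by (intro ennreal_leI) auto
    also have "\<dots> = ennreal (l powr q) + ennreal (l powr (q - p)) * ennreal (\<bar>g y\<bar> powr p)"
      by (simp add: ennreal_mult)
    finally have "ennreal (\<bar>g y\<bar> powr q) * w y
        \<le> (ennreal (l powr q) + ennreal (l powr (q - p)) * ennreal (\<bar>g y\<bar> powr p)) * w y"
      by (intro mult_right_mono) auto
    then show "ennreal (\<bar>g y\<bar> powr q) * w y \<le> ennreal (l powr q) * w y
             + ennreal (l powr (q - p)) * (ennreal (\<bar>g y\<bar> powr p) * w y)"
      by (simp add: algebra_simps)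
  qed
  also have "\<dots> = ennreal (l powr q) * (\<integral>\<^sup>+y. w y \<partial>M)
      + ennreal (l powr (q - p)) * (\<integral>\<^sup>+y. ennreal (\<bar>g y\<bar> powr p) * w y \<partial>M)"
    by (simp add: nn_integral_add nn_integral_cmult)
  also have "\<dots> \<le> ennreal (l powr q) * ennreal N
      + ennreal (l powr (q - p)) * ennreal (l powr p * N)"
    by (intro add_mono mult_left_mono mass p_int) auto
  also have "\<dots> = ennreal (l powr q * N + l powr (q - p) * (l powr p * N))"
    using N by (simp add: ennreal_mult)
  also have "l powr q * N + l powr (q - p) * (l powr p * N) = 2 * l powr q * N"
    using l by (simp add: powr_diff)
  finally show ?thesis .
qed

lemma exists_geometric_shell:
  fixes R t \<Lambda> :: real
  assumes "0 < R" "R \<le> t" "1 < \<Lambda>"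
  shows "\<exists>k::nat. \<Lambda> ^ k * R \<le> t \<and> t < \<Lambda> ^ Suc k * R"
proof -
  obtain n where n: "t / R < \<Lambda> ^ n" using real_arch_pow[OF assms(3)] by blast
  define k where "k = (LEAST n. t < \<Lambda> ^ n * R)"
  have ex: "t < \<Lambda> ^ n * R" using n assms by (simp add: field_simps)
  have k1: "t < \<Lambda> ^ k * R" unfolding k_def by (rule LeastI[where P = "\<lambda>n. t < \<Lambda> ^ n * R", OF ex])
  have "k \<noteq> 0" using k1 assms by (intro notI) simp
  then obtain j where j: "k = Suc j" by (cases k) auto
  have "\<not> t < \<Lambda> ^ j * R" using not_less_Least[of j "\<lambda>n. t < \<Lambda> ^ n * R"] j k_def by simp
  with k1 j show ?thesis by (intro exI[of _ j]) auto
qed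

text \<open>This estimate and the next one say that the geometric series
  \<open>\<Sum>k. \<Lambda>\<^sup>-\<^sup>k\<^sup>s\<^sup>q\<close> is of exact order \<open>1 / s\<close> as \<open>s\<close> tends to 0; this is where the
  normalising factor \<open>s\<^sup>1\<^sup>/\<^sup>q\<close> comes from.\<close>

lemma one_minus_powr_neg_upper:
  fixes \<Lambda> \<sigma> :: real
  assumes "1 < \<Lambda>"
  shows "1 - \<Lambda> powr (- \<sigma>) \<le> \<sigma> * ln \<Lambda>"
  using exp_ge_add_one_self[of "- \<sigma> * ln \<Lambda>"] assms by (simp add: powr_def)

lemma inverse_one_minus_powr_neg_le:
  fixes s q :: real
  assumes "0 < s" "s \<le> 1" "0 < q"
  shows "1 / (1 - 2 powr (- (s * q))) \<le> (1 + 1 / (q * ln 2)) / s"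
proof -
  define t where "t = s * q * ln 2"
  have t: "0 < t" using assms by (simp add: t_def)
  have e: "2 powr (- (s * q)) = exp (- t)" by (simp add: powr_def t_def)
  have "1 + t \<le> exp t" by (rule exp_ge_add_one_self)
  then have "exp (- t) \<le> 1 / (1 + t)" using t by (simp add: exp_minus field_simps)
  then have "t / (1 + t) \<le> 1 - exp (- t)" using t by (simp add: field_simps)
  then have "1 / (1 - exp (- t)) \<le> 1 / (t / (1 + t))"
    using t by (intro divide_left_mono) (auto intro!: mult_pos_pos)
  also have "\<dots> = 1 + 1 / t" using t by (simp add: field_simps)
  also have "\<dots> \<le> 1 / s + 1 / t" using assms by simp
  also have "\<dots> = (1 + 1 / (q * ln 2)) / s" using assms by (simp add: t_def field_simps)
  finally show ?thesis using e by simp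
qed

lemma ennreal_divide_le_iff:
  assumes "0 < c" "0 \<le> d"
  shows "X / ennreal c \<le> ennreal d \<longleftrightarrow> X \<le> ennreal (d * c)"
proof (cases X)
  case (real x)
  then show ?thesis using assms by (simp add: divide_ennreal pos_divide_le_eq)
next
  case top
  then show ?thesis using assms by (simp add: ennreal_top_divide top_unique)
qed

lemma ennreal_mult_le_iff:
  assumes "0 < c" "0 \<le> d"
  shows "ennreal (1 / c) * X \<le> ennreal d \<longleftrightarrow> X \<le> ennreal (d * c)"
proof (cases X)
  case (real x)
  then show ?thesis using assms by (simp add: ennreal_mult[symmetric] pos_divide_le_eq)
next
  case top
  then show ?thesis using assms by (simp add: ennreal_mult_top top_unique)
qed

text \<open>The index set is a subset of a space that may be uncountable, so countable sums are written as
  integrals over a counting measure.\<close>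

lemma borel_measurable_nn_integral_count_space:
  assumes S: "countable S" and f: "\<And>i. i \<in> S \<Longrightarrow> f i \<in> borel_measurable M"
  shows "(\<lambda>x. \<integral>\<^sup>+i. f i x \<partial>count_space S) \<in> borel_measurable M"
proof -
  interpret S: sigma_finite_measure "count_space S"
    by (rule sigma_finite_measure_count_space_countable[OF S])
  have "(\<lambda>(i, x). f i x) \<in> borel_measurable (count_space S \<Otimes>\<^sub>M M)"
    using f by (intro measurable_pair_measure_countable1[OF S]) simp
  then have "(\<lambda>(x, i). f i x) \<in> borel_measurable (M \<Otimes>\<^sub>M count_space S)"
    by (subst measurable_pair_swap_iff) (simp add: split_beta')
  then show ?thesis by (rule S.borel_measurable_nn_integral)
qed

section \<open>Balls in a space of homogeneous type\<close>

text \<open>The constants \<open>K\<close> and \<open>L\<close> are parameters, so that all bounds below are explicit in them and hence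
  visibly independent of points, radii and functions.\<close>

locale homogeneous_space =
  fixes M :: "'a measure" and \<rho> :: "'a \<Rightarrow> 'a \<Rightarrow> real" and K L :: real
  assumes rho_nonneg: "\<lbrakk>x \<in> space M; y \<in> space M\<rbrakk> \<Longrightarrow> 0 \<le> \<rho> x y"
    and rho_eq_0: "\<lbrakk>x \<in> space M; y \<in> space M\<rbrakk> \<Longrightarrow> \<rho> x y = 0 \<longleftrightarrow> x = y"
    and rho_sym: "\<lbrakk>x \<in> space M; y \<in> space M\<rbrakk> \<Longrightarrow> \<rho> x y = \<rho> y x"
    and K_ge_1: "1 \<le> K"
    and rho_triangle:
      "\<lbrakk>x \<in> space M; y \<in> space M; z \<in> space M\<rbrakk> \<Longrightarrow> \<rho> x z \<le> K * (\<rho> x y + \<rho> y z)"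
    and L_ge_1: "1 \<le> L"
    and ball_in_sets: "\<lbrakk>x \<in> space M; 0 < r\<rbrakk> \<Longrightarrow> qball M \<rho> x r \<in> sets M"
    and ball_pos: "\<lbrakk>x \<in> space M; 0 < r\<rbrakk> \<Longrightarrow> 0 < emeasure M (qball M \<rho> x r)"
    and ball_fin: "\<lbrakk>x \<in> space M; 0 < r\<rbrakk> \<Longrightarrow> emeasure M (qball M \<rho> x r) < \<infinity>"
    and doubling: "\<lbrakk>x \<in> space M; 0 < r\<rbrakk> \<Longrightarrow>
      emeasure M (qball M \<rho> x (2 * r)) \<le> ennreal L * emeasure M (qball M \<rho> x r)"

lemma homogeneous_typeE:
  assumes "homogeneous_type M \<rho>"
  obtains K L where "homogeneous_space M \<rho> K L"
proof -
  have qm: "quasi_metric_on (space M) \<rho>"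
    and balls: "\<forall>x\<in>space M. \<forall>r>0. qball M \<rho> x r \<in> sets M"
    and L_ex: "\<exists>L::real. 1 \<le> L \<and> (\<forall>x\<in>space M. \<forall>r>0.
        0 < emeasure M (qball M \<rho> x (2 * r)) \<and>
        emeasure M (qball M \<rho> x (2 * r)) \<le> ennreal L * emeasure M (qball M \<rho> x r) \<and>
        ennreal L * emeasure M (qball M \<rho> x r) < \<infinity>)"
    using assms unfolding homogeneous_type_def by simp_all
  have met: "\<forall>x\<in>space M. \<forall>y\<in>space M. 0 \<le> \<rho> x y \<and> (\<rho> x y = 0 \<longleftrightarrow> x = y) \<and> \<rho> x y = \<rho> y x"
    using qm unfolding quasi_metric_on_def by (rule conjunct1)
  obtain K where K: "1 \<le> K" "\<forall>x\<in>space M. \<forall>y\<in>space M. \<forall>z\<in>space M. \<rho> x z \<le> K * (\<rho> x y + \<rho> y z)"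
    using qm unfolding quasi_metric_on_def by (elim conjE exE)
  obtain L :: real where L: "1 \<le> L" and D': "\<forall>x\<in>space M. \<forall>r>0.
        0 < emeasure M (qball M \<rho> x (2 * r)) \<and>
        emeasure M (qball M \<rho> x (2 * r)) \<le> ennreal L * emeasure M (qball M \<rho> x r) \<and>
        ennreal L * emeasure M (qball M \<rho> x r) < \<infinity>"
    using L_ex by (elim conjE exE)
  note D = D'[rule_format]
  have "homogeneous_space M \<rho> K L"
  proof
    fix x r assume x: "x \<in> space M" and r: "(0::real) < r"
    show "0 < emeasure M (qball M \<rho> x r)" using D[OF x, of "r / 2"] r by simp
    show "emeasure M (qball M \<rho> x r) < \<infinity>"
      using D[OF x r] L by (auto simp: ennreal_mult_less_top)
    show "emeasure M (qball M \<rho> x (2 * r)) \<le> ennreal L * emeasure M (qball M \<rho> x r)"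
      using D[OF x r] by simp
    show "qball M \<rho> x r \<in> sets M" using balls x r by simp
  next
    fix x y assume xy: "x \<in> space M" "y \<in> space M"
    show "0 \<le> \<rho> x y" "\<rho> x y = 0 \<longleftrightarrow> x = y" "\<rho> x y = \<rho> y x" using met xy by blast+
    show "\<rho> x z \<le> K * (\<rho> x y + \<rho> y z)" if "z \<in> space M" for z using K(2) xy that by blast
  qed (use K(1) L in simp_all)
  then show ?thesis by (rule that)
qed

context homogeneous_space
begin

abbreviation "B \<equiv> qball M \<rho>"

definition vol :: "'a \<Rightarrow> real \<Rightarrow> real" where
  "vol x r = measure M (B x r)"

text \<open>The factor by which the measure of a ball can grow when its radius is multiplied by \<open>c\<close>: the
  doubling inequality is used \<open>\<lceil>log 2 c\<rceil>\<close> times.\<close>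

definition growth :: "real \<Rightarrow> real" where
  "growth c = L ^ nat \<lceil>log 2 c\<rceil>"

lemma in_ball_iff: "y \<in> B x r \<longleftrightarrow> y \<in> space M \<and> \<rho> x y < r"
  by (simp add: qball_def)

lemma ball_nonpos: "x \<in> space M \<Longrightarrow> r \<le> 0 \<Longrightarrow> B x r = {}"
  using rho_nonneg by (fastforce simp: qball_def)

lemma ball_meas [measurable]: "x \<in> space M \<Longrightarrow> B x r \<in> sets M"
  using ball_in_sets ball_nonpos by (cases "0 < r") auto

lemma ball_mono: "r \<le> r' \<Longrightarrow> B x r \<subseteq> B x r'"
  by (auto simp: qball_def)

lemma emeasure_ball: "x \<in> space M \<Longrightarrow> emeasure M (B x r) = ennreal (vol x r)"
  using ball_fin[of x r] ball_nonpos[of x r] unfolding vol_def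
  by (cases "0 < r") (auto simp: emeasure_eq_ennreal_measure)

lemma vol_nonneg: "0 \<le> vol x r"
  by (simp add: vol_def)

lemma vol_pos: "x \<in> space M \<Longrightarrow> 0 < r \<Longrightarrow> 0 < vol x r"
  using ball_pos[of x r] emeasure_ball[of x r] by (simp add: ennreal_less_zero_iff)

lemma vol_le_if_subset:
  assumes "x \<in> space M" "y \<in> space M" "B x r \<subseteq> B y r'"
  shows "vol x r \<le> vol y r'"
proof -
  have "ennreal (vol x r) \<le> ennreal (vol y r')"
    using emeasure_mono[OF assms(3) ball_meas[OF assms(2)]] emeasure_ball assms by simp
  then show ?thesis using vol_nonneg by simp
qed

lemma vol_mono: "x \<in> space M \<Longrightarrow> r \<le> r' \<Longrightarrow> vol x r \<le> vol x r'"
  by (intro vol_le_if_subset ball_mono)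

lemma vol_double:
  assumes "x \<in> space M" "0 < r" shows "vol x (2 * r) \<le> L * vol x r"
proof -
  have "ennreal (vol x (2 * r)) \<le> ennreal (L * vol x r)"
    using doubling[OF assms] emeasure_ball assms L_ge_1 vol_nonneg by (simp add: ennreal_mult)
  then show ?thesis using L_ge_1 vol_nonneg by (subst (asm) ennreal_le_iff) auto
qed

lemma growth_ge_1: "1 \<le> growth c"
  by (simp add: growth_def L_ge_1)

lemma vol_growth:
  assumes x: "x \<in> space M" and r: "0 < r" and c: "1 \<le> c" and r': "r' \<le> c * r"
  shows "vol x r' \<le> growth c * vol x r"
proof -
  have it: "vol x (2 ^ n * r) \<le> L ^ n * vol x r" for n
  proof (induction n)
    case (Suc n)
    have "vol x (2 ^ Suc n * r) \<le> L * vol x (2 ^ n * r)"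
      using vol_double[OF x, of "2 ^ n * r"] r by (simp add: mult.assoc)
    also have "\<dots> \<le> L * (L ^ n * vol x r)" using Suc L_ge_1 by (intro mult_left_mono) auto
    finally show ?case by simp
  qed simp
  define n where "n = nat \<lceil>log 2 c\<rceil>"
  have "log 2 c \<le> real n" unfolding n_def by linarith
  then have "c \<le> 2 powr real n" using c by (subst (asm) log_le_iff) auto
  then have "c \<le> 2 ^ n" by (simp add: powr_realpow)
  then have "r' \<le> 2 ^ n * r" using r' r by (meson mult_right_mono order_trans less_imp_le)
  then have "vol x r' \<le> vol x (2 ^ n * r)" by (rule vol_mono[OF x])
  with it[of n] show ?thesis by (simp add: growth_def n_def)
qed

lemma ball_subset_ball:
  assumes "x \<in> space M" "y \<in> space M" "K * (\<rho> x y + r) \<le> r'"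
  shows "B y r \<subseteq> B x r'"
proof
  fix z assume z: "z \<in> B y r"
  then have "\<rho> x z \<le> K * (\<rho> x y + \<rho> y z)" using assms by (auto simp: in_ball_iff rho_triangle)
  also have "\<dots> < K * (\<rho> x y + r)" using z K_ge_1 by (auto simp: in_ball_iff)
  finally show "z \<in> B x r'" using z assms by (auto simp: in_ball_iff)
qed

text \<open>Separated points carry disjoint balls of radius \<open>r / (2 K)\<close>. All of these lie in one ball
  comparable to \<open>B z R\<close>, and by doubling each carries a fixed fraction of its measure, so there can
  be only a bounded number of them.\<close>

lemma separated_finite_card:
  assumes T: "finite T" "T \<subseteq> B z R" and z: "z \<in> space M" and r: "0 < r" "r \<le> c * R" and c: "1 \<le> c"
    and R: "0 < R" "R \<le> c * r"
    and sep: "\<And>s t. s \<in> T \<Longrightarrow> t \<in> T \<Longrightarrow> s \<noteq> t \<Longrightarrow> r \<le> \<rho> s t"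
  shows "real (card T) \<le> growth (8 * K ^ 3 * c ^ 2)"
proof -
  have K0: "0 < K" using K_ge_1 by simp
  \<comment> \<open>The small balls all lie in \<open>B z Q\<close>, which in turn lies in \<open>B t (4 K\<^sup>2 c R)\<close> for every \<open>t\<close> in \<open>T\<close>.\<close>
  define Q where "Q = 2 * K * (c * R)"
  have RcR: "R \<le> c * R" using c R by simp
  have Tsp: "t \<in> space M" "\<rho> z t < R" "\<rho> t z < R" if "t \<in> T" for t
    using subsetD[OF T(2) that] rho_sym[of z t] z by (auto simp: in_ball_iff)
  have disj: "disjoint_family_on (\<lambda>t. B t (r / (2 * K))) T"
    unfolding disjoint_family_on_def
  proof (intro ballI impI)
    fix s t assume st: "s \<in> T" "t \<in> T" "s \<noteq> t"
    show "B s (r / (2 * K)) \<inter> B t (r / (2 * K)) = {}"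
    proof (rule ccontr)
      assume "B s (r / (2 * K)) \<inter> B t (r / (2 * K)) \<noteq> {}"
      then obtain w where w: "w \<in> space M" "\<rho> s w < r / (2 * K)" "\<rho> t w < r / (2 * K)"
        by (auto simp: in_ball_iff)
      have "\<rho> s t \<le> K * (\<rho> s w + \<rho> w t)" using rho_triangle w Tsp st by blast
      also have "\<dots> < K * (r / (2 * K) + r / (2 * K))"
        using w K0 rho_sym[of t w] Tsp st by (intro mult_strict_left_mono add_strict_mono) auto
      also have "\<dots> = r" using K0 by (simp add: field_simps)
      finally show False using sep[OF st] by simp
    qed
  qed
  have sub: "B t (r / (2 * K)) \<subseteq> B z Q" if "t \<in> T" for t
  proof (rule ball_subset_ball)
    have "r / (2 * K) \<le> r" using r K_ge_1 by (simp add: field_simps)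
    then have "\<rho> z t + r / (2 * K) \<le> c * R + c * R" using Tsp[OF that] r RcR by linarith
    then show "K * (\<rho> z t + r / (2 * K)) \<le> Q"
      using mult_left_mono[of "\<rho> z t + r / (2 * K)" "c * R + c * R" K] K0
        by (simp add: Q_def algebra_simps)
  qed (use Tsp that z in auto)
  have low: "vol z Q \<le> growth (8 * K ^ 3 * c ^ 2) * vol t (r / (2 * K))" if "t \<in> T" for t
  proof -
    have K2: "c * R \<le> K * (c * R)" using K_ge_1 c R by simp
    have "B z Q \<subseteq> B t (4 * K ^ 2 * (c * R))"
    proof (rule ball_subset_ball)
      have "\<rho> t z + Q \<le> 4 * K * (c * R)" using Tsp(3)[OF that] RcR K2 R(1) unfolding Q_def mult.assoc by linarith
      then show "K * (\<rho> t z + Q) \<le> 4 * K ^ 2 * (c * R)"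
        using mult_left_mono[of "\<rho> t z + Q" "4 * K * (c * R)" K] K0
        by (simp add: power2_eq_square algebra_simps)
    qed (use Tsp that z in auto)
    then have "vol z Q \<le> vol t (4 * K ^ 2 * (c * R))" using Tsp that z by (intro vol_le_if_subset) auto
    also have "\<dots> \<le> growth (8 * K ^ 3 * c ^ 2) * vol t (r / (2 * K))"
    proof (rule vol_growth)
      show "1 \<le> 8 * K ^ 3 * c ^ 2"
        using mult_mono[OF one_le_power[OF K_ge_1, of 3] one_le_power[OF c, of 2]] K_ge_1 by simp
      have "4 * K ^ 2 * (c * R) \<le> 4 * K ^ 2 * (c * (c * r))"
        using R c by (intro mult_left_mono) auto
      also have "\<dots> = 8 * K ^ 3 * c ^ 2 * (r / (2 * K))"
        using K0 by (simp add: field_simps power2_eq_square power3_eq_cube)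
      finally show "4 * K ^ 2 * (c * R) \<le> 8 * K ^ 3 * c ^ 2 * (r / (2 * K))" .
    qed (use Tsp that r K0 in auto)
    finally show ?thesis .
  qed
  have Qpos: "0 < vol z Q" using vol_pos[OF z] c R K0 by (simp add: Q_def)
  have "ennreal (\<Sum>t\<in>T. vol t (r / (2 * K))) = (\<Sum>t\<in>T. emeasure M (B t (r / (2 * K))))"
    using Tsp by (simp add: emeasure_ball vol_nonneg flip: sum_ennreal)
  also have "\<dots> = emeasure M (\<Union>t\<in>T. B t (r / (2 * K)))"
    using T Tsp disj by (intro sum_emeasure) auto
  also have "\<dots> \<le> emeasure M (B z Q)" using sub z by (intro emeasure_mono) auto
  finally have "ennreal (\<Sum>t\<in>T. vol t (r / (2 * K))) \<le> ennreal (vol z Q)"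
    using emeasure_ball z by simp
  then have S: "(\<Sum>t\<in>T. vol t (r / (2 * K))) \<le> vol z Q" using vol_nonneg by simp
  have "real (card T) * vol z Q = (\<Sum>t\<in>T. vol z Q)" by simp
  also have "\<dots> \<le> (\<Sum>t\<in>T. growth (8 * K ^ 3 * c ^ 2) * vol t (r / (2 * K)))" by (intro sum_mono low)
  also have "\<dots> \<le> growth (8 * K ^ 3 * c ^ 2) * vol z Q"
    using S growth_ge_1[of "8 * K ^ 3 * c ^ 2"] by (simp add: mult_left_mono flip: sum_distrib_left)
  finally show ?thesis using Qpos by simp
qed

definition separated_set :: "real \<Rightarrow> 'a set \<Rightarrow> bool" where
  "separated_set r S \<longleftrightarrow> S \<subseteq> space M \<and> (\<forall>s\<in>S. \<forall>t\<in>S. s \<noteq> t \<longrightarrow> r \<le> \<rho> s t)"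

lemma separated_in_ball:
  assumes S: "separated_set r S" and z: "z \<in> space M" and r: "0 < r" "r \<le> c * R" and c: "1 \<le> c"
    and R: "0 < R" "R \<le> c * r"
  shows "finite (S \<inter> B z R)" "real (card (S \<inter> B z R)) \<le> growth (8 * K ^ 3 * c ^ 2)"
proof -
  have fin: "real (card T) \<le> growth (8 * K ^ 3 * c ^ 2)" if "finite T" "T \<subseteq> S \<inter> B z R" for T
  proof (rule separated_finite_card[OF that(1) _ z r c R])
    show "T \<subseteq> B z R" using that by blast
    show "r \<le> \<rho> s t" if "s \<in> T" "t \<in> T" "s \<noteq> t" for s t
      using that \<open>T \<subseteq> S \<inter> B z R\<close> S unfolding separated_set_def by blast
  qed
  show f: "finite (S \<inter> B z R)"
  proof (rule ccontr)
    assume "infinite (S \<inter> B z R)"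
    then obtain T where T: "T \<subseteq> S \<inter> B z R" "finite T" "card T = nat \<lceil>growth (8 * K ^ 3 * c ^ 2)\<rceil> + 1"
      using infinite_arbitrarily_large by metis
    then show False using fin[OF T(2,1)] by linarith
  qed
  show "real (card (S \<inter> B z R)) \<le> growth (8 * K ^ 3 * c ^ 2)" using fin[OF f] by simp
qed

lemma separated_countable:
  assumes S: "separated_set r S" and r: "0 < r"
  shows "countable S"
proof (cases "S = {}")
  case False
  then obtain z where z: "z \<in> S" "z \<in> space M" using S by (auto simp: separated_set_def)
  have "S \<subseteq> (\<Union>n. S \<inter> B z (real (Suc n)))"
  proof
    fix x assume x: "x \<in> S"
    obtain n where "\<rho> z x < real n" using reals_Archimedean2 by blast
    then have "\<rho> z x < real (Suc n)" by simp
    then show "x \<in> (\<Union>n. S \<inter> B z (real (Suc n)))"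
      using x S by (auto simp: in_ball_iff separated_set_def)
  qed
  moreover
  have "finite (S \<inter> B z (real (Suc n)))" for n
  proof -
    define c where "c = 1 + r / real (Suc n) + real (Suc n) / r"
    have c0: "1 \<le> c" "r / real (Suc n) \<le> c" "real (Suc n) / r \<le> c" using r by (auto simp: c_def)
    have "r \<le> c * real (Suc n)" "real (Suc n) \<le> c * r"
      using c0(2,3) r by (simp_all add: pos_divide_le_eq)
    note c = c0(1) this
    show ?thesis by (rule separated_in_ball(1)[OF S z(2) r c(2,1) _ c(3)]) simp
  qed
  then have "countable (\<Union>n. S \<inter> B z (real (Suc n)))"
    by (intro countable_UN countable_finite countableI_type)
  ultimately show ?thesis by (rule countable_subset)
qed simp

text \<open>By Zorn's lemma there is a maximal separated subset; maximality is exactly the covering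
  property.\<close>

lemma exists_net:
  assumes A: "A \<subseteq> space M" and r: "0 < r"
  shows "\<exists>S. S \<subseteq> A \<and> separated_set r S \<and> (\<forall>x\<in>A. \<exists>s\<in>S. \<rho> s x < r)"
proof -
  define F where "F = {S. S \<subseteq> A \<and> separated_set r S}"
  have "\<exists>S\<in>F. \<forall>T\<in>F. S \<subseteq> T \<longrightarrow> T = S"
  proof (rule subset_Zorn')
    fix C assume C: "subset.chain F C"
    show "\<Union>C \<in> F"
      unfolding F_def separated_set_def
    proof (intro CollectI conjI ballI impI)
      show "\<Union>C \<subseteq> A" "\<Union>C \<subseteq> space M" using C A by (auto simp: subset.chain_def F_def)
      fix s t assume st: "s \<in> \<Union>C" "t \<in> \<Union>C" "s \<noteq> t"
      then obtain S T where ST: "S \<in> C" "s \<in> S" "T \<in> C" "t \<in> T" by blast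
      have CF: "C \<subseteq> F" and "S \<subseteq> T \<or> T \<subseteq> S"
        using C ST(1,3) by (simp_all add: subset_chain_def)
      then have "\<exists>V\<in>C. s \<in> V \<and> t \<in> V"
        using ST by (meson subsetD)
      then obtain V where "V \<in> F" "s \<in> V" "t \<in> V"
        using CF by (meson subsetD)
      then show "r \<le> \<rho> s t" using st by (auto simp: F_def separated_set_def)
    qed
  qed
  then obtain S where S: "S \<in> F" and max: "\<And>T. T \<in> F \<Longrightarrow> S \<subseteq> T \<Longrightarrow> T = S" by blast
  have Ssub: "S \<subseteq> A" "\<And>s. s \<in> S \<Longrightarrow> s \<in> space M"
    and Ssep: "\<And>s t. s \<in> S \<Longrightarrow> t \<in> S \<Longrightarrow> s \<noteq> t \<Longrightarrow> r \<le> \<rho> s t"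
    using S A by (auto simp: F_def separated_set_def)
  have "\<exists>s\<in>S. \<rho> s x < r" if x: "x \<in> A" for x
  proof (rule ccontr)
    assume "\<not> (\<exists>s\<in>S. \<rho> s x < r)"
    then have far: "\<forall>s\<in>S. r \<le> \<rho> s x" by force
    then have "\<forall>s\<in>S. r \<le> \<rho> x s"
      using rho_sym[of x] Ssub x A by auto
    with far have "insert x S \<in> F"
      using Ssub(1) Ssep x A unfolding F_def separated_set_def by auto
    then have "x \<in> S" using max[of "insert x S"] by blast
    moreover have "\<rho> x x = 0" using rho_eq_0[of x x] x A by blast
    ultimately show False using far r by force
  qed
  with S show ?thesis by (auto simp: F_def)
qed

text \<open>The balls of a quasi-metric need not be quasi-open, so the Lindelof property is obtained from
  nets: the points of \<open>\<Omega>\<close> whose ball of radius \<open>1 / Suc n\<close> stays inside \<open>\<Omega>\<close> admit a countable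
  net of that mesh, and the balls around all of these nets exhaust \<open>\<Omega>\<close>.\<close>

lemma quasi_open_measurable:
  assumes "quasi_open M \<rho> \<Omega>"
  shows "\<Omega> \<in> sets M"
proof -
  define A where "A n = {x \<in> \<Omega>. B x (1 / real (Suc n)) \<subseteq> \<Omega>}" for n
  have sub: "\<Omega> \<subseteq> space M" using assms by (simp add: quasi_open_def)
  have "\<exists>S. S \<subseteq> A n \<and> separated_set (1 / real (Suc n)) S \<and> (\<forall>x\<in>A n. \<exists>s\<in>S. \<rho> s x < 1 / real (Suc n))" for n
    using sub by (intro exists_net) (auto simp: A_def)
  then obtain S where S: "\<And>n. S n \<subseteq> A n" "\<And>n. separated_set (1 / real (Suc n)) (S n)"
    "\<And>n x. x \<in> A n \<Longrightarrow> \<exists>s\<in>S n. \<rho> s x < 1 / real (Suc n)" by metis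
  have cnt: "countable (S n)" for n using S(2) by (rule separated_countable) simp
  have "\<Omega> = (\<Union>n. \<Union>s\<in>S n. B s (1 / real (Suc n)))"
  proof
    show "(\<Union>n. \<Union>s\<in>S n. B s (1 / real (Suc n))) \<subseteq> \<Omega>" using S(1) by (fastforce simp: A_def)
    show "\<Omega> \<subseteq> (\<Union>n. \<Union>s\<in>S n. B s (1 / real (Suc n)))"
    proof
      fix x assume x: "x \<in> \<Omega>"
      then obtain r where r: "r > 0" "B x r \<subseteq> \<Omega>" using assms by (auto simp: quasi_open_def)
      obtain n where "1 / real (Suc n) < r" using nat_approx_posE[OF r(1)] by blast
      then have "x \<in> A n" using x r ball_mono[of "1 / real (Suc n)" r x] by (auto simp: A_def)
      then obtain s where "s \<in> S n" "\<rho> s x < 1 / real (Suc n)" using S(3) by blast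
      then show "x \<in> (\<Union>n. \<Union>s\<in>S n. B s (1 / real (Suc n)))"
        using x sub by (auto simp: in_ball_iff)
    qed
  qed
  moreover have "(\<Union>n. \<Union>s\<in>S n. B s (1 / real (Suc n))) \<in> sets M"
  proof (rule sets.countable_UN)
    have "(\<Union>s\<in>S n. B s (1 / real (Suc n))) \<in> sets M" for n
      using S(1)[of n] sub by (intro sets.countable_UN' cnt ball_meas) (auto simp: A_def)
    then show "range (\<lambda>n. \<Union>s\<in>S n. B s (1 / real (Suc n))) \<subseteq> sets M" by blast
  qed
  ultimately show ?thesis by simp
qed

section \<open>The kernel at large distances\<close>

text \<open>The kernel of the Gagliardo functional with \<open>U\<close> replaced by the measure of the ball centred at the
  first argument. It is measurable in the second argument because
  \<open>r \<mapsto> vol x r\<close> is monotone, whereas \<open>U\<close> need not be. On the diagonal its value is \<open>1 / 0 = 0\<close>, which agrees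
  with the convention for the integrand.\<close>

definition kern :: "real \<Rightarrow> 'a \<Rightarrow> 'a \<Rightarrow> real" where
  "kern \<sigma> x y = 1 / (vol x (\<rho> x y) * \<rho> x y powr \<sigma>)"

lemma rho_measurable [measurable]:
  assumes "x \<in> space M" shows "\<rho> x \<in> borel_measurable M"
proof (subst borel_measurable_iff_less, intro allI)
  fix a
  have "{w \<in> space M. \<rho> x w < a} = B x a" by (simp add: qball_def)
  then show "{w \<in> space M. \<rho> x w < a} \<in> sets M" using assms by simp
qed

lemma kern_measurable [measurable]:
  assumes [measurable]: "x \<in> space M" shows "kern \<sigma> x \<in> borel_measurable M"
proof -
  have "mono (vol x)" using vol_mono assms by (auto simp: mono_def)
  then have [measurable]: "vol x \<in> borel_measurable borel" by (rule borel_measurable_mono)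
  show ?thesis unfolding kern_def by measurable
qed

lemma kern_nonneg: "0 \<le> kern \<sigma> x y"
  by (simp add: kern_def vol_nonneg)

lemma kern_antimono:
  assumes x: "x \<in> space M" "y \<in> space M" and "\<rho> x y < 1" "\<sigma> \<le> \<tau>"
  shows "kern \<sigma> x y \<le> kern \<tau> x y"
proof (cases "\<rho> x y = 0")
  case False
  then have p: "0 < \<rho> x y" using rho_nonneg[OF x] by simp
  have "\<rho> x y powr \<tau> \<le> \<rho> x y powr \<sigma>" using p assms by (intro powr_mono') auto
  then show ?thesis unfolding kern_def
    using p vol_pos[OF x(1) p] by (intro divide_left_mono mult_left_mono mult_pos_pos) auto
qed (simp add: kern_def)

lemma U_fun_le: "U_fun M \<rho> x y \<le> vol x (\<rho> x y)"
  by (simp add: U_fun_def vol_def)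

text \<open>With \<open>r = \<rho> x y\<close>, the ball \<open>B x r\<close> lies in \<open>B y (2 K r)\<close>, so the two balls in the definition of
  \<open>U\<close> have comparable measure.\<close>

lemma vol_le_U_fun:
  assumes x: "x \<in> space M" "y \<in> space M" "x \<noteq> y"
  shows "vol x (\<rho> x y) \<le> growth (2 * K) * U_fun M \<rho> x y"
proof -
  have p: "0 < \<rho> x y" using rho_nonneg[OF x(1,2)] rho_eq_0[OF x(1,2)] x(3) by simp
  have "vol x (\<rho> x y) \<le> vol y (2 * K * \<rho> x y)"
    using x rho_sym[OF x(1,2)] by (intro vol_le_if_subset ball_subset_ball) auto
  also have "\<dots> \<le> growth (2 * K) * vol y (\<rho> x y)" using x p K_ge_1 by (intro vol_growth) auto
  finally have 1: "vol x (\<rho> x y) \<le> growth (2 * K) * vol y (\<rho> x y)" .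
  have 2: "vol x (\<rho> x y) \<le> growth (2 * K) * vol x (\<rho> x y)"
    using mult_right_mono[OF growth_ge_1 vol_nonneg] by simp
  show ?thesis using 1 2 unfolding U_fun_def vol_def[symmetric] by (simp add: min_def)
qed

lemma kern_le_U_kernel:
  assumes x: "x \<in> space M" "y \<in> space M" "x \<noteq> y"
  shows "kern \<sigma> x y \<le> 1 / (U_fun M \<rho> x y * \<rho> x y powr \<sigma>)"
    "1 / (U_fun M \<rho> x y * \<rho> x y powr \<sigma>) \<le> growth (2 * K) * kern \<sigma> x y"
proof -
  have p: "0 < \<rho> x y" using rho_nonneg[OF x(1,2)] rho_eq_0[OF x(1,2)] x(3) by simp
  have U: "0 < U_fun M \<rho> x y"
    using vol_pos[OF x(1) p] vol_pos[OF x(2) p] by (simp add: U_fun_def vol_def)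
  show "kern \<sigma> x y \<le> 1 / (U_fun M \<rho> x y * \<rho> x y powr \<sigma>)"
    unfolding kern_def using U p vol_pos[OF x(1) p] U_fun_le
    by (intro divide_left_mono mult_right_mono mult_pos_pos) auto
  have "vol x (\<rho> x y) * \<rho> x y powr \<sigma> \<le> growth (2 * K) * U_fun M \<rho> x y * \<rho> x y powr \<sigma>"
    using vol_le_U_fun[OF x] by (intro mult_right_mono) auto
  then show "1 / (U_fun M \<rho> x y * \<rho> x y powr \<sigma>) \<le> growth (2 * K) * kern \<sigma> x y"
    unfolding kern_def using U p vol_pos[OF x(1) p] by (simp add: field_simps)
qed

text \<open>On the dyadic shell \<open>2\<^sup>k R \<le> \<rho> x y < 2\<^sup>k\<^sup>+\<^sup>1 R\<close> the kernel is at most a constant times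
  \<open>(2\<^sup>k R)\<^sup>-\<^sup>\<sigma>\<close> divided by the measure of the ball of radius \<open>2\<^sup>k\<^sup>+\<^sup>1 R\<close>. The kernel at large
  distances is thus controlled by a geometric superposition of averages over balls.\<close>

lemma far_kernel_le:
  assumes x [measurable]: "x \<in> space M" and R: "0 < R" and \<sigma>: "0 < \<sigma>"
    and [measurable]: "h \<in> borel_measurable M"
  shows "(\<integral>\<^sup>+y\<in>{y \<in> space M. R \<le> \<rho> x y}. h y * ennreal (kern \<sigma> x y) \<partial>M)
    \<le> (\<Sum>k. ennreal (L * (2 ^ k * R) powr (- \<sigma>) / vol x (2 ^ Suc k * R))
             * (\<integral>\<^sup>+y\<in>B x (2 ^ Suc k * R). h y \<partial>M))"
proof -
  define c where "c k = ennreal (L * (2 ^ k * R) powr (- \<sigma>) / vol x (2 ^ Suc k * R))" for k :: nat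
  have pt: "h y * ennreal (kern \<sigma> x y) * indicator {y \<in> space M. R \<le> \<rho> x y} y
      \<le> (\<Sum>k. c k * (h y * indicator (B x (2 ^ Suc k * R)) y))" if y: "y \<in> space M" for y
  proof (cases "R \<le> \<rho> x y")
    case True
    obtain k :: nat where k: "2 ^ k * R \<le> \<rho> x y" "\<rho> x y < 2 ^ Suc k * R"
      using exists_geometric_shell[OF R True, of 2] by auto
    have kR: "0 < 2 ^ k * R" using R by simp
    have m1: "0 < vol x (2 ^ k * R)" using vol_pos[OF x kR] .
    have m2: "0 < vol x (2 ^ Suc k * R)" using vol_pos[OF x, of "2 ^ Suc k * R"] R by simp
    have "vol x (2 ^ Suc k * R) \<le> L * vol x (2 ^ k * R)"
      using vol_double[OF x kR] by (simp add: mult.assoc)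
    also have "\<dots> \<le> L * vol x (\<rho> x y)" using vol_mono[OF x k(1)] L_ge_1 by simp
    finally have mm: "vol x (2 ^ Suc k * R) \<le> L * vol x (\<rho> x y)" .
    have m3: "0 < vol x (\<rho> x y)" using m1 vol_mono[OF x k(1)] by simp
    have "kern \<sigma> x y = (1 / vol x (\<rho> x y)) * \<rho> x y powr (- \<sigma>)"
      using k kR by (simp add: kern_def powr_minus_divide)
    also have "\<dots> \<le> (L / vol x (2 ^ Suc k * R)) * (2 ^ k * R) powr (- \<sigma>)"
    proof (rule mult_mono)
      show "1 / vol x (\<rho> x y) \<le> L / vol x (2 ^ Suc k * R)" using mm m2 m3 by (simp add: field_simps)
      show "\<rho> x y powr (- \<sigma>) \<le> (2 ^ k * R) powr (- \<sigma>)" using k kR \<sigma> by (intro powr_mono2') auto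
    qed (use m2 L_ge_1 in auto)
    finally have "ennreal (kern \<sigma> x y) \<le> c k"
      unfolding c_def by (intro ennreal_leI) simp
    then have "h y * ennreal (kern \<sigma> x y) \<le> c k * h y"
      by (subst mult.commute) (rule mult_right_mono, auto)
    also have "\<dots> = (\<Sum>k\<in>{k}. c k * (h y * indicator (B x (2 ^ Suc k * R)) y))"
      using k y by (simp add: in_ball_iff)
    also have "\<dots> \<le> (\<Sum>k. c k * (h y * indicator (B x (2 ^ Suc k * R)) y))"
      by (intro sum_le_suminf) auto
    finally show ?thesis using True y by simp
  qed simp
  have "(\<integral>\<^sup>+y\<in>{y \<in> space M. R \<le> \<rho> x y}. h y * ennreal (kern \<sigma> x y) \<partial>M)
     \<le> (\<integral>\<^sup>+y. (\<Sum>k. c k * (h y * indicator (B x (2 ^ Suc k * R)) y)) \<partial>M)"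
    by (intro nn_integral_mono pt)
  also have "\<dots> = (\<Sum>k. \<integral>\<^sup>+y. c k * (h y * indicator (B x (2 ^ Suc k * R)) y) \<partial>M)"
    using x by (intro nn_integral_suminf) measurable
  also have "\<dots> = (\<Sum>k. c k * (\<integral>\<^sup>+y\<in>B x (2 ^ Suc k * R). h y \<partial>M))"
    using x by (intro suminf_cong nn_integral_cmult) measurable
  finally show ?thesis by (simp add: c_def)
qed

lemma suminf_geometric_powr:
  assumes "1 < \<Lambda>" "0 < R" "0 < \<sigma>" "0 \<le> a"
  shows "(\<Sum>k. ennreal (a * (\<Lambda> ^ k * R) powr (- \<sigma>)))
    = ennreal (a * R powr (- \<sigma>) / (1 - \<Lambda> powr (- \<sigma>)))"
proof -
  have b: "\<Lambda> powr (- \<sigma>) < 1" using assms by (simp add: powr_less_one)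
  have "(\<lambda>k. a * R powr (- \<sigma>) * (\<Lambda> powr (- \<sigma>)) ^ k)
      sums (a * R powr (- \<sigma>) * (1 / (1 - \<Lambda> powr (- \<sigma>))))"
    using b by (intro sums_mult geometric_sums) simp
  moreover have "(\<lambda>k. a * (\<Lambda> ^ k * R) powr (- \<sigma>))
      = (\<lambda>k. a * R powr (- \<sigma>) * (\<Lambda> powr (- \<sigma>)) ^ k)"
  proof
    fix k
    have "(\<Lambda> ^ k) powr (- \<sigma>) = (\<Lambda> powr (- \<sigma>)) ^ k"
      using assms by (simp add: powr_realpow[symmetric] powr_powr powr_power mult.commute)
    then show "a * (\<Lambda> ^ k * R) powr (- \<sigma>) = a * R powr (- \<sigma>) * (\<Lambda> powr (- \<sigma>)) ^ k"
      using assms by (simp add: powr_mult)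
  qed
  ultimately have "(\<lambda>k. a * (\<Lambda> ^ k * R) powr (- \<sigma>)) sums (a * R powr (- \<sigma>) / (1 - \<Lambda> powr (- \<sigma>)))"
    by simp
  then show ?thesis using assms by (intro suminf_ennreal_eq) auto
qed

lemma far_kernel_bound:
  assumes x: "x \<in> space M" and R: "1 \<le> R" and \<sigma>: "0 < \<sigma>" and a: "0 \<le> a"
    and h: "h \<in> borel_measurable M"
    and av: "\<And>r. R \<le> r \<Longrightarrow> (\<integral>\<^sup>+y\<in>B x r. h y \<partial>M) \<le> ennreal (a * vol x r)"
  shows "(\<integral>\<^sup>+y\<in>{y \<in> space M. R \<le> \<rho> x y}. h y * ennreal (kern \<sigma> x y) \<partial>M)
    \<le> ennreal (L * a / (1 - 2 powr (- \<sigma>)))"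
proof -
  have R0: "0 < R" using R by simp
  have "(\<integral>\<^sup>+y\<in>{y \<in> space M. R \<le> \<rho> x y}. h y * ennreal (kern \<sigma> x y) \<partial>M)
    \<le> (\<Sum>k. ennreal (L * (2 ^ k * R) powr (- \<sigma>) / vol x (2 ^ Suc k * R))
             * (\<integral>\<^sup>+y\<in>B x (2 ^ Suc k * R). h y \<partial>M))"
    by (rule far_kernel_le[OF x R0 \<sigma> h])
  also have "\<dots> \<le> (\<Sum>k. ennreal ((L * a) * (2 ^ k * R) powr (- \<sigma>)))"
  proof (rule suminf_le)
    fix k :: nat
    have ge: "R \<le> 2 ^ Suc k * R"
      using mult_right_mono[OF one_le_power[of "2::real" "Suc k"], of R] R by simp
    have m2: "0 < vol x (2 ^ Suc k * R)" using vol_pos[OF x, of "2 ^ Suc k * R"] R by simp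
    have "ennreal (L * (2 ^ k * R) powr (- \<sigma>) / vol x (2 ^ Suc k * R))
             * (\<integral>\<^sup>+y\<in>B x (2 ^ Suc k * R). h y \<partial>M)
        \<le> ennreal (L * (2 ^ k * R) powr (- \<sigma>) / vol x (2 ^ Suc k * R))
             * ennreal (a * vol x (2 ^ Suc k * R))"
      by (intro mult_left_mono av ge) auto
    also have "\<dots> = ennreal (L * (2 ^ k * R) powr (- \<sigma>) / vol x (2 ^ Suc k * R) * (a * vol x (2 ^ Suc k * R)))"
      using L_ge_1 m2 a by (intro ennreal_mult[symmetric]) auto
    also have "L * (2 ^ k * R) powr (- \<sigma>) / vol x (2 ^ Suc k * R) * (a * vol x (2 ^ Suc k * R))
      = (L * a) * (2 ^ k * R) powr (- \<sigma>)" using m2 by simp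
    finally show "ennreal (L * (2 ^ k * R) powr (- \<sigma>) / vol x (2 ^ Suc k * R))
             * (\<integral>\<^sup>+y\<in>B x (2 ^ Suc k * R). h y \<partial>M) \<le> ennreal ((L * a) * (2 ^ k * R) powr (- \<sigma>))" .
  qed auto
  also have "\<dots> = ennreal ((L * a) * R powr (- \<sigma>) / (1 - 2 powr (- \<sigma>)))"
    using R \<sigma> a L_ge_1 by (intro suminf_geometric_powr) auto
  also have "\<dots> \<le> ennreal (L * a / (1 - 2 powr (- \<sigma>)))"
  proof (intro ennreal_leI divide_right_mono)
    have "R powr (- \<sigma>) \<le> R powr 0" using R \<sigma> by (intro powr_mono) auto
    then have "R powr (- \<sigma>) \<le> 1" using R by simp
    then show "L * a * R powr (- \<sigma>) \<le> L * a"
      using mult_left_mono[of "R powr (- \<sigma>)" 1 "L * a"] a L_ge_1 by simp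
    show "0 \<le> 1 - 2 powr (- \<sigma>)" using \<sigma> powr_mono[of "- \<sigma>" 0 2] by simp
  qed
  finally show ?thesis .
qed

text \<open>Used to move the WRD and WMD conditions from their particular centre to
  an arbitrary point, at the price of a constant factor in the radius.\<close>

lemma ball_transfer:
  assumes "x \<in> space M" "z \<in> space M" "\<rho> x z \<le> r" "2 * K * r \<le> r'"
  shows "vol z r \<le> vol x r'"
proof (intro vol_le_if_subset ball_subset_ball)
  have "K * (\<rho> x z + r) \<le> K * (r + r)" using assms K_ge_1 by (intro mult_left_mono) auto
  then show "K * (\<rho> x z + r) \<le> r'" using assms by (simp add: algebra_simps)
qed (use assms in auto)

lemma ratio_eventually_ge:
  assumes x: "x \<in> space M" and A: "\<And>r. A r \<in> sets M" "\<And>r. A r \<subseteq> B x (c * r)"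
    and lim: "ennreal C \<le> Liminf at_top (\<lambda>r. emeasure M (A r) / emeasure M (B x r))"
    and C': "0 < C'" "C' < C"
  shows "\<exists>r0>0. \<forall>r\<ge>r0. C' * vol x r \<le> measure M (A r)"
proof -
  have "ennreal C' < Liminf at_top (\<lambda>r. emeasure M (A r) / emeasure M (B x r))"
    using lim C' by (intro less_le_trans[OF _ lim]) (simp add: ennreal_less_iff)
  then have "\<forall>\<^sub>F r in at_top. ennreal C' < emeasure M (A r) / emeasure M (B x r)"
    by (rule less_LiminfD)
  then obtain r1 where r1: "\<And>r. r1 \<le> r \<Longrightarrow> ennreal C' < emeasure M (A r) / emeasure M (B x r)"
    by (auto simp: eventually_at_top_linorder)
  have "C' * vol x r \<le> measure M (A r)" if "max r1 1 \<le> r" for r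
  proof -
    have r: "0 < r" "r1 \<le> r" using that by auto
    have "emeasure M (A r) \<le> emeasure M (B x (c * r))" using A x by (intro emeasure_mono) auto
    also have "\<dots> < \<infinity>" using emeasure_ball[OF x] by simp
    finally have "emeasure M (A r) = ennreal (measure M (A r))"
      by (intro emeasure_eq_ennreal_measure) auto
    then have "ennreal C' < ennreal (measure M (A r) / vol x r)"
      using r1[OF r(2)] vol_pos[OF x r(1)] emeasure_ball[OF x] by (simp add: divide_ennreal)
    then have "C' < measure M (A r) / vol x r"
      using C' by (simp add: ennreal_less_iff)
    then show ?thesis using vol_pos[OF x r(1)] by (simp add: field_simps)
  qed
  then show ?thesis by (intro exI[of _ "max r1 1"]) auto
qed

text \<open>Iterating WRD makes the measure ratio as large as desired, at the price of a larger
  dilation \<open>\<Lambda>\<close>. The dilation does not depend on the point; only the radius \<open>R0\<close> from which on the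
  estimate holds does.\<close>

lemma reverse_doubling:
  assumes "WRD M \<rho>" and \<eta>: "0 < \<eta>"
  shows "\<exists>\<Lambda>>1. \<forall>x\<in>space M. \<exists>R0>0. \<forall>r\<ge>R0. vol x r \<le> \<eta> * vol x (\<Lambda> * r)"
proof -
  obtain x0 l C where x0: "x0 \<in> space M" and l: "1 < l" and C: "1 < C"
    and lim: "ennreal C \<le> Liminf at_top
       (\<lambda>r. emeasure M (qball M \<rho> x0 (l * r)) / emeasure M (qball M \<rho> x0 r))"
    using assms(1) unfolding WRD_def by blast
  obtain C' where C': "1 < C'" "C' < C" using dense[OF C] by blast
  have "\<exists>r0>0. \<forall>r\<ge>r0. C' * vol x0 r \<le> measure M (B x0 (l * r))"
    by (rule ratio_eventually_ge[OF x0 _ _ lim]) (use C' x0 in auto)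
  then obtain r0 where r0: "0 < r0" "\<And>r. r0 \<le> r \<Longrightarrow> C' * vol x0 r \<le> vol x0 (l * r)"
    unfolding vol_def by blast
  have it: "C' ^ n * vol x0 r \<le> vol x0 (l ^ n * r)" if r: "r0 \<le> r" for r n
  proof (induction n)
    case (Suc n)
    have "1 * r \<le> l ^ n * r"
      using r r0(1) l by (intro mult_right_mono one_le_power) auto
    then have "r0 \<le> l ^ n * r" using r by linarith
    then have "C' * vol x0 (l ^ n * r) \<le> vol x0 (l ^ Suc n * r)"
      using r0(2) by (simp add: mult.assoc)
    moreover have "C' ^ Suc n * vol x0 r \<le> C' * vol x0 (l ^ n * r)"
      using mult_left_mono[OF Suc, of C'] C' by (simp add: mult.assoc)
    ultimately show ?case by linarith
  qed simp
  obtain n where n: "1 / \<eta> < C' ^ n" using real_arch_pow[OF C'(1)] by blast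
  \<comment> \<open>The factor \<open>4 K\<^sup>2\<close> pays for moving the centre to \<open>x0\<close> and back.\<close>
  define \<Lambda> where "\<Lambda> = 4 * K ^ 2 * l ^ n"
  have K2: "1 \<le> K ^ 2" and ln: "1 \<le> l ^ n" using K_ge_1 l by (simp_all add: one_le_power)
  have L1: "1 < \<Lambda>" using mult_mono[OF K2 ln] by (simp add: \<Lambda>_def)
  have "\<exists>R0>0. \<forall>r\<ge>R0. vol x r \<le> \<eta> * vol x (\<Lambda> * r)" if x: "x \<in> space M" for x
  proof (intro exI conjI allI impI)
    show "0 < max r0 (\<rho> x x0)" using r0 by simp
    fix r assume "max r0 (\<rho> x x0) \<le> r"
    then have r: "r0 \<le> r" "\<rho> x x0 \<le> r" "0 < r" using r0 by auto
    have rK: "r \<le> 2 * K * r" using K_ge_1 r by simp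
    have lK: "2 * K * r \<le> l ^ n * (2 * K * r)" using mult_right_mono[OF ln, of "2 * K * r"] r rK by simp
    have "vol x r \<le> vol x0 (2 * K * r)"
      using r x x0 rho_sym[OF x x0] by (intro ball_transfer) auto
    then have "C' ^ n * vol x r \<le> C' ^ n * vol x0 (2 * K * r)" using C' by (intro mult_left_mono) auto
    also have "\<dots> \<le> vol x0 (l ^ n * (2 * K * r))" using order_trans[OF r(1) rK] by (rule it)
    also have "\<dots> \<le> vol x (\<Lambda> * r)"
    proof (rule ball_transfer[OF x x0])
      show "\<rho> x x0 \<le> l ^ n * (2 * K * r)" using r rK lK by linarith
    qed (simp add: \<Lambda>_def power2_eq_square)
    finally have "C' ^ n * vol x r \<le> vol x (\<Lambda> * r)" .
    moreover have "1 / \<eta> * vol x r \<le> C' ^ n * vol x r" using n vol_nonneg by (intro mult_right_mono) auto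
    ultimately have "1 / \<eta> * vol x r \<le> vol x (\<Lambda> * r)" by linarith
    then show "vol x r \<le> \<eta> * vol x (\<Lambda> * r)" using \<eta> by (simp add: field_simps)
  qed
  with L1 show ?thesis by blast
qed

lemma measure_density:
  assumes "WMD M \<rho> \<Omega>" and \<Omega>: "\<Omega> \<in> sets M"
  shows "\<exists>c>0. \<forall>x\<in>space M. \<exists>R0>0. \<forall>r\<ge>R0. c * vol x r \<le> measure M (B x r \<inter> \<Omega>)"
proof -
  obtain x0 C where x0: "x0 \<in> space M" and C: "0 < C"
    and lim: "ennreal C \<le> Liminf at_top
       (\<lambda>r. emeasure M (qball M \<rho> x0 r \<inter> \<Omega>) / emeasure M (qball M \<rho> x0 r))"
    using assms(1) unfolding WMD_def by blast
  have "\<exists>r0>0. \<forall>r\<ge>r0. (C / 2) * vol x0 r \<le> measure M (B x0 r \<inter> \<Omega>)"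
    by (rule ratio_eventually_ge[OF x0 _ _ lim, of 1]) (use C x0 \<Omega> in auto)
  then obtain r0 where r0: "0 < r0" "\<And>r. r0 \<le> r \<Longrightarrow> (C / 2) * vol x0 r \<le> measure M (B x0 r \<inter> \<Omega>)"
    by blast
  define D where "D = growth (4 * K ^ 2)"
  have D: "1 \<le> D" by (simp add: D_def growth_ge_1)
  have K0: "0 < K" using K_ge_1 by simp
  have "\<exists>R0>0. \<forall>r\<ge>R0. C / (2 * D) * vol x r \<le> measure M (B x r \<inter> \<Omega>)" if x: "x \<in> space M" for x
  proof (intro exI conjI allI impI)
    define R0 where "R0 = max (2 * K * r0) (2 * K * \<rho> x x0)"
    show "0 < R0" using r0(1) K0 by (simp add: R0_def less_max_iff_disj)
    fix r assume rr: "R0 \<le> r"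
    have r: "2 * K * r0 \<le> r" "2 * K * \<rho> x x0 \<le> r" "0 < r" using rr \<open>0 < R0\<close> by (auto simp: R0_def)
    define t where "t = r / (2 * K)"
    have rt: "r = 2 * K * t" using K0 by (simp add: t_def)
    have t: "r0 \<le> t" "\<rho> x x0 \<le> t" "0 < t" using r K0 by (auto simp: t_def field_simps)
    have tr: "t \<le> r" using K_ge_1 t by (simp add: rt)
    have "vol x r \<le> vol x0 (2 * K * r)"
      using t tr x x0 rho_sym[OF x x0] by (intro ball_transfer) auto
    also have "\<dots> \<le> D * vol x0 t"
      unfolding D_def using x0 t(3) mult_mono[of 1 K 1 K] K_ge_1
      by (intro vol_growth) (auto simp: rt power2_eq_square)
    finally have "C / (2 * D) * vol x r \<le> C / (2 * D) * (D * vol x0 t)"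
      using C D by (intro mult_left_mono) auto
    also have "\<dots> = C / 2 * vol x0 t" using D by simp
    also have "\<dots> \<le> measure M (B x0 t \<inter> \<Omega>)" using t by (intro r0)
    also have "\<dots> \<le> measure M (B x r \<inter> \<Omega>)"
    proof (rule measure_mono_fmeasurable)
      have "K * (\<rho> x x0 + t) \<le> r" using mult_left_mono[of "\<rho> x x0 + t" "t + t" K] t K0 by (simp add: rt algebra_simps)
      then show "B x0 t \<inter> \<Omega> \<subseteq> B x r \<inter> \<Omega>" using ball_subset_ball[OF x x0] by blast
      show "B x r \<inter> \<Omega> \<in> fmeasurable M"
        using emeasure_ball[OF x] x \<Omega>
        by (intro fmeasurable_Int_fmeasurable fmeasurableI) auto
    qed (use x0 \<Omega> in auto)
    finally show "C / (2 * D) * vol x r \<le> measure M (B x r \<inter> \<Omega>)" .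
  qed
  moreover have "0 < C / (2 * D)" using C D by simp
  ultimately show ?thesis by blast
qed

text \<open>In a large ball \<open>\<Omega>\<close> has a fixed proportion \<open>c\<close> of the measure, and by reverse doubling the
  concentric ball that is smaller by the factor \<open>\<Lambda>\<close> has only the proportion \<open>c / 2\<close>. So the shell
  between them contains a fixed proportion of \<open>\<Omega>\<close>.\<close>

lemma shell_mass:
  assumes "WRD M \<rho>" "WMD M \<rho> \<Omega>" and \<Omega>: "\<Omega> \<in> sets M"
  shows "\<exists>\<Lambda>>1. \<exists>c>0. \<forall>x\<in>space M. \<exists>R0>0. \<forall>r\<ge>R0.
    c * vol x (\<Lambda> * r) \<le> measure M (\<Omega> \<inter> (B x (\<Lambda> * r) - B x r))"
proof -
  obtain c where c: "0 < c" and
    dens: "\<And>x. x \<in> space M \<Longrightarrow> \<exists>R0>0. \<forall>r\<ge>R0. c * vol x r \<le> measure M (B x r \<inter> \<Omega>)"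
    using measure_density[OF assms(2,3)] by blast
  obtain \<Lambda> where \<Lambda>: "1 < \<Lambda>" and
    rd: "\<And>x. x \<in> space M \<Longrightarrow> \<exists>R0>0. \<forall>r\<ge>R0. vol x r \<le> c / 2 * vol x (\<Lambda> * r)"
    using reverse_doubling[OF assms(1), of "c / 2"] c by auto
  have "\<exists>R0>0. \<forall>r\<ge>R0. c / 2 * vol x (\<Lambda> * r) \<le> measure M (\<Omega> \<inter> (B x (\<Lambda> * r) - B x r))"
    if x: "x \<in> space M" for x
  proof -
    obtain R1 where R1: "0 < R1" "\<And>r. R1 \<le> r \<Longrightarrow> c * vol x r \<le> measure M (B x r \<inter> \<Omega>)"
      using dens[OF x] by blast
    obtain R2 where R2: "0 < R2" "\<And>r. R2 \<le> r \<Longrightarrow> vol x r \<le> c / 2 * vol x (\<Lambda> * r)"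
      using rd[OF x] by blast
    have "c / 2 * vol x (\<Lambda> * r) \<le> measure M (\<Omega> \<inter> (B x (\<Lambda> * r) - B x r))" if "max R1 R2 \<le> r" for r
    proof -
      have r: "0 < r" "R1 \<le> \<Lambda> * r" "R2 \<le> r"
      proof -
        show "0 < r" "R2 \<le> r" using that R1(1) by auto
        then have "1 * r \<le> \<Lambda> * r" using \<Lambda> by (intro mult_right_mono) auto
        then show "R1 \<le> \<Lambda> * r" using that by linarith
      qed
      have fm: "B x s \<in> fmeasurable M" for s
        using emeasure_ball[OF x] x by (intro fmeasurableI) auto
      have sub: "B x (\<Lambda> * r) \<inter> \<Omega> \<subseteq> (\<Omega> \<inter> (B x (\<Lambda> * r) - B x r)) \<union> B x r" by blast
      have f1: "\<Omega> \<inter> (B x (\<Lambda> * r) - B x r) \<in> fmeasurable M"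
        by (rule fmeasurableI2[OF fm[of "\<Lambda> * r"]]) (use x \<Omega> in auto)
      have "measure M (B x (\<Lambda> * r) \<inter> \<Omega>) \<le> measure M ((\<Omega> \<inter> (B x (\<Lambda> * r) - B x r)) \<union> B x r)"
        using sub x \<Omega> f1 fm by (intro measure_mono_fmeasurable fmeasurable.Un) auto
      also have "\<dots> \<le> measure M (\<Omega> \<inter> (B x (\<Lambda> * r) - B x r)) + vol x r"
        unfolding vol_def using f1 fm by (intro measure_Un_le) auto
      finally show ?thesis using R1(2)[OF r(2)] R2(2)[OF r(3)] by simp
    qed
    then show ?thesis using R1(1) by (intro exI[of _ "max R1 R2"]) auto
  qed
  then show ?thesis using \<Lambda> c by (intro exI[of _ \<Lambda>] conjI exI[of _ "c / 2"]) auto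
qed

text \<open>Each shell with ratio \<open>\<Lambda>\<close> contributes at least \<open>c\<close> times its outer radius to the power \<open>-\<sigma>\<close>; the
  shells are disjoint, and the contributions form a geometric series.\<close>

lemma far_kernel_lower:
  assumes x [measurable]: "x \<in> space M" and \<Omega> [measurable]: "\<Omega> \<in> sets M" and \<Lambda>: "1 < \<Lambda>" and c: "0 < c"
    and R: "0 < R" and \<sigma>: "0 < \<sigma>"
    and shell: "\<And>r. R \<le> r \<Longrightarrow> c * vol x (\<Lambda> * r) \<le> measure M (\<Omega> \<inter> (B x (\<Lambda> * r) - B x r))"
  shows "ennreal (c * (\<Lambda> * R) powr (- \<sigma>) / (1 - \<Lambda> powr (- \<sigma>)))
    \<le> (\<integral>\<^sup>+y\<in>{y \<in> \<Omega>. R \<le> \<rho> x y}. ennreal (kern \<sigma> x y) \<partial>M)"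
proof -
  define r where "r k = \<Lambda> ^ k * R" for k :: nat
  define S where "S k = \<Omega> \<inter> (B x (\<Lambda> * r k) - B x (r k))" for k
  define \<nu> where "\<nu> = density M (\<lambda>y. ennreal (kern \<sigma> x y))"
  have S_sets [measurable]: "S k \<in> sets M" for k unfolding S_def by measurable
  have r_mono: "r i \<le> r j" if "i \<le> j" for i j
    using that \<Lambda> R by (auto simp: r_def intro!: mult_right_mono power_increasing)
  have rR: "R \<le> r k" for k using r_mono[of 0 k] by (simp add: r_def)
  have rSuc: "\<Lambda> * r k = r (Suc k)" for k by (simp add: r_def)
  have "S i \<inter> S j = {}" if "i < j" for i j
    using r_mono[of "Suc i" j] that ball_mono[of "r (Suc i)" "r j" x] by (auto simp: S_def rSuc)
  then have disj: "disjoint_family S"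
    unfolding disjoint_family_on_def by (metis inf_commute linorder_neqE_nat)
  have low: "ennreal (c * (\<Lambda> ^ k * (\<Lambda> * R)) powr (- \<sigma>)) \<le> emeasure \<nu> (S k)" for k
  proof -
    define a where "a = 1 / (vol x (\<Lambda> * r k) * (\<Lambda> * r k) powr \<sigma>)"
    have rk: "0 < r k" "0 < \<Lambda> * r k" using R \<Lambda> by (auto simp: r_def)
    have mk: "0 < vol x (\<Lambda> * r k)" by (rule vol_pos[OF x rk(2)])
    have a: "0 < a" using mk rk(2) unfolding a_def by (intro divide_pos_pos mult_pos_pos) auto
    have ker: "a \<le> kern \<sigma> x y" if y: "y \<in> S k" for y
    proof -
      have y: "r k \<le> \<rho> x y" "\<rho> x y < \<Lambda> * r k" using y by (auto simp: S_def in_ball_iff)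
      have yp: "0 < \<rho> x y" using y rk by simp
      have "vol x (\<rho> x y) * \<rho> x y powr \<sigma> \<le> vol x (\<Lambda> * r k) * (\<Lambda> * r k) powr \<sigma>"
        using y yp \<sigma> vol_mono[OF x] vol_nonneg by (intro mult_mono powr_mono2) auto
      then show ?thesis unfolding a_def kern_def
        using yp vol_pos[OF x yp] by (intro divide_left_mono mult_pos_pos) (use mk rk in auto)
    qed
    have Sf: "emeasure M (S k) = ennreal (measure M (S k))"
    proof (rule emeasure_eq_ennreal_measure)
      have "emeasure M (S k) \<le> emeasure M (B x (\<Lambda> * r k))"
        using x by (intro emeasure_mono) (auto simp: S_def)
      then show "emeasure M (S k) \<noteq> top" using emeasure_ball[OF x] by (auto simp: top_unique)
    qed
    have "c * (\<Lambda> ^ k * (\<Lambda> * R)) powr (- \<sigma>) = c * vol x (\<Lambda> * r k) * a"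
      using mk rk by (simp add: a_def r_def powr_minus_divide mult_ac)
    also have "\<dots> \<le> measure M (S k) * a"
      unfolding S_def using a by (intro mult_right_mono shell rR) auto
    finally have "ennreal (c * (\<Lambda> ^ k * (\<Lambda> * R)) powr (- \<sigma>)) \<le> ennreal (measure M (S k) * a)"
      by (rule ennreal_leI)
    also have "\<dots> = (\<integral>\<^sup>+y\<in>S k. ennreal a \<partial>M)"
      using Sf a by (simp add: nn_integral_cmult_indicator ennreal_mult mult.commute)
    also have "\<dots> \<le> (\<integral>\<^sup>+y\<in>S k. ennreal (kern \<sigma> x y) \<partial>M)"
      using ker by (intro nn_integral_mono) (auto split: split_indicator intro: ennreal_leI)
    also have "\<dots> = emeasure \<nu> (S k)"
      unfolding \<nu>_def by (subst emeasure_density) auto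
    finally show ?thesis .
  qed
  have far [measurable]: "{y \<in> \<Omega>. R \<le> \<rho> x y} \<in> sets M"
  proof -
    have "{y \<in> \<Omega>. R \<le> \<rho> x y} = \<Omega> - B x R"
      using sets.sets_into_space[OF \<Omega>] by (auto simp: in_ball_iff)
    then show ?thesis by simp
  qed
  have "ennreal (c * (\<Lambda> * R) powr (- \<sigma>) / (1 - \<Lambda> powr (- \<sigma>)))
      = (\<Sum>k. ennreal (c * (\<Lambda> ^ k * (\<Lambda> * R)) powr (- \<sigma>)))"
    using \<Lambda> R \<sigma> c by (intro suminf_geometric_powr[symmetric]) auto
  also have "\<dots> \<le> (\<Sum>k. emeasure \<nu> (S k))" by (intro suminf_le low) auto
  also have "\<dots> = emeasure \<nu> (\<Union>k. S k)"
    using disj by (intro suminf_emeasure) (auto simp: \<nu>_def)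
  also have "\<dots> \<le> emeasure \<nu> {y \<in> \<Omega>. R \<le> \<rho> x y}"
  proof (rule emeasure_mono)
    show "(\<Union>k. S k) \<subseteq> {y \<in> \<Omega>. R \<le> \<rho> x y}"
    proof
      fix y assume "y \<in> (\<Union>k. S k)"
      then obtain k where "y \<in> S k" by blast
      then show "y \<in> {y \<in> \<Omega>. R \<le> \<rho> x y}" using rR[of k] by (auto simp: S_def in_ball_iff)
    qed
  qed (simp add: \<nu>_def)
  also have "\<dots> = (\<integral>\<^sup>+y\<in>{y \<in> \<Omega>. R \<le> \<rho> x y}. ennreal (kern \<sigma> x y) \<partial>M)"
    unfolding \<nu>_def by (subst emeasure_density) auto
  finally show ?thesis .
qed

text \<open>That \<open>\<kappa>\<close> depends neither on \<open>x\<close> nor on \<open>R\<close> is essential, since \<open>R\<close> is later chosen depending on the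
  function and on \<open>x\<close>. It is independent of \<open>R\<close> because \<open>(\<Lambda> R)\<^sup>-\<^sup>s\<^sup>q\<close> tends to 1 as \<open>s\<close> tends to 0.\<close>

lemma far_kernel_lower_eventually:
  assumes "WRD M \<rho>" "WMD M \<rho> \<Omega>" and \<Omega>: "\<Omega> \<in> sets M" and q: "0 < q"
  shows "\<exists>\<kappa>>0. \<forall>x\<in>space M. \<exists>R0>0. \<forall>R\<ge>R0. \<forall>\<^sub>F s in at_right 0.
    ennreal (\<kappa> / s) \<le> (\<integral>\<^sup>+y\<in>{y \<in> \<Omega>. R \<le> \<rho> x y}. ennreal (kern (s * q) x y) \<partial>M)"
proof -
  obtain \<Lambda> c where \<Lambda>: "1 < \<Lambda>" and c: "0 < c" and sh: "\<And>x. x \<in> space M \<Longrightarrow> \<exists>R0>0. \<forall>r\<ge>R0.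
    c * vol x (\<Lambda> * r) \<le> measure M (\<Omega> \<inter> (B x (\<Lambda> * r) - B x r))"
    using shell_mass[OF assms(1-3)] by blast
  define \<kappa> where "\<kappa> = c / (2 * q * ln \<Lambda>)"
  have ln: "0 < ln \<Lambda>" using \<Lambda> by simp
  have k: "0 < \<kappa>" using c q ln by (simp add: \<kappa>_def)
  have "\<exists>R0>0. \<forall>R\<ge>R0. \<forall>\<^sub>F s in at_right 0.
    ennreal (\<kappa> / s) \<le> (\<integral>\<^sup>+y\<in>{y \<in> \<Omega>. R \<le> \<rho> x y}. ennreal (kern (s * q) x y) \<partial>M)"
    if x: "x \<in> space M" for x
  proof -
    obtain R0 where R0: "0 < R0" "\<And>r. R0 \<le> r \<Longrightarrow> c * vol x (\<Lambda> * r) \<le> measure M (\<Omega> \<inter> (B x (\<Lambda> * r) - B x r))"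
      using sh[OF x] by blast
    have "\<forall>\<^sub>F s in at_right 0. ennreal (\<kappa> / s) \<le> (\<integral>\<^sup>+y\<in>{y \<in> \<Omega>. R \<le> \<rho> x y}. ennreal (kern (s * q) x y) \<partial>M)"
      if R: "R0 \<le> R" for R
    proof -
      have Rp: "0 < R" "0 < \<Lambda> * R" using R R0(1) \<Lambda> by auto
      have "((\<lambda>s. (\<Lambda> * R) powr (- (s * q))) \<longlongrightarrow> (\<Lambda> * R) powr (- (0 * q))) (at_right 0)"
        using Rp by (intro tendsto_intros) auto
      then have "\<forall>\<^sub>F s in at_right 0. 1 / 2 < (\<Lambda> * R) powr (- (s * q))"
        using Rp by (intro order_tendstoD) auto
      moreover have "\<forall>\<^sub>F s in at_right (0::real). 0 < s" by (simp add: eventually_at_right_less)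
      ultimately show ?thesis
      proof eventually_elim
        case (elim s)
        have "\<Lambda> powr (- (s * q)) < 1" using \<Lambda> elim q by (simp add: powr_less_one)
        then have d: "0 < 1 - \<Lambda> powr (- (s * q))" by simp
        have "\<kappa> / s = c * (1 / 2) / (s * q * ln \<Lambda>)" by (simp add: \<kappa>_def)
        also have "\<dots> \<le> c * (\<Lambda> * R) powr (- (s * q)) / (1 - \<Lambda> powr (- (s * q)))"
          using c elim q ln d one_minus_powr_neg_upper[OF \<Lambda>, of "s * q"]
          by (intro frac_le mult_left_mono) auto
        finally have "ennreal (\<kappa> / s) \<le> ennreal (c * (\<Lambda> * R) powr (- (s * q)) / (1 - \<Lambda> powr (- (s * q))))"
          by (rule ennreal_leI)
        also have "\<dots> \<le> (\<integral>\<^sup>+y\<in>{y \<in> \<Omega>. R \<le> \<rho> x y}. ennreal (kern (s * q) x y) \<partial>M)"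
          using elim q R by (intro far_kernel_lower[OF x \<Omega> \<Lambda> c Rp(1)] R0(2)) auto
        finally show ?case .
      qed
    qed
    with R0(1) show ?thesis by blast
  qed
  with k show ?thesis by blast
qed

end

section \<open>Morrey bounds and averaging operators\<close>

text \<open>The growth function enters only through the comparison of its values at nearby centres and at
  larger radii; one constant \<open>A\<close> serves for both.\<close>

locale morrey_weight = homogeneous_space +
  fixes p :: real and \<phi> :: "'a \<Rightarrow> real \<Rightarrow> real" and A :: real
  assumes p_pos: "0 < p"
    and A_ge_1: "1 \<le> A"
    and phi_pos: "\<lbrakk>x \<in> space M; 0 < r\<rbrakk> \<Longrightarrow> 0 < \<phi> x r"
    and phi_near: "\<lbrakk>x \<in> space M; y \<in> space M; 0 < r; \<rho> x y \<le> r\<rbrakk> \<Longrightarrow> \<phi> x r \<le> A * \<phi> y r"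
    and phi_dec: "\<lbrakk>x \<in> space M; 0 < r; r \<le> s\<rbrakk> \<Longrightarrow> \<phi> x s \<le> A * \<phi> x r"
begin

text \<open>The \<open>p\<close>-th power of the Morrey norm, phrased as a family of upper bounds on integrals: for
  \<open>h = \<bar>f\<bar>\<^sup>p\<close> this says that the norm of \<open>f\<close> is at most \<open>b\<^sup>1\<^sup>/\<^sup>p\<close>. In this form the bounds are additive
  in \<open>h\<close>, so no triangle inequality for roots is involved, and exponents below 1 cause no trouble.\<close>

definition morrey_bd :: "('a \<Rightarrow> ennreal) \<Rightarrow> real \<Rightarrow> bool" where
  "morrey_bd h b \<longleftrightarrow> (\<forall>z\<in>space M. \<forall>R>0.
     (\<integral>\<^sup>+y\<in>B z R. h y \<partial>M) \<le> ennreal (b * (\<phi> z R powr p * vol z R)))"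

lemma morrey_bdD:
  "\<lbrakk>morrey_bd h b; z \<in> space M; 0 < R\<rbrakk>
    \<Longrightarrow> (\<integral>\<^sup>+y\<in>B z R. h y \<partial>M) \<le> ennreal (b * (\<phi> z R powr p * vol z R))"
  by (simp add: morrey_bd_def)

lemma morrey_bd_mono:
  assumes "morrey_bd h b" "AE y in M. h' y \<le> h y" "b \<le> b'"
  shows "morrey_bd h' b'"
  unfolding morrey_bd_def
proof (intro ballI allI impI)
  fix z R assume z: "z \<in> space M" and R: "(0::real) < R"
  have "(\<integral>\<^sup>+y\<in>B z R. h' y \<partial>M) \<le> (\<integral>\<^sup>+y\<in>B z R. h y \<partial>M)"
    using assms(2) by (intro nn_integral_mono_AE) (auto split: split_indicator)
  also have "\<dots> \<le> ennreal (b * (\<phi> z R powr p * vol z R))" by (rule morrey_bdD[OF assms(1) z R])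
  also have "\<dots> \<le> ennreal (b' * (\<phi> z R powr p * vol z R))"
    using assms(3) vol_nonneg by (intro ennreal_leI mult_right_mono) auto
  finally show "(\<integral>\<^sup>+y\<in>B z R. h' y \<partial>M) \<le> ennreal (b' * (\<phi> z R powr p * vol z R))" .
qed

lemma morrey_bd_add:
  assumes "morrey_bd h b" "morrey_bd h' b'" "0 \<le> b" "0 \<le> b'"
    and [measurable]: "h \<in> borel_measurable M" "h' \<in> borel_measurable M"
  shows "morrey_bd (\<lambda>y. h y + h' y) (b + b')"
  unfolding morrey_bd_def
proof (intro ballI allI impI)
  fix z R assume z [measurable]: "z \<in> space M" and R: "(0::real) < R"
  have "(\<integral>\<^sup>+y\<in>B z R. h y + h' y \<partial>M) = (\<integral>\<^sup>+y\<in>B z R. h y \<partial>M) + (\<integral>\<^sup>+y\<in>B z R. h' y \<partial>M)"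
    using z by (intro nn_set_integral_add) auto
  also have "\<dots> \<le> ennreal (b * (\<phi> z R powr p * vol z R)) + ennreal (b' * (\<phi> z R powr p * vol z R))"
    using assms z R by (intro add_mono morrey_bdD) auto
  also have "\<dots> = ennreal ((b + b') * (\<phi> z R powr p * vol z R))"
    using assms vol_nonneg by (simp add: ring_distribs flip: ennreal_plus)
  finally show "(\<integral>\<^sup>+y\<in>B z R. h y + h' y \<partial>M) \<le> ennreal ((b + b') * (\<phi> z R powr p * vol z R))" .
qed

lemma morrey_bd_cmult:
  assumes "morrey_bd h b" "0 \<le> c" "0 \<le> b"
    and [measurable]: "h \<in> borel_measurable M"
  shows "morrey_bd (\<lambda>y. ennreal c * h y) (c * b)"
  unfolding morrey_bd_def
proof (intro ballI allI impI)
  fix z R assume z [measurable]: "z \<in> space M" and R: "(0::real) < R"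
  have "(\<integral>\<^sup>+y\<in>B z R. ennreal c * h y \<partial>M) = ennreal c * (\<integral>\<^sup>+y\<in>B z R. h y \<partial>M)"
    by (simp add: mult.assoc nn_integral_cmult)
  also have "\<dots> \<le> ennreal c * ennreal (b * (\<phi> z R powr p * vol z R))"
    using assms z R by (intro mult_left_mono morrey_bdD) auto
  also have "\<dots> = ennreal (c * b * (\<phi> z R powr p * vol z R))"
    using assms vol_nonneg by (simp add: ennreal_mult[symmetric] mult.assoc)
  finally show "(\<integral>\<^sup>+y\<in>B z R. ennreal c * h y \<partial>M) \<le> ennreal (c * b * (\<phi> z R powr p * vol z R))" .
qed

lemma morrey_norm_le_iff:
  assumes b: "0 \<le> b"
  shows "morrey_norm M \<rho> p \<phi> f \<le> ennreal b \<longleftrightarrow>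
    morrey_bd (\<lambda>y. ennreal (\<bar>f y\<bar> powr p)) (b powr p)"
proof -
  have "ennreal (1 / \<phi> x r) *
       enn_powr ((\<integral>\<^sup>+y\<in>B x r. ennreal (\<bar>f y\<bar> powr p) \<partial>M) / emeasure M (B x r)) (1 / p) \<le> ennreal b
     \<longleftrightarrow> (\<integral>\<^sup>+y\<in>B x r. ennreal (\<bar>f y\<bar> powr p) \<partial>M) \<le> ennreal (b powr p * (\<phi> x r powr p * vol x r))"
    if "x \<in> space M" "0 < r" for x r
  proof -
    have "(b * \<phi> x r) powr p * vol x r = b powr p * (\<phi> x r powr p * vol x r)"
      using b phi_pos[OF that] by (simp add: powr_mult)
    then show ?thesis
      using that b phi_pos[OF that] p_pos vol_pos[OF that]
      by (simp add: ennreal_mult_le_iff enn_powr_le_iff emeasure_ball ennreal_divide_le_iff mult.assoc)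
  qed
  then show ?thesis
    unfolding morrey_norm_def morrey_bd_def by (auto simp: SUP_le_iff)
qed

lemma morrey_bd_finite:
  assumes "morrey_bd h b" "z \<in> space M" "0 < R"
  shows "(\<integral>\<^sup>+y\<in>B z R. h y \<partial>M) < \<infinity>"
  using morrey_bdD[OF assms] by (rule le_less_trans) simp

lemma morrey_spaceI:
  assumes g: "g \<in> borel_measurable M" and b: "0 \<le> b"
    and bd: "morrey_bd (\<lambda>y. ennreal (\<bar>g y\<bar> powr p)) (b powr p)"
  shows "g \<in> morrey_space M \<rho> p \<phi>" "morrey_norm M \<rho> p \<phi> g \<le> ennreal b"
proof -
  show n: "morrey_norm M \<rho> p \<phi> g \<le> ennreal b" using bd b by (simp add: morrey_norm_le_iff)
  have "morrey_norm M \<rho> p \<phi> g < \<infinity>" using n by (rule le_less_trans) simp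
  moreover have "\<forall>x\<in>space M. \<exists>r>0. (\<integral>\<^sup>+y\<in>B x r. ennreal (\<bar>g y\<bar> powr p) \<partial>M) < \<infinity>"
    using morrey_bd_finite[OF bd] by (meson zero_less_one)
  ultimately show "g \<in> morrey_space M \<rho> p \<phi>" using g by (simp add: morrey_space_def Lp_loc_def)
qed

lemma morrey_spaceD:
  assumes "g \<in> morrey_space M \<rho> p \<phi>"
  shows "g \<in> borel_measurable M"
    "\<And>b. 0 \<le> b \<Longrightarrow> morrey_norm M \<rho> p \<phi> g \<le> ennreal b \<Longrightarrow> morrey_bd (\<lambda>y. ennreal (\<bar>g y\<bar> powr p)) (b powr p)"
  using assms by (auto simp: morrey_space_def Lp_loc_def morrey_norm_le_iff)

lemma morrey_bd_AE_finite:
  assumes bd: "morrey_bd h b" and [measurable]: "h \<in> borel_measurable M"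
  shows "AE y in M. h y < \<infinity>"
proof (cases "space M = {}")
  case False
  then obtain z where z [measurable]: "z \<in> space M" by blast
  have "AE y in M. h y * indicator (B z (real (Suc n))) y \<noteq> \<infinity>" for n
    using morrey_bd_finite[OF bd z, of "real (Suc n)"] by (intro nn_integral_PInf_AE) auto
  then have "AE y in M. \<forall>n. h y * indicator (B z (real (Suc n))) y \<noteq> \<infinity>"
    by (simp add: AE_all_countable)
  then show ?thesis
  proof (rule AE_mp, intro AE_I2 impI)
    fix y assume y: "y \<in> space M" and fin: "\<forall>n. h y * indicator (B z (real (Suc n))) y \<noteq> \<infinity>"
    obtain n where "\<rho> z y < real n" using reals_Archimedean2 by blast
    then have "y \<in> B z (real (Suc n))" using y by (simp add: in_ball_iff)
    then show "h y < \<infinity>" using fin[rule_format, of n] by (simp add: less_top)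
  qed
qed (auto intro: AE_I2)

definition net :: "real \<Rightarrow> 'a set" where
  "net r = (SOME S. S \<subseteq> space M \<and> separated_set r S \<and> (\<forall>x\<in>space M. \<exists>s\<in>S. \<rho> s x < r))"

lemma net:
  assumes "0 < r"
  shows "net r \<subseteq> space M" "separated_set r (net r)" "\<And>x. x \<in> space M \<Longrightarrow> \<exists>s\<in>net r. \<rho> s x < r"
    "countable (net r)"
proof -
  have "net r \<subseteq> space M \<and> separated_set r (net r) \<and> (\<forall>x\<in>space M. \<exists>s\<in>net r. \<rho> s x < r)"
    unfolding net_def by (rule someI_ex[OF exists_net[OF subset_refl assms]])
  then show "net r \<subseteq> space M" "separated_set r (net r)" "\<And>x. x \<in> space M \<Longrightarrow> \<exists>s\<in>net r. \<rho> s x < r"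
    by blast+
  then show "countable (net r)" using separated_countable assms by blast
qed

text \<open>The sum over the net counts the points of the net in the ball of radius \<open>c r\<close> around \<open>y\<close>.\<close>

lemma net_overlap:
  assumes y: "y \<in> space M" and r: "0 < r" and c: "1 \<le> c"
  shows "(\<integral>\<^sup>+i. indicator (B i (c * r)) y \<partial>count_space (net r)) \<le> ennreal (growth (8 * K ^ 3 * c ^ 2))"
proof -
  have cr: "r \<le> c * r" "0 < c * r" using mult_right_mono[OF c, of r] r c by auto
  have "r \<le> c * (c * r)" using mult_mono[OF c cr(1)] r c by simp
  note S = separated_in_ball[OF net(2)[OF r] y r this c cr(2) order_refl]
  have "(\<integral>\<^sup>+i. indicator (B i (c * r)) y \<partial>count_space (net r))
      = (\<integral>\<^sup>+i. indicator (net r \<inter> B y (c * r)) i \<partial>count_space (net r))"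
    using net(1)[OF r] y rho_sym
    by (intro nn_integral_cong) (auto simp: in_ball_iff indicator_def subset_iff)
  also have "\<dots> = emeasure (count_space (net r)) (net r \<inter> B y (c * r))" by simp
  also have "\<dots> = ennreal (real (card (net r \<inter> B y (c * r))))"
    using S(1) by (subst emeasure_count_space) (auto simp: ennreal_of_nat_eq_real_of_nat)
  also have "\<dots> \<le> ennreal (growth (8 * K ^ 3 * c ^ 2))" using S(2) by (rule ennreal_leI)
  finally show ?thesis .
qed

text \<open>A discrete version of the operator \<open>h \<mapsto> (1 / vol x r) \<integral>h\<close> over \<open>B x r\<close>.
  Since \<open>\<rho>\<close> is only separately measurable, the averages over balls need not be measurable as functions of the
  centre, and Tonelli's theorem is not applicable to them. Replacing the centre \<open>x\<close> by nearby
  points of a countable net gives a measurable majorant, for which the exchange of integrations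
  is an exchange of a sum and an integral.\<close>

definition avg_op :: "real \<Rightarrow> ('a \<Rightarrow> ennreal) \<Rightarrow> 'a \<Rightarrow> ennreal" where
  "avg_op r h x = (\<integral>\<^sup>+i. (\<integral>\<^sup>+y\<in>B i (2 * K * r). h y \<partial>M) / ennreal (vol i (2 * K * r))
      * indicator (B i r) x \<partial>count_space (net r))"

lemma avg_op_measurable [measurable]:
  assumes "0 < r" shows "avg_op r h \<in> borel_measurable M"
  unfolding avg_op_def
  using net(1)[OF assms]
  by (intro borel_measurable_nn_integral_count_space net(4)[OF assms]) auto

text \<open>Some net point \<open>i\<close> has \<open>x\<close> in \<open>B i r\<close>, and then
  \<open>B x r \<subseteq> B i (2 K r)\<close> with comparable measures.\<close>

lemma ball_integral_le_avg_op:
  assumes x: "x \<in> space M" and r: "0 < r"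
  shows "(\<integral>\<^sup>+y\<in>B x r. h y \<partial>M) \<le> ennreal (growth (4 * K ^ 2) * vol x r) * avg_op r h x"
proof -
  have K0: "0 < K" using K_ge_1 by simp
  obtain i where i: "i \<in> net r" "\<rho> i x < r" using net(3)[OF r x] by blast
  have isp: "i \<in> space M" using net(1)[OF r] i by blast
  have Kr: "0 < 2 * K * r" using K0 r by simp
  have mi: "0 < vol i (2 * K * r)" by (rule vol_pos[OF isp Kr])
  define a where "a j = (\<integral>\<^sup>+y\<in>B j (2 * K * r). h y \<partial>M) / ennreal (vol j (2 * K * r))" for j
  have sub: "B x r \<subseteq> B i (2 * K * r)"
  proof (rule ball_subset_ball[OF isp x])
    have "K * (\<rho> i x + r) \<le> K * (r + r)" using i K0 by (intro mult_left_mono) auto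
    then show "K * (\<rho> i x + r) \<le> 2 * K * r" by simp
  qed
  have "vol i (2 * K * r) \<le> vol x (4 * K ^ 2 * r)"
  proof (intro vol_le_if_subset ball_subset_ball)
    have "r \<le> K * r" using K_ge_1 r by simp
    then have "\<rho> x i + 2 * K * r \<le> 4 * (K * r)" using i rho_sym[OF x isp] r unfolding mult.assoc by linarith
    then have "K * (\<rho> x i + 2 * K * r) \<le> K * (4 * (K * r))" using K0 by (intro mult_left_mono) auto
    then show "K * (\<rho> x i + 2 * K * r) \<le> 4 * K ^ 2 * r" by (simp add: power2_eq_square mult_ac)
  qed (use x isp in auto)
  also have "\<dots> \<le> growth (4 * K ^ 2) * vol x r"
    using x r one_le_power[OF K_ge_1, of 2] by (intro vol_growth) auto
  finally have mle: "vol i (2 * K * r) \<le> growth (4 * K ^ 2) * vol x r" .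
  have "a i = a i * indicator (B i r) x" using i x by (simp add: in_ball_iff)
  also have "\<dots> = (\<integral>\<^sup>+j. (a i * indicator (B i r) x) * indicator {i} j \<partial>count_space (net r))"
    using i by (subst nn_integral_cmult_indicator) auto
  also have "\<dots> \<le> avg_op r h x"
    unfolding avg_op_def a_def by (intro nn_integral_mono) (auto split: split_indicator)
  finally have ai: "a i \<le> avg_op r h x" .
  have "(\<integral>\<^sup>+y\<in>B x r. h y \<partial>M) \<le> (\<integral>\<^sup>+y\<in>B i (2 * K * r). h y \<partial>M)"
    using sub by (intro nn_integral_mono mult_left_mono) (auto split: split_indicator)
  also have "\<dots> = ennreal (vol i (2 * K * r)) * a i"
    unfolding a_def using mi
    by (subst ennreal_times_divide, subst mult.commute, subst mult_divide_eq_ennreal) auto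
  also have "\<dots> \<le> ennreal (growth (4 * K ^ 2) * vol x r) * avg_op r h x"
    using mle ai by (intro mult_mono ennreal_leI) auto
  finally show ?thesis .
qed

lemma phi_powr_near:
  "\<lbrakk>x \<in> space M; y \<in> space M; 0 < r; \<rho> x y \<le> r\<rbrakk> \<Longrightarrow> \<phi> x r powr p \<le> A powr p * \<phi> y r powr p"
  using phi_near[of x y r] phi_pos[of x r] phi_pos[of y r] p_pos A_ge_1
    powr_mono2[of p "\<phi> x r" "A * \<phi> y r"] by (simp add: powr_mult)

lemma phi_powr_dec:
  "\<lbrakk>x \<in> space M; 0 < r; r \<le> s\<rbrakk> \<Longrightarrow> \<phi> x s powr p \<le> A powr p * \<phi> x r powr p"
  using phi_dec[of x r s] phi_pos[of x r] phi_pos[of x s] p_pos A_ge_1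
    powr_mono2[of p "\<phi> x s" "A * \<phi> x r"] by (simp add: powr_mult)

definition avg_const :: real where
  "avg_const = (growth (8 * K ^ 3 * (2 * K) ^ 2) * growth (4 * K ^ 2) + growth (8 * K ^ 3)) * (A powr p * A powr p)"

lemma avg_const_nonneg: "0 \<le> avg_const"
  using growth_ge_1[of "8 * K ^ 3 * (2 * K) ^ 2"] growth_ge_1[of "4 * K ^ 2"] growth_ge_1[of "8 * K ^ 3"]
  unfolding avg_const_def by (intro mult_nonneg_nonneg add_nonneg_nonneg) auto

text \<open>Averaging operators are bounded on the Morrey space uniformly in the scale \<open>r\<close>. Test on a ball
  \<open>B z R\<close>. If \<open>r \<le> R\<close>, all balls of the net that meet \<open>B z R\<close> lie in \<open>B z (4 K\<^sup>2 R)\<close> with bounded overlap,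
  so the integral is at most a constant times that of \<open>h\<close> over this larger ball. If \<open>R < r\<close>, every
  average that occurs is bounded by the Morrey bound at scale \<open>2 K r\<close>, which nearness and the
  almost monotonicity of \<open>\<phi>\<close> compare with the one at \<open>(z, R)\<close>.\<close>

lemma morrey_bd_avg_op:
  assumes bd: "morrey_bd h b" and b: "0 \<le> b" and r: "0 < r" and [measurable]: "h \<in> borel_measurable M"
  shows "morrey_bd (avg_op r h) (avg_const * b)"
  unfolding morrey_bd_def
proof (intro ballI allI impI)
  fix z R assume z [measurable]: "z \<in> space M" and R: "(0::real) < R"
  define S where "S = net r"
  define a where "a i = (\<integral>\<^sup>+y\<in>B i (2 * K * r). h y \<partial>M) / ennreal (vol i (2 * K * r))" for i
  have K0: "0 < K" using K_ge_1 by simp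
  have Kr: "0 < 2 * K * r" "r \<le> K * r" and KR: "R \<le> K * R" using K_ge_1 r R by auto
  have Ssp: "i \<in> space M" if "i \<in> S" for i using that net(1)[OF r] by (auto simp: S_def)
  have cS: "countable S" using net(4)[OF r] by (simp add: S_def)
  define P where "P = \<phi> z R powr p * vol z R"
  have P0: "0 \<le> P" by (simp add: P_def vol_nonneg)
  have A1: "1 \<le> A powr p" using A_ge_1 p_pos by (simp add: ge_one_powr_ge_zero)
  have close: "\<rho> z i \<le> K * (R + r)" if "i \<in> S" "B i r \<inter> B z R \<noteq> {}" for i
  proof -
    obtain w where w: "w \<in> space M" "\<rho> i w < r" "\<rho> z w < R" using \<open>B i r \<inter> B z R \<noteq> {}\<close> by (auto simp: in_ball_iff)
    have "\<rho> z i \<le> K * (\<rho> z w + \<rho> w i)" using z w Ssp that by (intro rho_triangle) auto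
    also have "\<dots> \<le> K * (R + r)"
      using w rho_sym[of w i] Ssp that K0 by (intro mult_left_mono) auto
    finally show ?thesis .
  qed
  have swap: "(\<integral>\<^sup>+x\<in>B z R. avg_op r h x \<partial>M) = (\<integral>\<^sup>+i. a i * emeasure M (B i r \<inter> B z R) \<partial>count_space S)"
  proof -
    have "(\<integral>\<^sup>+x\<in>B z R. avg_op r h x \<partial>M)
        = (\<integral>\<^sup>+x. (\<integral>\<^sup>+i. a i * indicator (B i r \<inter> B z R) x \<partial>count_space S) \<partial>M)"
      unfolding avg_op_def S_def[symmetric] a_def[symmetric]
      by (subst nn_integral_multc[symmetric])
        (auto intro!: nn_integral_cong simp: indicator_inter_arith mult.assoc)
    also have "\<dots> = (\<integral>\<^sup>+i. (\<integral>\<^sup>+x. a i * indicator (B i r \<inter> B z R) x \<partial>M) \<partial>count_space S)"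
      using Ssp by (intro nn_integral_count_space_nn_integral cS) auto
    also have "\<dots> = (\<integral>\<^sup>+i. a i * emeasure M (B i r \<inter> B z R) \<partial>count_space S)"
      using Ssp by (intro nn_integral_cong nn_integral_cmult_indicator) auto
    finally show ?thesis .
  qed
  have "(\<integral>\<^sup>+x\<in>B z R. avg_op r h x \<partial>M) \<le> ennreal (avg_const * b * P)"
  proof (cases "r \<le> R")
    case True
    define N where "N = growth (8 * K ^ 3 * (2 * K) ^ 2)"
    \<comment> \<open>Balls of the net at scale \<open>2 K r\<close> that matter stay inside \<open>B z R\'\<close>.\<close>
    define R' where "R' = 4 * K ^ 2 * R"
    have K2: "1 \<le> 4 * K ^ 2" using one_le_power[OF K_ge_1, of 2] by simp
    have RR': "R \<le> R'" using mult_right_mono[OF K2, of R] R by (simp add: R'_def)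
    have summand: "a i * emeasure M (B i r \<inter> B z R)
        \<le> (\<integral>\<^sup>+y. h y * indicator (B z R') y * indicator (B i (2 * K * r)) y \<partial>M)" if i: "i \<in> S" for i
    proof (cases "B i r \<inter> B z R = {}")
      case False
      have isp: "i \<in> space M" using Ssp i by blast
      have mi: "0 < vol i (2 * K * r)" by (rule vol_pos[OF isp Kr(1)])
      have sub: "B i (2 * K * r) \<subseteq> B z R'"
      proof (rule ball_subset_ball[OF z isp])
        have KrR: "K * r \<le> K * R" using True K0 by simp
        have "\<rho> z i + 2 * K * r \<le> 4 * (K * R)"
          using close[OF i False] KrR unfolding mult.assoc ring_distribs by linarith
        then have "K * (\<rho> z i + 2 * K * r) \<le> K * (4 * (K * R))" using K0 by (intro mult_left_mono) auto
        then show "K * (\<rho> z i + 2 * K * r) \<le> R'" by (simp add: R'_def power2_eq_square mult_ac)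
      qed
      have "emeasure M (B i r \<inter> B z R) \<le> emeasure M (B i (2 * K * r))"
        using ball_mono[of r "2 * K * r" i] Kr r isp by (intro emeasure_mono) auto
      then have "a i * emeasure M (B i r \<inter> B z R) \<le> a i * ennreal (vol i (2 * K * r))"
        using emeasure_ball[OF isp] by (intro mult_left_mono) auto
      also have "\<dots> = (\<integral>\<^sup>+y\<in>B i (2 * K * r). h y \<partial>M)"
        unfolding a_def using mi
        by (subst mult.commute, subst ennreal_times_divide, subst mult.commute,
            subst mult_divide_eq_ennreal) auto
      also have "\<dots> = (\<integral>\<^sup>+y. h y * indicator (B z R') y * indicator (B i (2 * K * r)) y \<partial>M)"
        using sub by (intro nn_integral_cong) (auto split: split_indicator)
      finally show ?thesis .
    qed simp
    have "(\<integral>\<^sup>+x\<in>B z R. avg_op r h x \<partial>M)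
        \<le> (\<integral>\<^sup>+i. (\<integral>\<^sup>+y. h y * indicator (B z R') y * indicator (B i (2 * K * r)) y \<partial>M) \<partial>count_space S)"
      unfolding swap by (intro nn_integral_mono summand) simp
    also have "\<dots> = (\<integral>\<^sup>+y. (\<integral>\<^sup>+i. h y * indicator (B z R') y * indicator (B i (2 * K * r)) y \<partial>count_space S) \<partial>M)"
      using Ssp by (intro nn_integral_count_space_nn_integral[symmetric] cS) auto
    also have "\<dots> \<le> (\<integral>\<^sup>+y. ennreal N * (h y * indicator (B z R') y) \<partial>M)"
    proof (rule nn_integral_mono)
      fix y assume y: "y \<in> space M"
      have "(\<integral>\<^sup>+i. h y * indicator (B z R') y * indicator (B i (2 * K * r)) y \<partial>count_space S)
          = h y * indicator (B z R') y * (\<integral>\<^sup>+i. indicator (B i (2 * K * r)) y \<partial>count_space S)"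
        by (rule nn_integral_cmult) simp
      also have "\<dots> \<le> h y * indicator (B z R') y * ennreal N"
        using net_overlap[OF y r, of "2 * K"] K_ge_1 unfolding S_def N_def
        by (intro mult_left_mono) auto
      finally show "(\<integral>\<^sup>+i. h y * indicator (B z R') y * indicator (B i (2 * K * r)) y \<partial>count_space S)
          \<le> ennreal N * (h y * indicator (B z R') y)" by (simp add: mult.commute)
    qed
    also have "\<dots> = ennreal N * (\<integral>\<^sup>+y\<in>B z R'. h y \<partial>M)" by (simp add: nn_integral_cmult)
    also have "\<dots> \<le> ennreal N * ennreal (b * (\<phi> z R' powr p * vol z R'))"
      using RR' R by (intro mult_left_mono morrey_bdD[OF bd z]) auto
    also have "\<dots> = ennreal (N * (b * (\<phi> z R' powr p * vol z R')))"
      using growth_ge_1[of "8 * K ^ 3 * (2 * K) ^ 2"] b vol_nonneg by (simp add: N_def ennreal_mult)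
    also have "\<dots> \<le> ennreal (avg_const * b * P)"
    proof (rule ennreal_leI)
      have N: "0 \<le> N" and D: "0 \<le> growth (4 * K ^ 2)" "0 \<le> growth (8 * K ^ 3)"
        using growth_ge_1[of "8 * K ^ 3 * (2 * K) ^ 2"] growth_ge_1[of "4 * K ^ 2"] growth_ge_1[of "8 * K ^ 3"]
        by (auto simp: N_def)
      have "\<phi> z R' powr p * vol z R' \<le> (A powr p * \<phi> z R powr p) * (growth (4 * K ^ 2) * vol z R)"
        using z R RR' K2 vol_nonneg by (intro mult_mono phi_powr_dec vol_growth) (auto simp: R'_def)
      also have "\<dots> = A powr p * (growth (4 * K ^ 2) * P)" by (simp add: P_def)
      also have "\<dots> \<le> (A powr p * A powr p) * (growth (4 * K ^ 2) * P)"
        using mult_left_mono[OF A1, of "A powr p"] D P0 by (intro mult_right_mono) auto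
      finally have "N * (b * (\<phi> z R' powr p * vol z R')) \<le> N * (b * ((A powr p * A powr p) * (growth (4 * K ^ 2) * P)))"
        using N b by (intro mult_left_mono) auto
      also have "\<dots> \<le> \<dots> + growth (8 * K ^ 3) * (A powr p * A powr p) * b * P"
        using D b P0 by (simp add: mult_nonneg_nonneg)
      also have "\<dots> = avg_const * b * P" by (simp add: avg_const_def N_def algebra_simps)
      finally show "N * (b * (\<phi> z R' powr p * vol z R')) \<le> avg_const * b * P" .
    qed
    finally show ?thesis .
  next
    case False
    define N where "N = growth (8 * K ^ 3)"
    define c where "c = b * ((A powr p * A powr p) * \<phi> z R powr p)"
    have c0: "0 \<le> c" using b by (simp add: c_def)
    have summand: "a i * emeasure M (B i r \<inter> B z R)
        \<le> ennreal c * (\<integral>\<^sup>+y. indicator (B z R) y * indicator (B i r) y \<partial>M)" if i: "i \<in> S" for i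
    proof (cases "B i r \<inter> B z R = {}")
      case nonempty: False
      have isp: "i \<in> space M" using Ssp i by blast
      have mi: "0 < vol i (2 * K * r)" by (rule vol_pos[OF isp Kr(1)])
      have "K * (R + r) \<le> K * (r + r)" using False K0 by (intro mult_left_mono) auto
      then have d: "\<rho> i z \<le> 2 * K * r" using close[OF i nonempty] rho_sym[OF isp z] by (simp add: algebra_simps)
      have "R \<le> 2 * K * r" using False Kr by simp
      then have "\<phi> i (2 * K * r) powr p \<le> A powr p * (A powr p * \<phi> z R powr p)"
        using phi_powr_near[OF isp z Kr(1) d] mult_left_mono[OF phi_powr_dec[OF z R, of "2 * K * r"], of "A powr p"]
        by simp
      then have "(b * \<phi> i (2 * K * r) powr p) * vol i (2 * K * r) \<le> c * vol i (2 * K * r)"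
        unfolding c_def using b mi by (intro mult_right_mono mult_left_mono) auto
      then have "(\<integral>\<^sup>+y\<in>B i (2 * K * r). h y \<partial>M) \<le> ennreal (c * vol i (2 * K * r))"
        using morrey_bdD[OF bd isp Kr(1)] by (auto simp: mult.assoc intro: order_trans ennreal_leI)
      then have "a i \<le> ennreal c"
        unfolding a_def using mi c0 by (subst ennreal_divide_le_iff) auto
      moreover have "(\<lambda>y. indicator (B z R) y * indicator (B i r) y :: ennreal) = indicator (B i r \<inter> B z R)"
        by (auto simp: fun_eq_iff split: split_indicator)
      then have "(\<integral>\<^sup>+y. indicator (B z R) y * indicator (B i r) y \<partial>M) = emeasure M (B i r \<inter> B z R)"
        using isp by simp
      ultimately show ?thesis by (simp add: mult_right_mono)
    qed simp
    have "(\<integral>\<^sup>+x\<in>B z R. avg_op r h x \<partial>M)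
        \<le> (\<integral>\<^sup>+i. ennreal c * (\<integral>\<^sup>+y. indicator (B z R) y * indicator (B i r) y \<partial>M) \<partial>count_space S)"
      unfolding swap by (intro nn_integral_mono summand) simp
    also have "\<dots> = ennreal c * (\<integral>\<^sup>+i. (\<integral>\<^sup>+y. indicator (B z R) y * indicator (B i r) y \<partial>M) \<partial>count_space S)"
      by (intro nn_integral_cmult) simp
    also have "(\<integral>\<^sup>+i. (\<integral>\<^sup>+y. indicator (B z R) y * indicator (B i r) y \<partial>M) \<partial>count_space S)
        = (\<integral>\<^sup>+y. (\<integral>\<^sup>+i. indicator (B z R) y * indicator (B i r) y \<partial>count_space S) \<partial>M)"
      using Ssp by (intro nn_integral_count_space_nn_integral[symmetric] cS) auto
    also have "\<dots> \<le> (\<integral>\<^sup>+y. ennreal N * indicator (B z R) y \<partial>M)"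
    proof (rule nn_integral_mono)
      fix y assume y: "y \<in> space M"
      have "(\<integral>\<^sup>+i. indicator (B z R) y * indicator (B i r) y \<partial>count_space S)
          = indicator (B z R) y * (\<integral>\<^sup>+i. indicator (B i r) y \<partial>count_space S)"
        by (rule nn_integral_cmult) simp
      also have "\<dots> \<le> indicator (B z R) y * ennreal N"
        using net_overlap[OF y r, of 1] unfolding S_def N_def
        by (intro mult_left_mono) auto
      finally show "(\<integral>\<^sup>+i. indicator (B z R) y * indicator (B i r) y \<partial>count_space S)
          \<le> ennreal N * indicator (B z R) y" by (simp add: mult.commute)
    qed
    also have "\<dots> = ennreal N * ennreal (vol z R)"
      using emeasure_ball[OF z] by (simp add: nn_integral_cmult_indicator)
    also have "ennreal c * (ennreal N * ennreal (vol z R)) = ennreal (c * (N * vol z R))"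
      using c0 growth_ge_1[of "8 * K ^ 3"] vol_nonneg by (simp add: N_def ennreal_mult)
    also have "\<dots> \<le> ennreal (avg_const * b * P)"
    proof (rule ennreal_leI)
      have D: "0 \<le> growth (4 * K ^ 2)" "0 \<le> growth (8 * K ^ 3 * (2 * K) ^ 2)"
        using growth_ge_1[of "8 * K ^ 3 * (2 * K) ^ 2"] growth_ge_1[of "4 * K ^ 2"] by auto
      have "c * (N * vol z R) = N * (A powr p * A powr p) * b * P" by (simp add: c_def P_def)
      also have "\<dots> \<le> \<dots> + growth (8 * K ^ 3 * (2 * K) ^ 2) * growth (4 * K ^ 2) * (A powr p * A powr p) * b * P"
        using D b P0 by (simp add: mult_nonneg_nonneg)
      also have "\<dots> = avg_const * b * P" by (simp add: avg_const_def N_def algebra_simps)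
      finally show "c * (N * vol z R) \<le> avg_const * b * P" .
    qed
    finally show ?thesis by (simp add: mult_left_mono)
  qed
  then show "(\<integral>\<^sup>+x\<in>B z R. avg_op r h x \<partial>M) \<le> ennreal (avg_const * b * (\<phi> z R powr p * vol z R))"
    by (simp add: P_def)
qed

text \<open>The superposition of averages that dominates the far part of the kernel, see
  \<open>far_kernel_le_tail_op\<close>. For small \<open>\<sigma>\<close> its Morrey bound is of order
  \<open>1 / \<sigma>\<close>, which the factor \<open>s\<close> compensates when \<open>\<sigma> = s q\<close>.\<close>

definition tail_op :: "real \<Rightarrow> ('a \<Rightarrow> ennreal) \<Rightarrow> 'a \<Rightarrow> ennreal" where
  "tail_op \<sigma> h x = (\<Sum>k. ennreal ((2 ^ k) powr (- \<sigma>)) * avg_op (2 ^ Suc k) h x)"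

lemma tail_op_measurable [measurable]: "tail_op \<sigma> h \<in> borel_measurable M"
proof -
  have [measurable]: "avg_op (2 ^ Suc k) h \<in> borel_measurable M" for k :: nat
    by (rule avg_op_measurable) simp
  show ?thesis unfolding tail_op_def by measurable
qed

lemma morrey_bd_tail_op:
  assumes bd: "morrey_bd h b" and b: "0 \<le> b" and \<sigma>: "0 < \<sigma>" and h: "h \<in> borel_measurable M"
  shows "morrey_bd (tail_op \<sigma> h) (avg_const * b / (1 - 2 powr (- \<sigma>)))"
  unfolding morrey_bd_def
proof (intro ballI allI impI)
  fix z R assume z [measurable]: "z \<in> space M" and R: "(0::real) < R"
  define P where "P = \<phi> z R powr p * vol z R"
  have P0: "0 \<le> avg_const * b * P" using vol_nonneg b avg_const_nonneg by (simp add: P_def)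
  have [measurable]: "avg_op (2 ^ Suc k) h \<in> borel_measurable M" for k :: nat
    by (rule avg_op_measurable) simp
  have "(\<integral>\<^sup>+x\<in>B z R. tail_op \<sigma> h x \<partial>M)
      = (\<integral>\<^sup>+x. (\<Sum>k. ennreal ((2 ^ k) powr (- \<sigma>)) * (avg_op (2 ^ Suc k) h x * indicator (B z R) x)) \<partial>M)"
    unfolding tail_op_def by (intro nn_integral_cong) (simp add: mult.assoc[symmetric])
  also have "\<dots> = (\<Sum>k. \<integral>\<^sup>+x. ennreal ((2 ^ k) powr (- \<sigma>)) * (avg_op (2 ^ Suc k) h x * indicator (B z R) x) \<partial>M)"
    by (intro nn_integral_suminf) measurable
  also have "\<dots> = (\<Sum>k. ennreal ((2 ^ k) powr (- \<sigma>)) * (\<integral>\<^sup>+x\<in>B z R. avg_op (2 ^ Suc k) h x \<partial>M))"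
    by (intro suminf_cong nn_integral_cmult) measurable
  also have "\<dots> \<le> (\<Sum>k. ennreal ((avg_const * b * P) * (2 ^ k * 1) powr (- \<sigma>)))"
  proof (rule suminf_le)
    fix k :: nat
    have "ennreal ((2 ^ k) powr (- \<sigma>)) * (\<integral>\<^sup>+x\<in>B z R. avg_op (2 ^ Suc k) h x \<partial>M)
        \<le> ennreal ((2 ^ k) powr (- \<sigma>)) * ennreal (avg_const * b * P)"
      unfolding P_def by (intro mult_left_mono morrey_bdD[OF morrey_bd_avg_op[OF bd b _ h] z R]) auto
    also have "\<dots> = ennreal ((avg_const * b * P) * (2 ^ k * 1) powr (- \<sigma>))"
      using P0 by (simp add: ennreal_mult[symmetric] mult.commute)
    finally show "ennreal ((2 ^ k) powr (- \<sigma>)) * (\<integral>\<^sup>+x\<in>B z R. avg_op (2 ^ Suc k) h x \<partial>M)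
        \<le> ennreal ((avg_const * b * P) * (2 ^ k * 1) powr (- \<sigma>))" .
  qed auto
  also have "\<dots> = ennreal ((avg_const * b * P) * 1 powr (- \<sigma>) / (1 - 2 powr (- \<sigma>)))"
    using P0 \<sigma> by (intro suminf_geometric_powr) auto
  finally show "(\<integral>\<^sup>+x\<in>B z R. tail_op \<sigma> h x \<partial>M)
      \<le> ennreal (avg_const * b / (1 - 2 powr (- \<sigma>)) * (\<phi> z R powr p * vol z R))"
    by (simp add: P_def)
qed

lemma far_kernel_le_tail_op:
  assumes x: "x \<in> space M" and \<sigma>: "0 < \<sigma>" and h: "h \<in> borel_measurable M"
  shows "(\<integral>\<^sup>+y\<in>{y \<in> space M. 1 \<le> \<rho> x y}. h y * ennreal (kern \<sigma> x y) \<partial>M)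
    \<le> ennreal (L * growth (4 * K ^ 2)) * tail_op \<sigma> h x"
proof -
  define D where "D = growth (4 * K ^ 2)"
  have D: "1 \<le> D" by (simp add: D_def growth_ge_1)
  have "(\<integral>\<^sup>+y\<in>{y \<in> space M. 1 \<le> \<rho> x y}. h y * ennreal (kern \<sigma> x y) \<partial>M)
    \<le> (\<Sum>k. ennreal (L * (2 ^ k * 1) powr (- \<sigma>) / vol x (2 ^ Suc k * 1))
             * (\<integral>\<^sup>+y\<in>B x (2 ^ Suc k * 1). h y \<partial>M))"
    by (rule far_kernel_le[OF x zero_less_one \<sigma> h])
  also have "\<dots> \<le> (\<Sum>k. ennreal (L * D) * (ennreal ((2 ^ k) powr (- \<sigma>)) * avg_op (2 ^ Suc k) h x))"
  proof (rule suminf_le)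
    fix k :: nat
    have m2: "0 < vol x (2 ^ Suc k)" using vol_pos[OF x, of "2 ^ Suc k"] by simp
    have "ennreal (L * (2 ^ k * 1) powr (- \<sigma>) / vol x (2 ^ Suc k * 1)) * (\<integral>\<^sup>+y\<in>B x (2 ^ Suc k * 1). h y \<partial>M)
       \<le> ennreal (L * (2 ^ k) powr (- \<sigma>) / vol x (2 ^ Suc k)) * (ennreal (D * vol x (2 ^ Suc k)) * avg_op (2 ^ Suc k) h x)"
      using ball_integral_le_avg_op[OF x, of "2 ^ Suc k" h] unfolding D_def mult_1_right
      by (intro mult_left_mono) auto
    also have "\<dots> = ennreal (L * (2 ^ k) powr (- \<sigma>) / vol x (2 ^ Suc k) * (D * vol x (2 ^ Suc k))) * avg_op (2 ^ Suc k) h x"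
      using m2 D L_ge_1 by (subst (2) ennreal_mult) (auto simp: mult.assoc)
    also have "L * (2 ^ k) powr (- \<sigma>) / vol x (2 ^ Suc k) * (D * vol x (2 ^ Suc k)) = (L * D) * (2 ^ k) powr (- \<sigma>)"
      using m2 by simp
    also have "ennreal ((L * D) * (2 ^ k) powr (- \<sigma>)) * avg_op (2 ^ Suc k) h x
        = ennreal (L * D) * (ennreal ((2 ^ k) powr (- \<sigma>)) * avg_op (2 ^ Suc k) h x)"
      using L_ge_1 D by (subst ennreal_mult) (auto simp: mult.assoc)
    finally show "ennreal (L * (2 ^ k * 1) powr (- \<sigma>) / vol x (2 ^ Suc k * 1)) * (\<integral>\<^sup>+y\<in>B x (2 ^ Suc k * 1). h y \<partial>M)
       \<le> ennreal (L * D) * (ennreal ((2 ^ k) powr (- \<sigma>)) * avg_op (2 ^ Suc k) h x)" .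
  qed auto
  also have "\<dots> = ennreal (L * D) * tail_op \<sigma> h x" unfolding tail_op_def by simp
  finally show ?thesis by (simp add: D_def)
qed

section \<open>The outer Morrey norm on a subset\<close>

text \<open>The two cases of the outer norm coincide in effect: a measurable \<open>F\<close> is its own best
  extension (by 0 outside \<open>\<Omega>\<close>), and otherwise \<open>G\<close>, changed to \<open>\<infinity>\<close> on the exceptional null set, is
  a measurable majorant. With the converse below, only pointwise domination by
  Morrey functions has to be discussed.\<close>

lemma morrey_outer_norm_leI:
  assumes \<Omega> [measurable]: "\<Omega> \<in> sets M" and [measurable]: "G \<in> borel_measurable M" and b: "0 \<le> b"
    and bd: "morrey_bd (\<lambda>y. ennreal (\<bar>G y\<bar> powr p)) (b powr p)"
    and FG: "AE x in M. x \<in> \<Omega> \<longrightarrow> F x \<le> ennreal (G x)"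
  shows "morrey_outer_norm_on M \<rho> p \<phi> \<Omega> F \<le> ennreal b"
proof -
  have on: "morrey_norm_on M \<rho> p \<phi> \<Omega> H \<le> ennreal b"
    if g: "g \<in> borel_measurable M" and le: "AE x in M. \<bar>g x\<bar> \<le> \<bar>G x\<bar>"
      and gH: "AE x in M. x \<in> \<Omega> \<longrightarrow> ereal (g x) = H x" for g H
  proof -
    have "morrey_bd (\<lambda>y. ennreal (\<bar>g y\<bar> powr p)) (b powr p)"
    proof (rule morrey_bd_mono[OF bd _ order_refl])
      show "AE y in M. ennreal (\<bar>g y\<bar> powr p) \<le> ennreal (\<bar>G y\<bar> powr p)"
        using le by eventually_elim (use p_pos in \<open>auto intro!: ennreal_leI powr_mono2\<close>)
    qed
    from morrey_spaceI[OF g b this] gH show ?thesis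
      unfolding morrey_norm_on_def by (intro Inf_lower2[of "morrey_norm M \<rho> p \<phi> g"]) auto
  qed
  show ?thesis
  proof (cases "F \<in> borel_measurable (restrict_space M \<Omega>)")
    case True
    then have meas: "(\<lambda>x. F x * indicator \<Omega> x) \<in> borel_measurable M"
      by (subst (asm) borel_measurable_restrict_space_iff_ennreal) auto
    have "morrey_norm_on M \<rho> p \<phi> \<Omega> (\<lambda>x. enn2ereal (F x)) \<le> ennreal b"
    proof (rule on)
      show "(\<lambda>x. enn2real (F x * indicator \<Omega> x)) \<in> borel_measurable M" using meas by simp
      show "AE x in M. \<bar>enn2real (F x * indicator \<Omega> x)\<bar> \<le> \<bar>G x\<bar>"
        using FG
      proof eventually_elim
        case (elim x)
        show ?case
        proof (cases "x \<in> \<Omega>")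
          case True
          then have "F x \<le> ennreal \<bar>G x\<bar>" using elim by (auto intro: order_trans ennreal_leI)
          then have "enn2real (F x) \<le> \<bar>G x\<bar>" by (intro enn2real_leI) auto
          with True show ?thesis by simp
        qed simp
      qed
      show "AE x in M. x \<in> \<Omega> \<longrightarrow> ereal (enn2real (F x * indicator \<Omega> x)) = enn2ereal (F x)"
        using FG
      proof (eventually_elim, intro impI)
        fix x assume "x \<in> \<Omega> \<longrightarrow> F x \<le> ennreal (G x)" and x: "x \<in> \<Omega>"
        then have "F x < top" by (auto intro: le_less_trans)
        then have "F x = ennreal (enn2real (F x))" by simp
        then have "enn2ereal (F x) = ereal (enn2real (F x))"
          by (metis enn2ereal_ennreal enn2real_nonneg)
        with x show "ereal (enn2real (F x * indicator \<Omega> x)) = enn2ereal (F x)" by simp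
      qed
    qed
    with True show ?thesis by (simp add: morrey_outer_norm_on_def)
  next
    case False
    obtain N where N: "{x \<in> space M. \<not> (x \<in> \<Omega> \<longrightarrow> F x \<le> ennreal (G x))} \<subseteq> N" "N \<in> null_sets M"
      using FG by (auto simp: eventually_ae_filter)
    then have Nm [measurable]: "N \<in> sets M" by auto
    define H where "H x = (if x \<in> N then top else ennreal (G x))" for x
    have Hm: "H \<in> borel_measurable M" unfolding H_def by measurable
    have "F x \<le> H x" if "x \<in> \<Omega>" for x
      using N(1) that sets.sets_into_space[OF \<Omega>] by (auto simp: H_def)
    moreover have "H \<in> borel_measurable (restrict_space M \<Omega>)" using Hm by (rule measurable_restrict_space1)
    moreover have "morrey_norm_on M \<rho> p \<phi> \<Omega> (\<lambda>x. enn2ereal (H x)) \<le> ennreal b"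
    proof (rule on)
      show "(\<lambda>x. max 0 (G x)) \<in> borel_measurable M" by measurable
      show "AE x in M. \<bar>max 0 (G x)\<bar> \<le> \<bar>G x\<bar>" by (intro AE_I2) auto
      have "ennreal (G x) = ennreal (max 0 (G x))" for x by (cases "0 \<le> G x") (auto simp: ennreal_neg)
      then have "enn2ereal (ennreal (G x)) = ereal (max 0 (G x))" for x
        by (metis enn2ereal_ennreal max.cobounded1)
      then show "AE x in M. x \<in> \<Omega> \<longrightarrow> ereal (max 0 (G x)) = enn2ereal (H x)"
        using AE_not_in[OF N(2)] by (auto simp: H_def)
    qed
    ultimately have "Inf {morrey_norm_on M \<rho> p \<phi> \<Omega> (\<lambda>x. enn2ereal (H x)) | H.
             H \<in> borel_measurable (restrict_space M \<Omega>) \<and> (\<forall>x\<in>\<Omega>. F x \<le> H x)} \<le> ennreal b"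
      by (intro Inf_lower2[of "morrey_norm_on M \<rho> p \<phi> \<Omega> (\<lambda>x. enn2ereal (H x))"]) auto
    with False show ?thesis by (simp add: morrey_outer_norm_on_def)
  qed
qed

lemma morrey_outer_norm_lessD:
  assumes "morrey_outer_norm_on M \<rho> p \<phi> \<Omega> F < c"
  shows "\<exists>G\<in>morrey_space M \<rho> p \<phi>. morrey_norm M \<rho> p \<phi> G < c \<and>
    (AE x in M. x \<in> \<Omega> \<longrightarrow> F x \<le> ennreal (G x))"
proof -
  obtain H where FH: "\<forall>x\<in>\<Omega>. F x \<le> H x"
    and H: "morrey_norm_on M \<rho> p \<phi> \<Omega> (\<lambda>x. enn2ereal (H x)) < c"
  proof (cases "F \<in> borel_measurable (restrict_space M \<Omega>)")
    case True
    then show ?thesis using assms that[of F] by (auto simp: morrey_outer_norm_on_def)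
  next
    case False
    then show ?thesis using assms that by (auto simp: morrey_outer_norm_on_def Inf_less_iff)
  qed
  from H obtain G where G: "G \<in> morrey_space M \<rho> p \<phi>" "morrey_norm M \<rho> p \<phi> G < c"
    and GH: "AE x in M. x \<in> \<Omega> \<longrightarrow> ereal (G x) = enn2ereal (H x)"
    by (auto simp: morrey_norm_on_def Inf_less_iff)
  have "AE x in M. x \<in> \<Omega> \<longrightarrow> F x \<le> ennreal (G x)"
    using GH
  proof (eventually_elim, intro impI)
    fix x assume "x \<in> \<Omega> \<longrightarrow> ereal (G x) = enn2ereal (H x)" and x: "x \<in> \<Omega>"
    then have "H x = ennreal (G x)" by (metis e2ennreal_enn2ereal e2ennreal_ereal)
    then show "F x \<le> ennreal (G x)" using FH x by auto
  qed
  with G show ?thesis by blast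
qed

section \<open>The upper bound\<close>

abbreviation U_energy :: "'a set \<Rightarrow> real \<Rightarrow> ('a \<Rightarrow> real) \<Rightarrow> real \<Rightarrow> 'a \<Rightarrow> ennreal" where
  "U_energy \<Omega> q f s x \<equiv> \<integral>\<^sup>+y\<in>\<Omega>. (if y = x then 0
     else ennreal (\<bar>f x - f y\<bar> powr q / (U_fun M \<rho> x y * \<rho> x y powr (s * q)))) \<partial>M"

lemma U_energy_cong:
  assumes "x \<in> \<Omega>" "\<And>y. y \<in> \<Omega> \<Longrightarrow> g y = f y + a"
  shows "U_energy \<Omega> q f s x = U_energy \<Omega> q g s x"
  using assms by (intro nn_integral_cong) (auto split: split_indicator)

lemma gagliardo_le_iff:
  assumes x: "x \<in> \<Omega>" and gf: "\<And>y. y \<in> \<Omega> \<Longrightarrow> g y = f y + a" and q: "0 < q" and G: "0 \<le> G"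
  shows "gagliardo M \<rho> \<Omega> s q f x \<le> ennreal G \<longleftrightarrow> U_energy \<Omega> q g s x \<le> ennreal (G powr q)"
proof -
  have "U_energy \<Omega> q f s x = U_energy \<Omega> q g s x" by (rule U_energy_cong[OF x gf])
  then show ?thesis unfolding gagliardo_def using enn_powr_le_iff[OF q G] by simp
qed

lemma kernel_energy_le_U_energy:
  assumes "x \<in> \<Omega>" "\<Omega> \<subseteq> space M"
  shows "(\<integral>\<^sup>+y\<in>\<Omega>. ennreal (\<bar>f x - f y\<bar> powr q * kern (s * q) x y) \<partial>M) \<le> U_energy \<Omega> q f s x"
proof (intro nn_integral_mono)
  fix y assume y: "y \<in> space M"
  show "ennreal (\<bar>f x - f y\<bar> powr q * kern (s * q) x y) * indicator \<Omega> y
     \<le> (if y = x then 0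
     else ennreal (\<bar>f x - f y\<bar> powr q / (U_fun M \<rho> x y * \<rho> x y powr (s * q)))) * indicator \<Omega> y"
  proof (cases "y = x")
    case False
    then have "\<bar>f x - f y\<bar> powr q * kern (s * q) x y
        \<le> \<bar>f x - f y\<bar> powr q * (1 / (U_fun M \<rho> x y * \<rho> x y powr (s * q)))"
      using assms y by (intro mult_left_mono kern_le_U_kernel(1)) auto
    then show ?thesis using False by (auto intro!: mult_right_mono ennreal_leI)
  qed simp
qed

lemma U_energy_le_kernel_energy:
  assumes "x \<in> \<Omega>" "\<Omega> \<subseteq> space M"
  shows "U_energy \<Omega> q f s x
    \<le> (\<integral>\<^sup>+y\<in>\<Omega>. ennreal (growth (2 * K) * (\<bar>f x - f y\<bar> powr q * kern (s * q) x y)) \<partial>M)"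
proof (intro nn_integral_mono)
  fix y assume y: "y \<in> space M"
  show "(if y = x then 0
     else ennreal (\<bar>f x - f y\<bar> powr q / (U_fun M \<rho> x y * \<rho> x y powr (s * q)))) * indicator \<Omega> y
    \<le> ennreal (growth (2 * K) * (\<bar>f x - f y\<bar> powr q * kern (s * q) x y)) * indicator \<Omega> y"
  proof (cases "y = x")
    case False
    then have "\<bar>f x - f y\<bar> powr q * (1 / (U_fun M \<rho> x y * \<rho> x y powr (s * q)))
        \<le> \<bar>f x - f y\<bar> powr q * (growth (2 * K) * kern (s * q) x y)"
      using assms y by (intro mult_left_mono kern_le_U_kernel(2)) auto
    then have "\<bar>f x - f y\<bar> powr q / (U_fun M \<rho> x y * \<rho> x y powr (s * q))
        \<le> growth (2 * K) * (\<bar>f x - f y\<bar> powr q * kern (s * q) x y)"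
      by (simp add: mult.left_commute)
    then show ?thesis using False by (auto intro!: mult_right_mono ennreal_leI)
  qed simp
qed

text \<open>The factor \<open>growth (4 * K ^ 2)\<close> is included so that the same constant bounds the mass of the far
  kernel and its comparison with the tail operator.\<close>

definition far_const :: "real \<Rightarrow> real" where
  "far_const q = L * growth (4 * K ^ 2) * (1 + 1 / (q * ln 2))"

lemma far_const_pos: "0 < q \<Longrightarrow> 0 < far_const q"
  using L_ge_1 growth_ge_1[of "4 * K ^ 2"] unfolding far_const_def
  by (intro mult_pos_pos add_pos_pos) auto

lemma inverse_geometric_le:
  assumes s: "0 < s" "s \<le> 1" and q: "0 < q" and a: "0 \<le> a"
  shows "L * a / (1 - 2 powr (- (s * q))) \<le> a * (far_const q / s)"
proof -
  have "L * a * (1 / (1 - 2 powr (- (s * q)))) \<le> L * a * ((1 + 1 / (q * ln 2)) / s)"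
    using inverse_one_minus_powr_neg_le[OF s q] L_ge_1 a by (intro mult_left_mono) auto
  also have "\<dots> \<le> L * a * (growth (4 * K ^ 2) * ((1 + 1 / (q * ln 2)) / s))"
    using mult_right_mono[OF growth_ge_1[of "4 * K ^ 2"], of "(1 + 1 / (q * ln 2)) / s"] L_ge_1 s q a
    by (intro mult_left_mono) auto
  also have "\<dots> = a * (far_const q / s)" by (simp add: far_const_def)
  finally show ?thesis by simp
qed

lemma far_mass_le:
  assumes x: "x \<in> space M" and s: "0 < s" "s \<le> 1" and q: "0 < q" and R: "1 \<le> R"
  shows "(\<integral>\<^sup>+y\<in>{y \<in> space M. R \<le> \<rho> x y}. ennreal (kern (s * q) x y) \<partial>M)
    \<le> ennreal (far_const q / s)"
proof -
  have "(\<integral>\<^sup>+y\<in>{y \<in> space M. R \<le> \<rho> x y}. 1 * ennreal (kern (s * q) x y) \<partial>M)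
      \<le> ennreal (L * 1 / (1 - 2 powr (- (s * q))))"
    using emeasure_ball[OF x] x s q R
    by (intro far_kernel_bound) (auto simp: nn_integral_indicator)
  also have "\<dots> \<le> ennreal (far_const q / s)"
    using inverse_geometric_le[OF s q, of 1] by (intro ennreal_leI) simp
  finally show ?thesis by simp
qed

text \<open>The kernel restricted to distances at least 1 has mass at most \<open>far_const q / s\<close>, and the integral of
  \<open>\<bar>g\<bar>\<^sup>p\<close> against it is at most \<open>t\<close> times this number. Interpolation at the level
  \<open>l = t\<^sup>1\<^sup>/\<^sup>p\<close> gives the claim. When \<open>t = 0\<close> this level is not
  admissible, and \<open>l\<close> tends to 0 instead.\<close>

lemma far_q_integral_le:
  assumes x [measurable]: "x \<in> space M" and s: "0 < s" "s \<le> 1" and q: "0 < q" "q < p"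
    and [measurable]: "g \<in> borel_measurable M"
    and t: "0 \<le> t" "ennreal s * tail_op (s * q) (\<lambda>y. ennreal (\<bar>g y\<bar> powr p)) x \<le> ennreal t"
  shows "(\<integral>\<^sup>+y\<in>{y \<in> space M. 1 \<le> \<rho> x y}. ennreal (\<bar>g y\<bar> powr q) * ennreal (kern (s * q) x y) \<partial>M)
    \<le> ennreal (2 * t powr (q / p) * (far_const q / s))"
proof -
  define N where "N = far_const q / s"
  have N: "0 < N" using far_const_pos[OF q(1)] s by (simp add: N_def)
  define w where "w y = ennreal (kern (s * q) x y) * indicator {y \<in> space M. 1 \<le> \<rho> x y} y" for y
  have [measurable]: "w \<in> borel_measurable M" unfolding w_def by measurable
  have w_eq: "(\<integral>\<^sup>+y\<in>{y \<in> space M. 1 \<le> \<rho> x y}. h y * ennreal (kern (s * q) x y) \<partial>M) = (\<integral>\<^sup>+y. h y * w y \<partial>M)" for h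
    by (simp add: w_def mult.assoc)
  have mass: "(\<integral>\<^sup>+y. w y \<partial>M) \<le> ennreal N"
    using far_mass_le[OF x s q(1) order_refl] by (simp add: w_def N_def)
  have "(\<integral>\<^sup>+y. ennreal (\<bar>g y\<bar> powr p) * w y \<partial>M)
      \<le> ennreal (L * growth (4 * K ^ 2)) * tail_op (s * q) (\<lambda>y. ennreal (\<bar>g y\<bar> powr p)) x"
    unfolding w_eq[symmetric] using x s q by (intro far_kernel_le_tail_op) auto
  also have "\<dots> = ennreal (L * growth (4 * K ^ 2) / s) * (ennreal s * tail_op (s * q) (\<lambda>y. ennreal (\<bar>g y\<bar> powr p)) x)"
    using s L_ge_1 growth_ge_1[of "4 * K ^ 2"]
    by (simp add: mult.assoc[symmetric] ennreal_mult[symmetric])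
  also have "\<dots> \<le> ennreal (L * growth (4 * K ^ 2) / s) * ennreal t"
    by (intro mult_left_mono t) auto
  also have "\<dots> = ennreal (L * growth (4 * K ^ 2) / s * t)"
    using s L_ge_1 growth_ge_1[of "4 * K ^ 2"] t by (intro ennreal_mult[symmetric]) auto
  also have "\<dots> \<le> ennreal (t * N)"
  proof (rule ennreal_leI)
    have "L * growth (4 * K ^ 2) * 1 \<le> far_const q"
      unfolding far_const_def using L_ge_1 growth_ge_1[of "4 * K ^ 2"] q by (intro mult_left_mono) auto
    then have "L * growth (4 * K ^ 2) / s \<le> N" using s by (simp add: N_def divide_right_mono)
    then have "L * growth (4 * K ^ 2) / s * t \<le> N * t" using t by (intro mult_right_mono) auto
    then show "L * growth (4 * K ^ 2) / s * t \<le> t * N" by (simp add: mult.commute)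
  qed
  finally have pint: "(\<integral>\<^sup>+y. ennreal (\<bar>g y\<bar> powr p) * w y \<partial>M) \<le> ennreal (t * N)" .
  have est: "(\<integral>\<^sup>+y. ennreal (\<bar>g y\<bar> powr q) * w y \<partial>M) \<le> ennreal (2 * l powr q * N)"
    if l: "0 < l" "t \<le> l powr p" for l
    using pint N l q mass
    by (intro nn_integral_interpolate[where p = p])
      (auto intro: order_trans ennreal_leI mult_right_mono)
  show ?thesis
  proof (cases "t = 0")
    case False
    have "(\<integral>\<^sup>+y. ennreal (\<bar>g y\<bar> powr q) * w y \<partial>M) \<le> ennreal (2 * (t powr (1 / p)) powr q * N)"
      using False t p_pos by (intro est) (auto simp: powr_powr)
    then show ?thesis unfolding w_eq N_def by (simp add: powr_powr)
  next
    case True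
    have "(\<integral>\<^sup>+y. ennreal (\<bar>g y\<bar> powr q) * w y \<partial>M) \<le> 0"
    proof (rule ennreal_le_epsilon)
      fix e :: real assume e: "0 < e"
      have "(\<integral>\<^sup>+y. ennreal (\<bar>g y\<bar> powr q) * w y \<partial>M)
          \<le> ennreal (2 * ((e / (2 * N)) powr (1 / q)) powr q * N)"
        using True e N by (intro est) auto
      also have "2 * ((e / (2 * N)) powr (1 / q)) powr q * N = e"
        using q e N by (simp add: powr_powr)
      finally show "(\<integral>\<^sup>+y. ennreal (\<bar>g y\<bar> powr q) * w y \<partial>M) \<le> 0 + ennreal e" by simp
    qed
    then show ?thesis unfolding w_eq by simp
  qed
qed

text \<open>Chosen to dominate each of the three coefficients that arise when the functional is split into the near part
  and the two terms of the far part.\<close>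

definition upper_const :: "real \<Rightarrow> real" where
  "upper_const q = growth (2 * K) * (2 * 2 powr q * far_const q + 1)"

lemma upper_const_ge:
  assumes "0 < q"
  shows "0 < upper_const q" "growth (2 * K) \<le> upper_const q"
    "2 * (growth (2 * K) * 2 powr q * far_const q) \<le> upper_const q"
proof -
  have D: "1 \<le> growth (2 * K)" by (rule growth_ge_1)
  have F: "0 < 2 powr q * far_const q" using far_const_pos[OF assms] by simp
  have e: "upper_const q = 2 * (growth (2 * K) * (2 powr q * far_const q)) + growth (2 * K)"
    by (simp add: upper_const_def algebra_simps)
  have P: "0 < growth (2 * K) * (2 powr q * far_const q)" using D F by simp
  show "0 < upper_const q" "growth (2 * K) \<le> upper_const q" using e P D by linarith+
  show "2 * (growth (2 * K) * 2 powr q * far_const q) \<le> upper_const q"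
    using e P D by (simp add: mult.assoc)
qed

text \<open>Split at distance 1. Below it \<open>\<rho>\<^sup>-\<^sup>s\<^sup>q \<le> \<rho>\<^sup>-\<^sup>s\<^sup>0\<^sup>q\<close>, so the functional at \<open>s0\<close>
  is a bound independent of \<open>s\<close>. Above it, the difference \<open>g x - g y\<close> is
  estimated by its two terms separately: the first one is multiplied by the mass of the kernel, and
  the second one is handled by \<open>far_q_integral_le\<close>.\<close>

lemma U_energy_upper_pointwise:
  assumes \<Omega> [measurable]: "\<Omega> \<in> sets M" and x: "x \<in> \<Omega>" and s: "0 < s" "s \<le> s0" "s0 \<le> 1"
    and q: "0 < q" "q < p" and [measurable]: "g \<in> borel_measurable M"
    and G0: "0 \<le> G0" "U_energy \<Omega> q g s0 x \<le> ennreal (G0 powr q)"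
    and t: "0 \<le> t" "ennreal s * tail_op (s * q) (\<lambda>y. ennreal (\<bar>g y\<bar> powr p)) x \<le> ennreal t"
  shows "U_energy \<Omega> q g s x
    \<le> ennreal (((3 * upper_const q) powr (1 / q) * (G0 + s powr (- (1 / q)) * (\<bar>g x\<bar> + t powr (1 / p)))) powr q)"
proof -
  have sub: "\<Omega> \<subseteq> space M" using sets.sets_into_space[OF \<Omega>] .
  have xs [measurable]: "x \<in> space M" using x sub by blast
  define D where "D = growth (2 * K)"
  define N where "N = far_const q / s"
  define E where "E = {y \<in> space M. 1 \<le> \<rho> x y}"
  have D: "1 \<le> D" by (simp add: D_def growth_ge_1)
  have s1: "s \<le> 1" using s by simp
  have N: "0 < N" using far_const_pos[OF q(1)] s by (simp add: N_def)
  have [measurable]: "E \<in> sets M" unfolding E_def by measurable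
  have "U_energy \<Omega> q g s x \<le> (\<integral>\<^sup>+y\<in>\<Omega>. ennreal (D * (\<bar>g x - g y\<bar> powr q * kern (s * q) x y)) \<partial>M)"
    unfolding D_def by (rule U_energy_le_kernel_energy[OF x sub])
  also have "\<dots> \<le> (\<integral>\<^sup>+y. ennreal D * (ennreal (\<bar>g x - g y\<bar> powr q * kern (s0 * q) x y) * indicator \<Omega> y)
      + (ennreal (D * 2 powr q * \<bar>g x\<bar> powr q) * (ennreal (kern (s * q) x y) * indicator E y)
       + ennreal (D * 2 powr q) * (ennreal (\<bar>g y\<bar> powr q) * ennreal (kern (s * q) x y) * indicator E y)) \<partial>M)"
  proof (rule nn_integral_mono)
    fix y assume y: "y \<in> space M"
    have k: "0 \<le> kern \<sigma> x y" for \<sigma> by (rule kern_nonneg)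
    show "ennreal (D * (\<bar>g x - g y\<bar> powr q * kern (s * q) x y)) * indicator \<Omega> y
      \<le> ennreal D * (ennreal (\<bar>g x - g y\<bar> powr q * kern (s0 * q) x y) * indicator \<Omega> y)
      + (ennreal (D * 2 powr q * \<bar>g x\<bar> powr q) * (ennreal (kern (s * q) x y) * indicator E y)
       + ennreal (D * 2 powr q) * (ennreal (\<bar>g y\<bar> powr q) * ennreal (kern (s * q) x y) * indicator E y))"
    proof (cases "y \<in> \<Omega>")
      case True
      show ?thesis
      proof (cases "\<rho> x y < 1")
        case True
        have "kern (s * q) x y \<le> kern (s0 * q) x y"
          using True xs y s q by (intro kern_antimono) auto
        then have "D * (\<bar>g x - g y\<bar> powr q * kern (s * q) x y) \<le> D * (\<bar>g x - g y\<bar> powr q * kern (s0 * q) x y)"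
          using D by (intro mult_left_mono) auto
        then have "ennreal (D * (\<bar>g x - g y\<bar> powr q * kern (s * q) x y))
            \<le> ennreal D * ennreal (\<bar>g x - g y\<bar> powr q * kern (s0 * q) x y)"
          using D k by (simp add: ennreal_mult[symmetric] ennreal_leI)
        then show ?thesis using \<open>y \<in> \<Omega>\<close> by (simp add: add_increasing2)
      next
        case False
        then have yE: "y \<in> E" using y by (simp add: E_def)
        have "\<bar>g x - g y\<bar> powr q \<le> (\<bar>g x\<bar> + \<bar>g y\<bar>) powr q" using q by (intro powr_mono2) auto
        also have "\<dots> \<le> 2 powr q * (\<bar>g x\<bar> powr q + \<bar>g y\<bar> powr q)" using q by (intro powr_add_le) auto
        finally have "D * (\<bar>g x - g y\<bar> powr q * kern (s * q) x y)
            \<le> D * ((2 powr q * (\<bar>g x\<bar> powr q + \<bar>g y\<bar> powr q)) * kern (s * q) x y)"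
          using D k by (intro mult_left_mono mult_right_mono) auto
        also have "\<dots> = (D * 2 powr q * \<bar>g x\<bar> powr q) * kern (s * q) x y
            + (D * 2 powr q) * (\<bar>g y\<bar> powr q * kern (s * q) x y)" by (simp add: algebra_simps)
        finally have "ennreal (D * (\<bar>g x - g y\<bar> powr q * kern (s * q) x y))
            \<le> ennreal ((D * 2 powr q * \<bar>g x\<bar> powr q) * kern (s * q) x y
            + (D * 2 powr q) * (\<bar>g y\<bar> powr q * kern (s * q) x y))" by (rule ennreal_leI)
        also have "\<dots> = ennreal (D * 2 powr q * \<bar>g x\<bar> powr q) * ennreal (kern (s * q) x y)
            + ennreal (D * 2 powr q) * (ennreal (\<bar>g y\<bar> powr q) * ennreal (kern (s * q) x y))"
          using D k by (simp add: ennreal_mult)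
        finally show ?thesis using \<open>y \<in> \<Omega>\<close> yE by (simp add: add_increasing)
      qed
    qed simp
  qed
  also have "\<dots> = ennreal D * (\<integral>\<^sup>+y\<in>\<Omega>. ennreal (\<bar>g x - g y\<bar> powr q * kern (s0 * q) x y) \<partial>M)
      + (ennreal (D * 2 powr q * \<bar>g x\<bar> powr q) * (\<integral>\<^sup>+y\<in>E. ennreal (kern (s * q) x y) \<partial>M)
       + ennreal (D * 2 powr q) * (\<integral>\<^sup>+y\<in>E. ennreal (\<bar>g y\<bar> powr q) * ennreal (kern (s * q) x y) \<partial>M))"
    by (simp add: nn_integral_add nn_integral_cmult)
  also have "\<dots> \<le> ennreal D * ennreal (G0 powr q)
      + (ennreal (D * 2 powr q * \<bar>g x\<bar> powr q) * ennreal N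
       + ennreal (D * 2 powr q) * ennreal (2 * t powr (q / p) * N))"
    unfolding E_def N_def
    using far_mass_le[OF xs s(1) s1 q(1) order_refl]
      far_q_integral_le[OF xs s(1) s1 q _ t] order_trans[OF kernel_energy_le_U_energy[OF x sub] G0(2)]
    by (intro add_mono mult_left_mono) auto
  also have "\<dots> = ennreal (D * G0 powr q + (D * 2 powr q * \<bar>g x\<bar> powr q * N
       + D * 2 powr q * (2 * t powr (q / p) * N)))"
    using D N by (simp add: ennreal_mult)
  also have "\<dots> \<le> ennreal (((3 * upper_const q) powr (1 / q) * (G0 + s powr (- (1 / q)) * (\<bar>g x\<bar> + t powr (1 / p)))) powr q)"
  proof (rule ennreal_leI)
    define W where "W = G0 + s powr (- (1 / q)) * (\<bar>g x\<bar> + t powr (1 / p))"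
    define C where "C = upper_const q"
    have C: "0 < C" "D \<le> C" "2 * (D * 2 powr q * far_const q) \<le> C"
      using upper_const_ge[OF q(1)] by (auto simp: C_def D_def)
    have ss: "s powr (- (1 / q)) > 0" "(s powr (- (1 / q))) powr q = 1 / s"
      unfolding powr_powr using s q by (auto simp: powr_minus_divide)
    have W0: "0 \<le> W" using G0 ss by (simp add: W_def)
    have W1: "G0 powr q \<le> W powr q" using G0 ss q by (intro powr_mono2) (auto simp: W_def)
    have W2: "\<bar>g x\<bar> powr q / s \<le> W powr q"
    proof -
      have "\<bar>g x\<bar> powr q / s = (s powr (- (1 / q)) * \<bar>g x\<bar>) powr q" using ss by (simp add: powr_mult)
      also have "\<dots> \<le> W powr q" using G0 ss q by (intro powr_mono2) (auto simp: W_def ring_distribs)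
      finally show ?thesis .
    qed
    have W3: "t powr (q / p) / s \<le> W powr q"
    proof -
      have "t powr (q / p) / s = (s powr (- (1 / q)) * t powr (1 / p)) powr q"
        using ss by (simp add: powr_mult powr_powr)
      also have "\<dots> \<le> W powr q" using G0 ss q by (intro powr_mono2) (auto simp: W_def ring_distribs)
      finally show ?thesis .
    qed
    have DF: "0 \<le> D * 2 powr q * far_const q" using D far_const_pos[OF q(1)] by simp
    have a1: "D * G0 powr q \<le> C * W powr q" using C W1 D by (intro mult_mono) auto
    have "D * 2 powr q * \<bar>g x\<bar> powr q * N = (D * 2 powr q * far_const q) * (\<bar>g x\<bar> powr q / s)"
      by (simp add: N_def)
    also have "\<dots> \<le> C * W powr q" using C W2 DF s by (intro mult_mono) auto
    finally have a2: "D * 2 powr q * \<bar>g x\<bar> powr q * N \<le> C * W powr q" .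
    have "D * 2 powr q * (2 * t powr (q / p) * N) = (2 * (D * 2 powr q * far_const q)) * (t powr (q / p) / s)"
      by (simp add: N_def)
    also have "\<dots> \<le> C * W powr q" using C W3 DF s by (intro mult_mono) auto
    finally have a3: "D * 2 powr q * (2 * t powr (q / p) * N) \<le> C * W powr q" .
    have "((3 * C) powr (1 / q) * W) powr q = 3 * C * W powr q"
      using C W0 q by (simp add: powr_mult powr_powr)
    then show "D * G0 powr q + (D * 2 powr q * \<bar>g x\<bar> powr q * N + D * 2 powr q * (2 * t powr (q / p) * N))
        \<le> ((3 * upper_const q) powr (1 / q) * (G0 + s powr (- (1 / q)) * (\<bar>g x\<bar> + t powr (1 / p)))) powr q"
      using a1 a2 a3 unfolding W_def[symmetric] C_def[symmetric] by linarith
  qed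
  finally show ?thesis .
qed

text \<open>In the last factor \<open>avg_const * (1 + 1 / (q * ln 2))\<close> comes from the averages; of the summand 2,
  1 comes from \<open>g\<close> itself and the other 1 absorbs the near part once \<open>s\<close> is small.\<close>

definition limsup_const :: "real \<Rightarrow> real" where
  "limsup_const q = 4 * (3 * upper_const q) powr (1 / q) * (2 + avg_const * (1 + 1 / (q * ln 2))) powr (1 / p)"

text \<open>The pointwise bound is a Morrey function whose first part, coming from \<open>s0\<close>, stays bounded as \<open>s\<close>
  tends to 0 and is killed by the factor \<open>s\<^sup>1\<^sup>/\<^sup>q\<close>. The other parts are of size \<open>s\<^sup>-\<^sup>1\<^sup>/\<^sup>q\<close> times the Morrey
  norm of \<open>g\<close>.\<close>

lemma sobolev_limsup_le:
  assumes \<Omega> [measurable]: "\<Omega> \<in> sets M" and q: "0 < q" "q < p"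
    and gm [measurable]: "g \<in> borel_measurable M" and gf: "\<And>x. x \<in> \<Omega> \<Longrightarrow> g x = f x + a"
    and b: "0 < b" and bd: "morrey_bd (\<lambda>y. ennreal (\<bar>g y\<bar> powr p)) (b powr p)"
    and s0: "0 < s0" "s0 < 1" and fin: "sobolev_seminorm M \<rho> p \<phi> \<Omega> s0 q f < \<infinity>"
  shows "Limsup (at_right 0) (\<lambda>s. ennreal (s powr (1 / q)) * sobolev_seminorm M \<rho> p \<phi> \<Omega> s q f)
    \<le> ennreal (limsup_const q * b)"
proof -
  define \<kappa> where "\<kappa> = (3 * upper_const q) powr (1 / q)"
  define V where "V = avg_const * (1 + 1 / (q * ln 2))"
  have \<kappa>: "0 < \<kappa>" using upper_const_ge(1)[OF q(1)] by (simp add: \<kappa>_def)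
  have V: "0 \<le> V" using avg_const_nonneg q by (simp add: V_def)
  obtain G0 where G0: "G0 \<in> morrey_space M \<rho> p \<phi>" "morrey_norm M \<rho> p \<phi> G0 < \<infinity>"
    and FG0: "AE x in M. x \<in> \<Omega> \<longrightarrow> gagliardo M \<rho> \<Omega> s0 q f x \<le> ennreal (G0 x)"
    using morrey_outer_norm_lessD fin unfolding sobolev_seminorm_def by blast
  have [measurable]: "G0 \<in> borel_measurable M" by (rule morrey_spaceD(1)[OF G0(1)])
  obtain b0 where b0: "0 \<le> b0" "morrey_norm M \<rho> p \<phi> G0 = ennreal b0"
    using G0(2) by (cases "morrey_norm M \<rho> p \<phi> G0") auto
  have bd0: "morrey_bd (\<lambda>y. ennreal (\<bar>G0 y\<bar> powr p)) (b0 powr p)"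
    using morrey_spaceD(2)[OF G0(1)] b0 by auto
  \<comment> \<open>The factors \<open>2\<^sup>p\<close> and \<open>4\<^sup>p\<close> stem from one and two applications of \<open>powr_add_le\<close>.\<close>
  define Bd where "Bd s = \<kappa> powr p * 2 powr p * b0 powr p
      + \<kappa> powr p * 4 powr p * s powr (- (p / q)) * ((1 + V) * b powr p)" for s
  have Bd0: "0 \<le> Bd s" for s using V by (simp add: Bd_def)
  have main: "sobolev_seminorm M \<rho> p \<phi> \<Omega> s q f \<le> ennreal (Bd s powr (1 / p))" if s: "0 < s" "s \<le> s0" for s
  proof -
    have s1: "s \<le> 1" and sq: "0 < s * q" using s s0 q by auto
    define T where "T x = ennreal s * tail_op (s * q) (\<lambda>y. ennreal (\<bar>g y\<bar> powr p)) x" for x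
    have [measurable]: "T \<in> borel_measurable M" unfolding T_def by measurable
    have bdT: "morrey_bd T (V * b powr p)"
    proof -
      have T: "morrey_bd T (s * (avg_const * b powr p / (1 - 2 powr (- (s * q)))))"
        unfolding T_def using s sq avg_const_nonneg powr_mono[of "- (s * q)" 0 2]
        by (intro morrey_bd_cmult morrey_bd_tail_op[OF bd]) auto
      have "s * (avg_const * b powr p / (1 - 2 powr (- (s * q)))) \<le> V * b powr p"
      proof -
        have "s * (avg_const * b powr p * (1 / (1 - 2 powr (- (s * q)))))
            \<le> s * (avg_const * b powr p * ((1 + 1 / (q * ln 2)) / s))"
          using inverse_one_minus_powr_neg_le[OF s(1) s1 q(1)] s avg_const_nonneg
          by (intro mult_left_mono) auto
        also have "\<dots> = V * b powr p" using s by (simp add: V_def)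
        finally show ?thesis by simp
      qed
      then show ?thesis by (intro morrey_bd_mono[OF T]) auto
    qed
    have Tfin: "AE x in M. T x < \<infinity>" by (rule morrey_bd_AE_finite[OF bdT]) measurable
    define W where "W x = \<kappa> * (\<bar>G0 x\<bar> + s powr (- (1 / q)) * (\<bar>g x\<bar> + enn2real (T x) powr (1 / p)))" for x
    have [measurable]: "W \<in> borel_measurable M" unfolding W_def by measurable
    have W0: "0 \<le> W x" for x using \<kappa> by (simp add: W_def)
    have ptw: "AE x in M. x \<in> \<Omega> \<longrightarrow> gagliardo M \<rho> \<Omega> s q f x \<le> ennreal (W x)"
      using FG0 Tfin
    proof (eventually_elim, intro impI)
      fix x assume F: "x \<in> \<Omega> \<longrightarrow> gagliardo M \<rho> \<Omega> s0 q f x \<le> ennreal (G0 x)" and Tx: "T x < \<infinity>" and x: "x \<in> \<Omega>"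
      have "gagliardo M \<rho> \<Omega> s0 q f x \<le> ennreal \<bar>G0 x\<bar>"
        using F x by (auto intro: order_trans ennreal_leI)
      then have "U_energy \<Omega> q g s0 x \<le> ennreal (\<bar>G0 x\<bar> powr q)"
        by (subst (asm) gagliardo_le_iff[OF x gf q(1)]) auto
      then have "U_energy \<Omega> q g s x \<le> ennreal (W x powr q)"
        unfolding W_def \<kappa>_def using x s s0 q Tx
        by (intro U_energy_upper_pointwise[where ?s0.0 = s0]) (auto simp: T_def)
      then show "gagliardo M \<rho> \<Omega> s q f x \<le> ennreal (W x)"
        by (subst gagliardo_le_iff[OF x gf q(1) W0])
    qed
    define H where "H x = ennreal (\<kappa> powr p * 2 powr p) * ennreal (\<bar>G0 x\<bar> powr p)
        + ennreal (\<kappa> powr p * 4 powr p * s powr (- (p / q))) * (ennreal (\<bar>g x\<bar> powr p) + T x)" for x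
    have bdH: "morrey_bd H (Bd s)"
    proof -
      have "morrey_bd H ((\<kappa> powr p * 2 powr p) * b0 powr p
          + (\<kappa> powr p * 4 powr p * s powr (- (p / q))) * (b powr p + V * b powr p))"
        unfolding H_def using bd bd0 bdT V
        by (intro morrey_bd_add morrey_bd_cmult) auto
      then show ?thesis by (simp add: Bd_def ring_distribs)
    qed
    have "AE x in M. ennreal (\<bar>W x\<bar> powr p) \<le> H x"
      using Tfin
    proof eventually_elim
      fix x assume Tx: "T x < \<infinity>"
      define t where "t = enn2real (T x)"
      have t: "0 \<le> t" "T x = ennreal t" using Tx by (auto simp: t_def)
      have "\<bar>W x\<bar> powr p = \<kappa> powr p * (\<bar>G0 x\<bar> + s powr (- (1 / q)) * (\<bar>g x\<bar> + t powr (1 / p))) powr p"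
        using W0[of x] \<kappa> by (simp add: W_def t_def powr_mult)
      also have "\<dots> \<le> \<kappa> powr p * (2 powr p * (\<bar>G0 x\<bar> powr p + (s powr (- (1 / q)) * (\<bar>g x\<bar> + t powr (1 / p))) powr p))"
        using p_pos by (intro mult_left_mono powr_add_le) auto
      also have "(s powr (- (1 / q)) * (\<bar>g x\<bar> + t powr (1 / p))) powr p
          = s powr (- (p / q)) * (\<bar>g x\<bar> + t powr (1 / p)) powr p"
        by (simp add: powr_mult powr_powr)
      also have "\<kappa> powr p * (2 powr p * (\<bar>G0 x\<bar> powr p + s powr (- (p / q)) * (\<bar>g x\<bar> + t powr (1 / p)) powr p))
          \<le> \<kappa> powr p * (2 powr p * (\<bar>G0 x\<bar> powr p + s powr (- (p / q)) * (2 powr p * (\<bar>g x\<bar> powr p + t))))"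
        using powr_add_le[of "\<bar>g x\<bar>" "t powr (1 / p)" p] p_pos t
        by (intro mult_left_mono add_left_mono) (auto simp: powr_powr)
      also have "\<dots> = \<kappa> powr p * 2 powr p * \<bar>G0 x\<bar> powr p
          + \<kappa> powr p * 4 powr p * s powr (- (p / q)) * (\<bar>g x\<bar> powr p + t)"
        using powr_mult[of 2 2 p] by (simp add: algebra_simps)
      finally have "ennreal (\<bar>W x\<bar> powr p) \<le> ennreal (\<kappa> powr p * 2 powr p * \<bar>G0 x\<bar> powr p
          + \<kappa> powr p * 4 powr p * s powr (- (p / q)) * (\<bar>g x\<bar> powr p + t))" by (rule ennreal_leI)
      also have "\<dots> = H x" using t(1) by (simp add: H_def t(2) ennreal_mult)
      finally show "ennreal (\<bar>W x\<bar> powr p) \<le> H x" .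
    qed
    then have "morrey_bd (\<lambda>x. ennreal (\<bar>W x\<bar> powr p)) ((Bd s powr (1 / p)) powr p)"
      using bdH Bd0[of s] p_pos by (intro morrey_bd_mono[OF bdH]) (auto simp: powr_powr)
    then show ?thesis
      unfolding sobolev_seminorm_def using ptw by (intro morrey_outer_norm_leI[where G = W]) auto
  qed
  have "((\<lambda>s. s powr (p / q) * (2 powr p * b0 powr p)) \<longlongrightarrow> 0 powr (p / q) * (2 powr p * b0 powr p)) (at_right 0)"
    using p_pos q by (intro tendsto_intros tendsto_powr' ) (auto simp: eventually_at_right_less intro: eventually_mono[OF eventually_at_right_less])
  then have "\<forall>\<^sub>F s in at_right 0. s powr (p / q) * (2 powr p * b0 powr p) < 4 powr p * b powr p"
    using b by (intro order_tendstoD) auto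
  moreover have "\<forall>\<^sub>F s in at_right 0. s \<in> {0<..<s0}" using s0 by (intro eventually_at_right_real) auto
  ultimately have "\<forall>\<^sub>F s in at_right 0. ennreal (s powr (1 / q)) * sobolev_seminorm M \<rho> p \<phi> \<Omega> s q f
      \<le> ennreal (limsup_const q * b)"
  proof eventually_elim
    case (elim s)
    then have s: "0 < s" "s \<le> s0" by auto
    have "ennreal (s powr (1 / q)) * sobolev_seminorm M \<rho> p \<phi> \<Omega> s q f
        \<le> ennreal (s powr (1 / q)) * ennreal (Bd s powr (1 / p))"
      by (intro mult_left_mono main s) auto
    also have "\<dots> = ennreal (s powr (1 / q) * Bd s powr (1 / p))" by (simp add: ennreal_mult)
    also have "\<dots> \<le> ennreal (limsup_const q * b)"
    proof (rule ennreal_leI)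
      have e: "s powr (p / q) * s powr (- (p / q)) = 1" using s by (simp add: powr_add[symmetric])
      have "s powr (1 / q) = (s powr (p / q)) powr (1 / p)" using p_pos by (simp add: powr_powr)
      then have "s powr (1 / q) * Bd s powr (1 / p) = (s powr (p / q) * Bd s) powr (1 / p)"
        using Bd0[of s] by (simp add: powr_mult)
      also have "\<dots> \<le> (\<kappa> powr p * 4 powr p * (2 + V) * b powr p) powr (1 / p)"
      proof (rule powr_mono2)
        have "s powr (p / q) * Bd s = \<kappa> powr p * (s powr (p / q) * (2 powr p * b0 powr p))
            + (s powr (p / q) * s powr (- (p / q))) * (\<kappa> powr p * 4 powr p * ((1 + V) * b powr p))"
          by (simp add: Bd_def algebra_simps)
        also have "\<dots> \<le> \<kappa> powr p * (4 powr p * b powr p) + \<kappa> powr p * 4 powr p * ((1 + V) * b powr p)"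
          unfolding e using elim by (intro add_mono mult_left_mono) auto
        also have "\<dots> = \<kappa> powr p * 4 powr p * (2 + V) * b powr p" by (simp add: algebra_simps)
        finally show "s powr (p / q) * Bd s \<le> \<kappa> powr p * 4 powr p * (2 + V) * b powr p" .
      qed (use p_pos Bd0[of s] in auto)
      also have "\<dots> = limsup_const q * b"
        using \<kappa> V b p_pos by (simp add: powr_mult powr_powr limsup_const_def \<kappa>_def V_def)
      finally show "s powr (1 / q) * Bd s powr (1 / p) \<le> limsup_const q * b" .
    qed
    finally show ?case .
  qed
  then show ?thesis by (rule Limsup_bounded)
qed

section \<open>The lower bound\<close>

text \<open>If \<open>\<phi> x\<close> stayed above some \<open>\<delta> > 0\<close>, the integral of \<open>\<delta> / t\<close> would be finite at infinity. A
  single small value suffices, because \<open>\<phi> x\<close> is almost decreasing.\<close>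

lemma phi_vanishes:
  assumes x: "x \<in> space M" and \<epsilon>: "0 < \<epsilon>"
    and int: "(\<integral>\<^sup>+t\<in>{1<..}. ennreal (\<phi> x t / t) \<partial>lborel) \<le> ennreal c"
  shows "\<exists>r0>0. \<forall>r\<ge>r0. \<phi> x r \<le> \<epsilon>"
proof (cases "\<exists>r>0. A * \<phi> x r \<le> \<epsilon>")
  case True
  then show ?thesis using phi_dec[OF x] by (meson order_trans)
next
  case False
  define \<delta> where "\<delta> = \<epsilon> / A"
  have \<delta>: "0 < \<delta>" using \<epsilon> A_ge_1 by (simp add: \<delta>_def)
  have big: "\<delta> \<le> \<phi> x t" if "0 < t" for t
    using False that A_ge_1 by (auto simp: \<delta>_def field_simps not_le intro: less_imp_le)
  \<comment> \<open>The integral of \<open>\<delta> / t\<close> over \<open>{2..2 * exp d}\<close> is \<open>\<delta> d\<close>, which exceeds \<open>c\<close>.\<close>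
  define d where "d = (\<bar>c\<bar> + 1) / \<delta>"
  have d: "0 < d" using \<delta> by (simp add: d_def add_pos_nonneg)
  have "ennreal (\<delta> * ln (2 * exp d) - \<delta> * ln 2) = (\<integral>\<^sup>+t\<in>{2..2 * exp d}. ennreal (\<delta> / t) \<partial>lborel)"
  proof (rule nn_integral_FTC_Icc[where F = "\<lambda>t. \<delta> * ln t", symmetric])
    fix t :: real assume t: "t \<in> {2..2 * exp d}"
    show "((\<lambda>t. \<delta> * ln t) has_real_derivative \<delta> / t) (at t)"
      using t by (auto intro!: derivative_eq_intros)
    show "0 \<le> \<delta> / t" using \<delta> t by simp
  qed (use d in auto)
  also have "\<dots> \<le> (\<integral>\<^sup>+t\<in>{1<..}. ennreal (\<phi> x t / t) \<partial>lborel)"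
    using big by (intro nn_integral_mono) (auto split: split_indicator intro!: ennreal_leI divide_right_mono)
  also have "\<dots> \<le> ennreal c" by (rule int)
  finally have "ennreal (\<delta> * ln (2 * exp d) - \<delta> * ln 2) \<le> ennreal c" .
  moreover have "\<delta> * ln (2 * exp d) - \<delta> * ln 2 = \<bar>c\<bar> + 1"
  proof -
    have "\<delta> * ln (2 * exp d) - \<delta> * ln 2 = \<delta> * d" by (simp add: ln_mult algebra_simps)
    also have "\<dots> = \<bar>c\<bar> + 1" using \<delta> by (simp add: d_def)
    finally show ?thesis .
  qed
  ultimately have "ennreal (\<bar>c\<bar> + 1) \<le> ennreal c" by metis
  then have False by (subst (asm) ennreal_le_iff2) auto
  then show ?thesis ..
qed

text \<open>Beyond a large radius \<open>R\<close> the averages of \<open>\<bar>g\<bar>\<^sup>p\<close> are small compared with \<open>\<bar>g x\<bar>\<^sup>p\<close>, because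
  \<open>\<phi> x r\<close> tends to 0. There \<open>g y\<close> is negligible against \<open>g x\<close> in the
  functional, while the mass of the kernel is at least \<open>\<kappa> / s\<close>.\<close>

lemma U_energy_lower_eventually:
  assumes \<Omega> [measurable]: "\<Omega> \<in> sets M" and x: "x \<in> \<Omega>" and q: "0 < q" "q < p"
    and gm [measurable]: "g \<in> borel_measurable M"
    and b: "0 < b" and bd: "morrey_bd (\<lambda>y. ennreal (\<bar>g y\<bar> powr p)) (b powr p)"
    and van: "\<And>\<epsilon>. 0 < \<epsilon> \<Longrightarrow> \<exists>r0>0. \<forall>r\<ge>r0. \<phi> x r \<le> \<epsilon>"
    and \<kappa>: "0 < \<kappa>" and low: "\<exists>R0>0. \<forall>R\<ge>R0. \<forall>\<^sub>F s in at_right 0.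
      ennreal (\<kappa> / s) \<le> (\<integral>\<^sup>+y\<in>{y \<in> \<Omega>. R \<le> \<rho> x y}. ennreal (kern (s * q) x y) \<partial>M)"
    and gx: "g x \<noteq> 0"
  shows "\<forall>\<^sub>F s in at_right 0. ennreal (\<kappa> / (2 * 2 powr q) * \<bar>g x\<bar> powr q / s) \<le> U_energy \<Omega> q g s x"
proof -
  have sub: "\<Omega> \<subseteq> space M" using sets.sets_into_space[OF \<Omega>] .
  have xs [measurable]: "x \<in> space M" using x sub by blast
  define N where "N = far_const q"
  have N: "0 < N" using far_const_pos[OF q(1)] by (simp add: N_def)
  define X where "X = \<kappa> * \<bar>g x\<bar> powr q"
  have X: "0 < X" using \<kappa> gx by (simp add: X_def)
  \<comment> \<open>The level that makes the error term below equal to half of the main term.\<close>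
  define l where "l = (X / (4 * 2 powr q * N)) powr (1 / q)"
  have l: "0 < l" using X N by (simp add: l_def)
  have lq: "2 powr q * (2 * l powr q * N) = X / 2"
    using X N q by (simp add: l_def powr_powr field_simps)
  \<comment> \<open>From \<open>r0\<close> on, the mean of \<open>\<bar>g\<bar>\<^sup>p\<close> over \<open>B x r\<close> is at most \<open>l\<^sup>p\<close>.\<close>
  obtain r0 where r0: "0 < r0" "\<And>r. r0 \<le> r \<Longrightarrow> \<phi> x r \<le> l / b" using van[of "l / b"] l b by auto
  obtain R0 where R0: "0 < R0" "\<And>R. R0 \<le> R \<Longrightarrow> \<forall>\<^sub>F s in at_right 0.
      ennreal (\<kappa> / s) \<le> (\<integral>\<^sup>+y\<in>{y \<in> \<Omega>. R \<le> \<rho> x y}. ennreal (kern (s * q) x y) \<partial>M)"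
    using low by blast
  define R where "R = max (max r0 R0) 1"
  have R: "r0 \<le> R" "R0 \<le> R" "1 \<le> R" by (auto simp: R_def)
  define E where "E = {y \<in> space M. R \<le> \<rho> x y}"
  have [measurable]: "E \<in> sets M" unfolding E_def by measurable
  have av: "(\<integral>\<^sup>+y\<in>B x r. ennreal (\<bar>g y\<bar> powr p) \<partial>M) \<le> ennreal (l powr p * vol x r)" if r: "R \<le> r" for r
  proof -
    have rp: "0 < r" using r R by simp
    have "(\<integral>\<^sup>+y\<in>B x r. ennreal (\<bar>g y\<bar> powr p) \<partial>M) \<le> ennreal (b powr p * (\<phi> x r powr p * vol x r))"
      by (rule morrey_bdD[OF bd xs rp])
    also have "\<dots> \<le> ennreal (l powr p * vol x r)"
    proof (rule ennreal_leI)
      have "b * \<phi> x r \<le> l" using r0(2)[of r] r R b by (simp add: field_simps)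
      then have "(b * \<phi> x r) powr p \<le> l powr p"
        using b phi_pos[OF xs rp] p_pos by (intro powr_mono2) auto
      then have "(b powr p * \<phi> x r powr p) * vol x r \<le> l powr p * vol x r"
        using b phi_pos[OF xs rp] vol_nonneg by (intro mult_right_mono) (auto simp: powr_mult)
      then show "b powr p * (\<phi> x r powr p * vol x r) \<le> l powr p * vol x r" by (simp add: mult.assoc)
    qed
    finally show ?thesis .
  qed
  have "\<forall>\<^sub>F s in at_right 0. s \<in> {0<..<1::real}" by (intro eventually_at_right_real) auto
  with R0(2)[OF R(2)] show ?thesis
  proof eventually_elim
    case (elim s)
    then have s: "0 < s" "s \<le> 1" by auto
    define w where "w y = ennreal (kern (s * q) x y) * indicator E y" for y
    have [measurable]: "w \<in> borel_measurable M" unfolding w_def by measurable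
    have "(\<integral>\<^sup>+y. ennreal (\<bar>g y\<bar> powr p) * w y \<partial>M) \<le> ennreal (l powr p * (N / s))"
    proof -
      have "(\<integral>\<^sup>+y. ennreal (\<bar>g y\<bar> powr p) * w y \<partial>M)
          = (\<integral>\<^sup>+y\<in>{y \<in> space M. R \<le> \<rho> x y}. ennreal (\<bar>g y\<bar> powr p) * ennreal (kern (s * q) x y) \<partial>M)"
        by (simp add: w_def E_def mult.assoc)
      also have "\<dots> \<le> ennreal (L * l powr p / (1 - 2 powr (- (s * q))))"
        using s q av R by (intro far_kernel_bound xs) auto
      also have "\<dots> \<le> ennreal (l powr p * (N / s))"
        unfolding N_def using s q by (intro ennreal_leI inverse_geometric_le) auto
      finally show ?thesis .
    qed
    then have far: "(\<integral>\<^sup>+y. ennreal (\<bar>g y\<bar> powr q) * w y \<partial>M) \<le> ennreal (2 * l powr q * (N / s))"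
      using far_mass_le[OF xs s q(1) R(3)] l q N s
      by (intro nn_integral_interpolate[where p = p]) (auto simp: w_def E_def N_def)
    have "ennreal (X / s) = ennreal (\<bar>g x\<bar> powr q) * ennreal (\<kappa> / s)"
      using \<kappa> s by (simp add: X_def ennreal_mult[symmetric] mult.commute)
    also have "\<dots> \<le> ennreal (\<bar>g x\<bar> powr q) * (\<integral>\<^sup>+y\<in>{y \<in> \<Omega>. R \<le> \<rho> x y}. ennreal (kern (s * q) x y) \<partial>M)"
      using elim by (intro mult_left_mono) auto
    also have "\<dots> = (\<integral>\<^sup>+y. ennreal (\<bar>g x\<bar> powr q) * (ennreal (kern (s * q) x y) * indicator (\<Omega> \<inter> E) y) \<partial>M)"
    proof (subst nn_integral_cmult)
      have "{y \<in> \<Omega>. R \<le> \<rho> x y} = \<Omega> \<inter> E" using sub by (auto simp: E_def)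
      then show "ennreal (\<bar>g x\<bar> powr q) * (\<integral>\<^sup>+y\<in>{y \<in> \<Omega>. R \<le> \<rho> x y}. ennreal (kern (s * q) x y) \<partial>M)
        = ennreal (\<bar>g x\<bar> powr q) * (\<integral>\<^sup>+y\<in>\<Omega> \<inter> E. ennreal (kern (s * q) x y) \<partial>M)" by simp
    qed measurable
    also have "\<dots> \<le> (\<integral>\<^sup>+y. ennreal (2 powr q) * (ennreal (\<bar>g x - g y\<bar> powr q * kern (s * q) x y) * indicator \<Omega> y)
        + ennreal (2 powr q) * (ennreal (\<bar>g y\<bar> powr q) * w y) \<partial>M)"
    proof (rule nn_integral_mono)
      fix y
      have k: "0 \<le> kern (s * q) x y" by (rule kern_nonneg)
      have "\<bar>g x\<bar> powr q \<le> (\<bar>g x - g y\<bar> + \<bar>g y\<bar>) powr q" using q by (intro powr_mono2) auto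
      also have "\<dots> \<le> 2 powr q * (\<bar>g x - g y\<bar> powr q + \<bar>g y\<bar> powr q)" using q by (intro powr_add_le) auto
      finally have "\<bar>g x\<bar> powr q * kern (s * q) x y
          \<le> 2 powr q * (\<bar>g x - g y\<bar> powr q + \<bar>g y\<bar> powr q) * kern (s * q) x y"
        using k by (intro mult_right_mono) auto
      also have "\<dots> = 2 powr q * (\<bar>g x - g y\<bar> powr q * kern (s * q) x y)
          + 2 powr q * (\<bar>g y\<bar> powr q * kern (s * q) x y)"
        by (simp add: algebra_simps)
      finally have "ennreal (\<bar>g x\<bar> powr q * kern (s * q) x y)
        \<le> ennreal (2 powr q * (\<bar>g x - g y\<bar> powr q * kern (s * q) x y)
          + 2 powr q * (\<bar>g y\<bar> powr q * kern (s * q) x y))" by (rule ennreal_leI)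
      also have "\<dots> = ennreal (2 powr q) * ennreal (\<bar>g x - g y\<bar> powr q * kern (s * q) x y)
          + ennreal (2 powr q) * (ennreal (\<bar>g y\<bar> powr q) * ennreal (kern (s * q) x y))"
        using k by (simp add: ennreal_mult)
      finally have "ennreal (\<bar>g x\<bar> powr q) * ennreal (kern (s * q) x y)
        \<le> ennreal (2 powr q) * ennreal (\<bar>g x - g y\<bar> powr q * kern (s * q) x y)
          + ennreal (2 powr q) * (ennreal (\<bar>g y\<bar> powr q) * ennreal (kern (s * q) x y))"
        using k by (simp add: ennreal_mult)
      then show "ennreal (\<bar>g x\<bar> powr q) * (ennreal (kern (s * q) x y) * indicator (\<Omega> \<inter> E) y)
        \<le> ennreal (2 powr q) * (ennreal (\<bar>g x - g y\<bar> powr q * kern (s * q) x y) * indicator \<Omega> y)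
        + ennreal (2 powr q) * (ennreal (\<bar>g y\<bar> powr q) * w y)"
        by (auto simp: w_def split: split_indicator)
    qed
    also have "\<dots> = ennreal (2 powr q) * (\<integral>\<^sup>+y\<in>\<Omega>. ennreal (\<bar>g x - g y\<bar> powr q * kern (s * q) x y) \<partial>M)
        + ennreal (2 powr q) * (\<integral>\<^sup>+y. ennreal (\<bar>g y\<bar> powr q) * w y \<partial>M)"
      by (simp add: nn_integral_add nn_integral_cmult)
    also have "\<dots> \<le> ennreal (2 powr q) * U_energy \<Omega> q g s x
        + ennreal (2 powr q) * ennreal (2 * l powr q * (N / s))"
      using kernel_energy_le_U_energy[OF x sub] far by (intro add_mono mult_left_mono) auto
    also have "ennreal (2 powr q) * ennreal (2 * l powr q * (N / s)) = ennreal (2 powr q * (2 * l powr q * N) / s)"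
      using N s by (simp add: ennreal_mult[symmetric])
    also have "\<dots> = ennreal (X / 2 / s)" by (simp only: lq)
    finally have fin: "ennreal (X / s) \<le> ennreal (2 powr q) * U_energy \<Omega> q g s x + ennreal (X / 2 / s)" .
    show "ennreal (\<kappa> / (2 * 2 powr q) * \<bar>g x\<bar> powr q / s) \<le> U_energy \<Omega> q g s x"
    proof (cases "U_energy \<Omega> q g s x")
      case (real v)
      have "ennreal (X / s) \<le> ennreal (2 powr q * v + X / 2 / s)"
        using fin real X s by (simp add: ennreal_mult)
      then have "X / s \<le> 2 powr q * v + X / 2 / s" using real X s by (subst (asm) ennreal_le_iff) auto
      then have "X / 2 / s \<le> 2 powr q * v" by (simp add: field_simps)
      then have "X / 2 / s / 2 powr q \<le> v"
        by (subst pos_divide_le_eq) (simp_all add: mult.commute[of v])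
      then have "\<kappa> / (2 * 2 powr q) * \<bar>g x\<bar> powr q / s \<le> v" by (simp add: X_def mult_ac)
      then show ?thesis using real by (simp add: ennreal_leI)
    qed simp
  qed
qed

lemma morrey_bd_liminf:
  assumes bd: "\<And>n::nat. morrey_bd (h n) b" and [measurable]: "\<And>n. h n \<in> borel_measurable M"
  shows "morrey_bd (\<lambda>x. liminf (\<lambda>n. h n x)) b"
  unfolding morrey_bd_def
proof (intro ballI allI impI)
  fix z R assume z [measurable]: "z \<in> space M" and R: "(0::real) < R"
  have "(\<integral>\<^sup>+y\<in>B z R. liminf (\<lambda>n. h n y) \<partial>M) = (\<integral>\<^sup>+y. liminf (\<lambda>n. h n y * indicator (B z R) y) \<partial>M)"
    by (intro nn_integral_cong) (auto simp: Liminf_const split: split_indicator)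
  also have "\<dots> \<le> liminf (\<lambda>n. \<integral>\<^sup>+y\<in>B z R. h n y \<partial>M)" by (intro nn_integral_liminf) measurable
  also have "\<dots> \<le> ennreal (b * (\<phi> z R powr p * vol z R))"
    by (intro Liminf_le always_eventually allI morrey_bdD[OF bd z R]) auto
  finally show "(\<integral>\<^sup>+y\<in>B z R. liminf (\<lambda>n. h n y) \<partial>M) \<le> ennreal (b * (\<phi> z R powr p * vol z R))" .
qed

text \<open>Take \<open>s\<close> along a sequence realising the lower limit and dominate the functionals by Morrey
  functions \<open>G n\<close> of nearly the same norm. Pointwise, \<open>s\<^sup>1\<^sup>/\<^sup>q G n\<close> is eventually at least a fixed multiple of
  \<open>\<bar>g\<bar>\<close> on \<open>\<Omega>\<close>, so Fatou's lemma on each ball bounds the Morrey norm of \<open>g\<close>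
  extended by 0.\<close>

lemma sobolev_liminf_ge:
  assumes \<Omega> [measurable]: "\<Omega> \<in> sets M" and q: "0 < q" "q < p"
    and gm [measurable]: "g \<in> borel_measurable M" and gf: "\<And>x. x \<in> \<Omega> \<Longrightarrow> g x = f x + a"
    and c: "0 < c" and low: "\<And>x. x \<in> \<Omega> \<Longrightarrow> g x \<noteq> 0 \<Longrightarrow>
      \<forall>\<^sub>F s in at_right 0. ennreal (c * \<bar>g x\<bar> powr q / s) \<le> U_energy \<Omega> q g s x"
    and less: "Liminf (at_right 0) (\<lambda>s. ennreal (s powr (1 / q)) * sobolev_seminorm M \<rho> p \<phi> \<Omega> s q f) < ennreal b"
    and b: "0 < b"
  shows "morrey_norm_mod_const M \<rho> p \<phi> \<Omega> f \<le> ennreal (b / c powr (1 / q))"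
proof -
  define X where "X s = ennreal (s powr (1 / q)) * sobolev_seminorm M \<rho> p \<phi> \<Omega> s q f" for s
  have freq: "\<exists>\<^sub>F s in at_right 0. X s < ennreal b"
  proof (rule ccontr)
    assume "\<not> (\<exists>\<^sub>F s in at_right 0. X s < ennreal b)"
    then have "\<forall>\<^sub>F s in at_right 0. ennreal b \<le> X s" by (simp add: frequently_def not_less)
    then have "ennreal b \<le> Liminf (at_right 0) X" by (rule Liminf_bounded)
    then show False using less by (simp add: X_def[abs_def])
  qed
  have "\<exists>s. 0 < s \<and> s < 1 / real (Suc n) \<and> X s < ennreal b" for n
  proof -
    have "\<forall>\<^sub>F s in at_right 0. s \<in> {0<..<1 / real (Suc n)}" by (intro eventually_at_right_real) auto
    from frequently_ex[OF frequently_eventually_conj[OF freq this]] show ?thesis by auto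
  qed
  then obtain S where S: "\<And>n. 0 < S n" "\<And>n. S n < 1 / real (Suc n)" "\<And>n. X (S n) < ennreal b" by metis
  have "S \<longlonglongrightarrow> 0"
  proof (rule tendsto_sandwich[OF _ _ tendsto_const])
    show "(\<lambda>n. 1 / real (Suc n)) \<longlonglongrightarrow> 0" using LIMSEQ_inverse_real_of_nat by (simp add: inverse_eq_divide)
  qed (use S in \<open>auto intro: less_imp_le always_eventually\<close>)
  then have Slim: "filterlim S (at_right 0) sequentially"
    using S(1) by (intro tendsto_imp_filterlim_at_right) auto
  have "\<exists>G\<in>morrey_space M \<rho> p \<phi>. morrey_norm M \<rho> p \<phi> G < ennreal (b / S n powr (1 / q)) \<and>
    (AE x in M. x \<in> \<Omega> \<longrightarrow> gagliardo M \<rho> \<Omega> (S n) q f x \<le> ennreal (G x))" for n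
  proof (rule morrey_outer_norm_lessD)
    have Sp: "0 < S n powr (1 / q)" using S(1)[of n] by simp
    have "X (S n) < ennreal b" by (rule S)
    then show "morrey_outer_norm_on M \<rho> p \<phi> \<Omega> (gagliardo M \<rho> \<Omega> (S n) q f) < ennreal (b / S n powr (1 / q))"
      unfolding X_def sobolev_seminorm_def using Sp b
      by (cases "morrey_outer_norm_on M \<rho> p \<phi> \<Omega> (gagliardo M \<rho> \<Omega> (S n) q f)")
        (auto simp: ennreal_mult[symmetric] ennreal_less_iff pos_less_divide_eq mult.commute ennreal_mult_top)
  qed
  then obtain G where G: "\<And>n. G n \<in> morrey_space M \<rho> p \<phi>"
    "\<And>n. morrey_norm M \<rho> p \<phi> (G n) < ennreal (b / S n powr (1 / q))"
    "\<And>n. AE x in M. x \<in> \<Omega> \<longrightarrow> gagliardo M \<rho> \<Omega> (S n) q f x \<le> ennreal (G n x)" by metis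
  have [measurable]: "G n \<in> borel_measurable M" for n by (rule morrey_spaceD(1)[OF G(1)])
  define h where "h n x = ennreal (S n powr (p / q)) * ennreal (\<bar>G n x\<bar> powr p)" for n x
  have [measurable]: "h n \<in> borel_measurable M" for n unfolding h_def by measurable
  have bdh: "morrey_bd (h n) (b powr p)" for n
  proof -
    have "morrey_bd (\<lambda>y. ennreal (\<bar>G n y\<bar> powr p)) ((b / S n powr (1 / q)) powr p)"
      using G(2)[of n] b by (intro morrey_spaceD(2)[OF G(1)]) auto
    then have "morrey_bd (h n) (S n powr (p / q) * (b / S n powr (1 / q)) powr p)"
      unfolding h_def by (intro morrey_bd_cmult) auto
    also have "S n powr (p / q) * (b / S n powr (1 / q)) powr p = b powr p"
      using S(1)[of n] b by (simp add: powr_divide powr_powr)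
    finally show ?thesis .
  qed
  define u where "u x = (if x \<in> \<Omega> then g x else 0)" for x
  have [measurable]: "u \<in> borel_measurable M" unfolding u_def by measurable
  have "AE x in M. \<forall>n. x \<in> \<Omega> \<longrightarrow> gagliardo M \<rho> \<Omega> (S n) q f x \<le> ennreal (G n x)"
    by (intro AE_all_countable[THEN iffD2] allI G(3))
  then have le: "AE x in M. ennreal (c powr (p / q)) * ennreal (\<bar>u x\<bar> powr p) \<le> liminf (\<lambda>n. h n x)"
  proof eventually_elim
    case (elim x)
    show ?case
    proof (cases "x \<in> \<Omega> \<and> g x \<noteq> 0")
      case True
      then have x: "x \<in> \<Omega>" "g x \<noteq> 0" by auto
      have "\<forall>\<^sub>F n in sequentially. ennreal (c * \<bar>g x\<bar> powr q / S n) \<le> U_energy \<Omega> q g (S n) x"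
        by (rule eventually_compose_filterlim[OF low[OF x] Slim])
      then have "\<forall>\<^sub>F n in sequentially. ennreal (c powr (p / q)) * ennreal (\<bar>u x\<bar> powr p) \<le> h n x"
      proof eventually_elim
        case (elim n)
        have "gagliardo M \<rho> \<Omega> (S n) q f x \<le> ennreal \<bar>G n x\<bar>"
          using \<open>\<forall>n. x \<in> \<Omega> \<longrightarrow> gagliardo M \<rho> \<Omega> (S n) q f x \<le> ennreal (G n x)\<close> x
          by (auto intro: order_trans ennreal_leI)
        then have "U_energy \<Omega> q g (S n) x \<le> ennreal (\<bar>G n x\<bar> powr q)"
          by (subst (asm) gagliardo_le_iff[OF x(1) gf q(1)]) auto
        with elim have "ennreal (c * \<bar>g x\<bar> powr q / S n) \<le> ennreal (\<bar>G n x\<bar> powr q)"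
          by (rule order_trans)
        then have "c * \<bar>g x\<bar> powr q / S n \<le> \<bar>G n x\<bar> powr q" by (subst (asm) ennreal_le_iff) auto
        then have "c * \<bar>g x\<bar> powr q \<le> S n * \<bar>G n x\<bar> powr q" using S(1)[of n] by (simp add: field_simps)
        then have "(c * \<bar>g x\<bar> powr q) powr (p / q) \<le> (S n * \<bar>G n x\<bar> powr q) powr (p / q)"
          using c q p_pos by (intro powr_mono2) auto
        then have "c powr (p / q) * \<bar>g x\<bar> powr p \<le> S n powr (p / q) * \<bar>G n x\<bar> powr p"
          using c q S(1)[of n] by (simp add: powr_mult powr_powr)
        then show ?case using x(1) by (simp add: h_def u_def ennreal_mult[symmetric] ennreal_leI)
      qed
      then show ?thesis by (rule Liminf_bounded)
    qed (auto simp: u_def)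
  qed
  have "morrey_bd (\<lambda>x. ennreal (c powr (p / q)) * ennreal (\<bar>u x\<bar> powr p)) (b powr p)"
    by (rule morrey_bd_mono[OF morrey_bd_liminf[OF bdh] le order_refl]) measurable
  then have "morrey_bd (\<lambda>x. ennreal (c powr (- (p / q))) * (ennreal (c powr (p / q)) * ennreal (\<bar>u x\<bar> powr p)))
      (c powr (- (p / q)) * b powr p)"
    by (intro morrey_bd_cmult) auto
  moreover have "ennreal (c powr (- (p / q))) * (ennreal (c powr (p / q)) * ennreal y) = ennreal y" if "0 \<le> y" for y
    using c that by (simp add: ennreal_mult[symmetric] powr_minus)
  ultimately have "morrey_bd (\<lambda>x. ennreal (\<bar>u x\<bar> powr p)) (c powr (- (p / q)) * b powr p)" by simp
  moreover have "c powr (- (p / q)) * b powr p = (b / c powr (1 / q)) powr p"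
    using b c by (simp add: powr_divide powr_powr powr_minus_divide)
  ultimately have bdu: "morrey_bd (\<lambda>x. ennreal (\<bar>u x\<bar> powr p)) ((b / c powr (1 / q)) powr p)" by simp
  have b': "0 \<le> b / c powr (1 / q)" using b by simp
  note u = morrey_spaceI[OF \<open>u \<in> borel_measurable M\<close> b' bdu]
  have "morrey_norm_mod_const M \<rho> p \<phi> \<Omega> f \<le> morrey_norm_on M \<rho> p \<phi> \<Omega> (\<lambda>x. ereal (f x + a))"
    unfolding morrey_norm_mod_const_def by (rule INF_lower) simp
  also have "\<dots> \<le> morrey_norm M \<rho> p \<phi> u"
    unfolding morrey_norm_on_def
  proof (intro Inf_lower CollectI exI[of _ u] conjI refl u(1))
    show "AE x in M. x \<in> \<Omega> \<longrightarrow> ereal (u x) = ereal (f x + a)" using gf by (simp add: u_def)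
  qed
  also have "\<dots> \<le> ennreal (b / c powr (1 / q))" by (rule u(2))
  finally show ?thesis .
qed

text \<open>An extension agreeing with \<open>f + a\<close> almost everywhere on \<open>\<Omega>\<close> may be redefined to agree everywhere
  on \<open>\<Omega>\<close>.\<close>

lemma morrey_norm_mod_const_lessD:
  assumes \<Omega> [measurable]: "\<Omega> \<in> sets M" and fm: "f \<in> borel_measurable (restrict_space M \<Omega>)"
    and less: "morrey_norm_mod_const M \<rho> p \<phi> \<Omega> f < ennreal b"
  shows "\<exists>a g. g \<in> borel_measurable M \<and> (\<forall>x\<in>\<Omega>. g x = f x + a) \<and>
    morrey_bd (\<lambda>y. ennreal (\<bar>g y\<bar> powr p)) (b powr p)"
proof -
  obtain a where "morrey_norm_on M \<rho> p \<phi> \<Omega> (\<lambda>x. ereal (f x + a)) < ennreal b"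
    using less by (auto simp: morrey_norm_mod_const_def INF_less_iff)
  then obtain g0 where g0: "g0 \<in> morrey_space M \<rho> p \<phi>" "morrey_norm M \<rho> p \<phi> g0 < ennreal b"
    and eq: "AE x in M. x \<in> \<Omega> \<longrightarrow> ereal (g0 x) = ereal (f x + a)"
    by (auto simp: morrey_norm_on_def Inf_less_iff)
  have g0m [measurable]: "g0 \<in> borel_measurable M" by (rule morrey_spaceD(1)[OF g0(1)])
  define g where "g x = (if x \<in> \<Omega> then f x + a else g0 x)" for x
  have fa: "(\<lambda>x. f x + a) \<in> borel_measurable (restrict_space M \<Omega>)" using fm by measurable
  have "g \<in> borel_measurable M"
    unfolding g_def using fa sets.sets_into_space[OF \<Omega>]
    by (subst measurable_If_restrict_space_iff)
      (auto intro!: measurable_restrict_space1 simp: Int_absorb2)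
  moreover have "\<forall>x\<in>\<Omega>. g x = f x + a" by (simp add: g_def)
  moreover have "0 \<le> b" using less by (cases "0 \<le> b") (auto simp: ennreal_neg)
  then have "morrey_bd (\<lambda>y. ennreal (\<bar>g0 y\<bar> powr p)) (b powr p)"
    using g0 by (intro morrey_spaceD(2)) auto
  then have "morrey_bd (\<lambda>y. ennreal (\<bar>g y\<bar> powr p)) (b powr p)"
  proof (rule morrey_bd_mono[OF _ _ order_refl])
    show "AE y in M. ennreal (\<bar>g y\<bar> powr p) \<le> ennreal (\<bar>g0 y\<bar> powr p)"
      using eq by eventually_elim (auto simp: g_def)
  qed
  ultimately show ?thesis by blast
qed

end

section \<open>The two-sided estimate\<close>

lemma morrey_weightE:
  assumes hom: "homogeneous_type M \<rho>" and p: "0 < p"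
    and G: "\<phi> \<in> G_dec M \<rho> p" and near: "nearness M \<rho> \<phi>"
  obtains K L A where "morrey_weight M \<rho> K L p \<phi> A"
proof -
  obtain K L where "homogeneous_space M \<rho> K L" using homogeneous_typeE[OF hom] .
  then interpret homogeneous_space M \<rho> K L .
  have pos: "\<And>x r. x \<in> space M \<Longrightarrow> 0 < r \<Longrightarrow> 0 < \<phi> x r" using G by (simp add: G_dec_def)
  obtain C1 where C1: "0 < C1" and N1: "\<And>x y r. x \<in> space M \<Longrightarrow> y \<in> space M \<Longrightarrow> 0 < r \<Longrightarrow> \<rho> x y \<le> r \<Longrightarrow>
      \<phi> x r / \<phi> y r \<le> C1"
    using near unfolding nearness_def by blast
  obtain C2 where C2: "0 < C2" and D2: "\<And>x r s. x \<in> space M \<Longrightarrow> 0 < r \<Longrightarrow> r < s \<Longrightarrow> \<phi> x s \<le> C2 * \<phi> x r"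
    using G unfolding G_dec_def almost_decreasing_def by blast
  define A where "A = 1 + C1 + C2"
  have "morrey_weight M \<rho> K L p \<phi> A"
  proof
    show "0 < p" by (rule p)
    show "1 \<le> A" using C1 C2 by (simp add: A_def)
    show "0 < \<phi> x r" if "x \<in> space M" "0 < r" for x r by (rule pos[OF that])
    show "\<phi> x r \<le> A * \<phi> y r" if "x \<in> space M" "y \<in> space M" "0 < r" "\<rho> x y \<le> r" for x y r
    proof -
      have "\<phi> x r \<le> C1 * \<phi> y r" using N1[OF that] pos[OF that(2,3)] by (simp add: field_simps)
      also have "\<dots> \<le> A * \<phi> y r" using pos[OF that(2,3)] C1 C2 by (intro mult_right_mono) (auto simp: A_def)
      finally show ?thesis .
    qed
    show "\<phi> x s \<le> A * \<phi> x r" if "x \<in> space M" "0 < r" "r \<le> s" for x r s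
    proof (cases "r = s")
      case True
      have "1 * \<phi> x r \<le> A * \<phi> x r" using pos[OF that(1,2)] C1 C2 by (intro mult_right_mono) (auto simp: A_def)
      with True show ?thesis by simp
    next
      case False
      then have "\<phi> x s \<le> C2 * \<phi> x r" using D2 that by simp
      also have "\<dots> \<le> A * \<phi> x r" using pos[OF that(1,2)] C1 C2 by (intro mult_right_mono) (auto simp: A_def)
      finally show ?thesis .
    qed
  qed
  then show ?thesis by (rule that)
qed

theorem theorem4p14:
  fixes M :: "'a measure" and \<rho> :: "'a \<Rightarrow> 'a \<Rightarrow> real" and \<Omega> :: "'a set"
    and p q :: real and \<phi> :: "'a \<Rightarrow> real \<Rightarrow> real"
  assumes "homogeneous_type M \<rho>" and "WRD M \<rho>"
    and "quasi_open M \<rho> \<Omega>" and "WMD M \<rho> \<Omega>"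
    and "0 < q" and "q < p"
    and "\<phi> \<in> G_dec M \<rho> p" and "nearness M \<rho> \<phi>"
    and "\<exists>C>0. \<forall>x\<in>space M. \<forall>r>0.
           (\<integral>\<^sup>+t\<in>{r<..}. ennreal (\<phi> x t / t) \<partial>lborel) \<le> ennreal (C * \<phi> x r)"
    and "(\<exists>C\<ge>1. \<forall>x\<in>space M. \<forall>r>0.
            1 / C \<le> \<phi> x r * measure M (qball M \<rho> x r) powr (1 / p) \<and>
            \<phi> x r * measure M (qball M \<rho> x r) powr (1 / p) \<le> C) \<or>
         ((\<forall>z\<in>space M. \<forall>R>0.
             filterlim (\<lambda>r. INF x\<in>qball M \<rho> z R. \<phi> x r) at_top (at_right 0)) \<and>
          (\<forall>x\<in>space M.
             filterlim (\<lambda>r. \<phi> x r * measure M (qball M \<rho> x r) powr (1 / p)) at_top at_top))"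
  shows "\<exists>C C'. 0 < C \<and> 0 < C' \<and>
    (\<forall>f \<in> morrey_space_mod_const M \<rho> p \<phi> \<Omega> \<inter> (\<Union>s\<in>{0<..<1}. sobolev_space M \<rho> p \<phi> \<Omega> s q).
       ennreal C * morrey_norm_mod_const M \<rho> p \<phi> \<Omega> f
         \<le> Liminf (at_right 0)
              (\<lambda>s. ennreal (s powr (1 / q)) * sobolev_seminorm M \<rho> p \<phi> \<Omega> s q f) \<and>
       Liminf (at_right 0)
              (\<lambda>s. ennreal (s powr (1 / q)) * sobolev_seminorm M \<rho> p \<phi> \<Omega> s q f)
         \<le> Limsup (at_right 0)
              (\<lambda>s. ennreal (s powr (1 / q)) * sobolev_seminorm M \<rho> p \<phi> \<Omega> s q f) \<and>
       Limsup (at_right 0)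
              (\<lambda>s. ennreal (s powr (1 / q)) * sobolev_seminorm M \<rho> p \<phi> \<Omega> s q f)
         \<le> ennreal C' * morrey_norm_mod_const M \<rho> p \<phi> \<Omega> f)"
proof -
  have q: "0 < q" "q < p" using assms(5,6) .
  have p: "0 < p" using q by simp
  obtain K L A where "morrey_weight M \<rho> K L p \<phi> A"
    using morrey_weightE[OF assms(1) p assms(7,8)] .
  then interpret morrey_weight M \<rho> K L p \<phi> A .
  have \<Omega>: "\<Omega> \<in> sets M" using assms(3) by (rule quasi_open_measurable)
  have sub: "\<Omega> \<subseteq> space M" using sets.sets_into_space[OF \<Omega>] .
  obtain \<kappa> where \<kappa>: "0 < \<kappa>" and low: "\<And>x. x \<in> space M \<Longrightarrow> \<exists>R0>0. \<forall>R\<ge>R0. \<forall>\<^sub>F s in at_right 0.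
    ennreal (\<kappa> / s) \<le> (\<integral>\<^sup>+y\<in>{y \<in> \<Omega>. R \<le> \<rho> x y}. ennreal (kern (s * q) x y) \<partial>M)"
    using far_kernel_lower_eventually[OF assms(2,4) \<Omega> q(1)] by blast
  obtain C\<phi> where C\<phi>: "\<And>x. x \<in> space M \<Longrightarrow>
      (\<integral>\<^sup>+t\<in>{1<..}. ennreal (\<phi> x t / t) \<partial>lborel) \<le> ennreal (C\<phi> * \<phi> x 1)"
    using assms(9) zero_less_one by blast
  define c where "c = \<kappa> / (2 * 2 powr q)"
  define C where "C = c powr (1 / q)"
  define C' where "C' = limsup_const q"
  have c: "0 < c" using \<kappa> by (simp add: c_def)
  have C: "0 < C" using c by (simp add: C_def)
  have C': "0 < C'"
  proof -
    have "0 < 2 + avg_const * (1 + 1 / (q * ln 2))"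
      using avg_const_nonneg q by (intro add_pos_nonneg mult_nonneg_nonneg) auto
    then show ?thesis using upper_const_ge(1)[OF q(1)] by (simp add: C'_def limsup_const_def)
  qed
  show ?thesis
  proof (rule exI[of _ C], rule exI[of _ C'], intro conjI ballI C C')
    fix f assume f: "f \<in> morrey_space_mod_const M \<rho> p \<phi> \<Omega> \<inter> (\<Union>s\<in>{0<..<1}. sobolev_space M \<rho> p \<phi> \<Omega> s q)"
    define X where "X s = ennreal (s powr (1 / q)) * sobolev_seminorm M \<rho> p \<phi> \<Omega> s q f" for s
    have fm: "f \<in> borel_measurable (restrict_space M \<Omega>)"
      and fin: "morrey_norm_mod_const M \<rho> p \<phi> \<Omega> f < \<infinity>" using f by (auto simp: morrey_space_mod_const_def)
    obtain s0 where s0: "0 < s0" "s0 < 1" "sobolev_seminorm M \<rho> p \<phi> \<Omega> s0 q f < \<infinity>"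
      using f by (auto simp: sobolev_space_def)
    obtain v where v: "0 \<le> v" "morrey_norm_mod_const M \<rho> p \<phi> \<Omega> f = ennreal v"
      using fin by (cases "morrey_norm_mod_const M \<rho> p \<phi> \<Omega> f") auto
    show "Liminf (at_right 0) (\<lambda>s. ennreal (s powr (1 / q)) * sobolev_seminorm M \<rho> p \<phi> \<Omega> s q f)
         \<le> Limsup (at_right 0) (\<lambda>s. ennreal (s powr (1 / q)) * sobolev_seminorm M \<rho> p \<phi> \<Omega> s q f)"
      by (intro Liminf_le_Limsup) simp
    have "Limsup (at_right 0) X \<le> ennreal (C' * v)"
    proof (rule ennreal_le_epsilon)
      fix e :: real assume e: "0 < e"
      define b where "b = v + e / C'"
      have b: "0 < b" "v < b" using v e C' by (auto simp: b_def add_nonneg_pos)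
      have "morrey_norm_mod_const M \<rho> p \<phi> \<Omega> f < ennreal b" using v b by (simp add: ennreal_less_iff)
      then obtain a g where g: "g \<in> borel_measurable M" "\<And>x. x \<in> \<Omega> \<Longrightarrow> g x = f x + a"
        "morrey_bd (\<lambda>y. ennreal (\<bar>g y\<bar> powr p)) (b powr p)"
        using morrey_norm_mod_const_lessD[OF \<Omega> fm] by blast
      have "Limsup (at_right 0) X \<le> ennreal (C' * b)"
        unfolding X_def C'_def by (rule sobolev_limsup_le[OF \<Omega> q g(1,2) b(1) g(3) s0])
      also have "C' * b = C' * v + e" using C' by (simp add: b_def algebra_simps)
      finally show "Limsup (at_right 0) X \<le> ennreal (C' * v) + ennreal e" using C' v e by simp
    qed
    then show "Limsup (at_right 0) (\<lambda>s. ennreal (s powr (1 / q)) * sobolev_seminorm M \<rho> p \<phi> \<Omega> s q f)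
         \<le> ennreal C' * morrey_norm_mod_const M \<rho> p \<phi> \<Omega> f"
      using C' v by (simp add: X_def[abs_def] ennreal_mult)
    have "ennreal (C * v) \<le> Liminf (at_right 0) X"
    proof (rule ennreal_le_epsilon)
      fix e :: real assume fin: "Liminf (at_right 0) X < top" and e: "0 < e"
      obtain l where l: "0 \<le> l" "Liminf (at_right 0) X = ennreal l"
        using fin by (cases "Liminf (at_right 0) X") auto
      obtain a g where g: "g \<in> borel_measurable M" "\<And>x. x \<in> \<Omega> \<Longrightarrow> g x = f x + a"
        "morrey_bd (\<lambda>y. ennreal (\<bar>g y\<bar> powr p)) ((v + 1) powr p)"
        using morrey_norm_mod_const_lessD[OF \<Omega> fm, of "v + 1"] v by (auto simp: ennreal_less_iff)
      have "morrey_norm_mod_const M \<rho> p \<phi> \<Omega> f \<le> ennreal ((l + e) / c powr (1 / q))"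
      proof (rule sobolev_liminf_ge[OF \<Omega> q g(1,2) c])
        show "\<forall>\<^sub>F s in at_right 0. ennreal (c * \<bar>g x\<bar> powr q / s) \<le> U_energy \<Omega> q g s x"
          if x: "x \<in> \<Omega>" "g x \<noteq> 0" for x
          unfolding c_def
        proof (rule U_energy_lower_eventually[OF \<Omega> x(1) q g(1) _ g(3) _ \<kappa> low x(2)])
          show "0 < v + 1" using v by simp
          show "x \<in> space M" using x sub by blast
          then show "\<exists>r0>0. \<forall>r\<ge>r0. \<phi> x r \<le> \<epsilon>" if "0 < \<epsilon>" for \<epsilon>
            using that C\<phi> by (intro phi_vanishes) auto
        qed
        show "Liminf (at_right 0) (\<lambda>s. ennreal (s powr (1 / q)) * sobolev_seminorm M \<rho> p \<phi> \<Omega> s q f) < ennreal (l + e)"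
          using l e unfolding X_def[abs_def] by (simp add: ennreal_less_iff)
        show "0 < l + e" using l e by simp
      qed
      then have "v \<le> (l + e) / C" using v l e C by (simp add: C_def)
      then have "C * v \<le> l + e" using C by (simp add: field_simps)
      then show "ennreal (C * v) \<le> Liminf (at_right 0) X + ennreal e"
        using l e by (simp flip: ennreal_plus add: ennreal_leI)
    qed
    then show "ennreal C * morrey_norm_mod_const M \<rho> p \<phi> \<Omega> f
         \<le> Liminf (at_right 0) (\<lambda>s. ennreal (s powr (1 / q)) * sobolev_seminorm M \<rho> p \<phi> \<Omega> s q f)"
      using C v by (simp add: X_def[abs_def] ennreal_mult)
  qed
qed

end
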